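(* Let $r\geq 2$, $t\geq 2$ with $t\mid n$, and $\alpha\in(0,1]$ with $\alpha n/t$ an integer and $\alpha\leq\min(1/2,(r-1)^{-1/2})$. Consider the joint distribution $\mathcal{P}$ on $(x,b,M,w)$, $x\in\mathbb{Z}_r^n$, $b\in\{\mathsf{YES},\mathsf{NO}\}$, $M\in\mathcal{M}^\alpha_{t,n}$, $w\in\mathbb{Z}_r^{\alpha n/t}$, given by \[ \Pr[x,\mathsf{YES},M,w]=\tfrac12 p_xp_M[Mx=w],\qquad \Pr[x,\mathsf{NO},M,w]=\tfrac12p_xp_Mp_w, \] where $p_x=r^{-n}$, $p_M=|\mathcal{M}^\alpha_{t,n}|^{-1}$, $p_w=r^{-\alpha n/t}$. Given any map $x\mapsto\rho_x$ from $\mathbb{Z}_r^n$ to $m$-qubit density matrices, define for each $(M,w)$ of positive probability $\rho^{M,w}_{b}=\sum_x\Pr[x\mid b,M,w]\rho_x$ for $b\in\{\mathsf{YES},\mathsf{NO}\}$. There is a universal constant $\gamma>0$ (independent of $n,t,r,\alpha$) such that for all $\varepsilon>0$, if $m\leq\frac{\gamma}{r^{1+1/t}}(\frac{\varepsilon^2}{\alpha})^{2/t}(n/t)^{1-2/t}$, then \[ \mathbb{E}_{(M,w)\sim\mathcal{P}_{M,w}}\Big[\big\|\Pr[\mathsf{YES}\mid M,w]\,\rho^{M,w}_{\mathsf{YES}}-\Pr[\mathsf{NO}\mid M,w]\,\rho^{M,w}_{\mathsf{NO}}\big\|_1\Big]\leq\varepsilon^2, \] where $\mathcal{P}_{M,w}$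 is the marginal of $\mathcal{P}$ on $(M,w)$.
   Context: $\mathcal{M}^\alpha_{t,n}$ is the set of $\alpha$-partial $t$-hypermatchings on $[n]$: sequences of $\alpha n/t$ pairwise disjoint hyperedges, each consisting of $t$ distinct elements of $[n]$. $M$ is identified with its incidence matrix in $\{0,1\}^{\alpha n/t\times n}$ (row $i$ is the indicator of the $i$-th hyperedge), and $Mx$ is computed over $\mathbb{Z}_r$. $[\cdot]$ is the indicator of an event. $\|\cdot\|_1$ is the trace norm (sum of singular values). *)

theory Defs
  imports
    "HOL-Probability.Probability_Mass_Function"
    "Jordan_Normal_Form.Schur_Decomposition"
begin

(* Dimensions vary with the data and are quantified inside the statement, so vectors and
   matrices are those of Jordan_Normal_Form; the competing syntax for type-indexed vectors
   is switched off. *)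
unbundle no vec_syntax
unbundle no inner_syntax

section \<open>Partial hypermatchings and their incidence matrices\<close>

text \<open>The number \<open>\<alpha>n/t\<close> of hyperedges; \<open>\<alpha>n/t\<close> is always assumed to be an integer, so nothing
  is rounded.\<close>

definition num_edges :: "real \<Rightarrow> nat \<Rightarrow> nat \<Rightarrow> nat" where
  "num_edges \<alpha> t n = nat \<lfloor>\<alpha> * real n / real t\<rfloor>"

text \<open>Sequences of hyperedges are lists (so the order matters), a hyperedge is a set of \<open>t\<close>
  vertices, and the vertex set \<open>[n]\<close> is \<open>{0, \<dots>, n-1}\<close>, in accordance with the indexing of
  matrices and vectors.\<close>

definition hypermatchings :: "real \<Rightarrow> nat \<Rightarrow> nat \<Rightarrow> nat set list set" where
  "hypermatchings \<alpha> t n =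
     {M. length M = num_edges \<alpha> t n \<and>
         (\<forall>i<length M. M ! i \<subseteq> {..<n} \<and> card (M ! i) = t) \<and>
         (\<forall>i<length M. \<forall>j<length M. i \<noteq> j \<longrightarrow> M ! i \<inter> M ! j = {})}"

definition incidence_mat :: "nat \<Rightarrow> nat set list \<Rightarrow> int mat" where
  "incidence_mat n M =
     Matrix.mat (length M) n (\<lambda>(i, j). if j \<in> M ! i then 1 else 0)"

text \<open>\<open>\<int>\<^sub>r\<^sup>k\<close>, each residue class being represented by its element in \<open>{0, \<dots>, r-1}\<close>.\<close>

definition Zr_vecs :: "nat \<Rightarrow> nat \<Rightarrow> int Matrix.vec set" where
  "Zr_vecs r k = {x \<in> carrier_vec k. \<forall>i<k. x $ i \<in> {0..<int r}}"

definition apply_matching :: "nat \<Rightarrow> nat set list \<Rightarrow> int Matrix.vec \<Rightarrow> int Matrix.vec" where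
  "apply_matching r M x = map_vec (\<lambda>a. a mod int r) (incidence_mat (dim_vec x) M *\<^sub>v x)"


section \<open>The joint distribution\<close>

datatype answer = YES | NO

type_synonym outcome = "int Matrix.vec \<times> answer \<times> nat set list \<times> int Matrix.vec"

definition joint_mass :: "nat \<Rightarrow> nat \<Rightarrow> nat \<Rightarrow> real \<Rightarrow> outcome \<Rightarrow> real" where
  "joint_mass r t n \<alpha> = (\<lambda>(x, b, M, w).
     let k = num_edges \<alpha> t n;
         p\<^sub>x = 1 / real r ^ n;
         p\<^sub>M = 1 / real (card (hypermatchings \<alpha> t n));
         p\<^sub>w = 1 / real r ^ k
     in if x \<in> Zr_vecs r n \<and> M \<in> hypermatchings \<alpha> t n \<and> w \<in> Zr_vecs r k
        then (case b of YES \<Rightarrow> 1/2 * p\<^sub>x * p\<^sub>M * of_bool (apply_matching r M x = w)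
                      | NO \<Rightarrow> 1/2 * p\<^sub>x * p\<^sub>M * p\<^sub>w)
        else 0)"

text \<open>That \<^const>\<open>joint_mass\<close> really is a probability mass function, so that the following
  definition is meaningful, is shown in \<open>pmf_joint_pmf\<close> below.\<close>

definition joint_pmf :: "nat \<Rightarrow> nat \<Rightarrow> nat \<Rightarrow> real \<Rightarrow> outcome pmf" where
  "joint_pmf r t n \<alpha> = embed_pmf (joint_mass r t n \<alpha>)"

definition marginal_Mw :: "outcome pmf \<Rightarrow> (nat set list \<times> int Matrix.vec) pmf" where
  "marginal_Mw P = map_pmf (\<lambda>(x, b, M, w). (M, w)) P"

definition prob_answer :: "outcome pmf \<Rightarrow> answer \<Rightarrow> nat set list \<Rightarrow> int Matrix.vec \<Rightarrow> real" where
  "prob_answer P b M w =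
     \<P>(z in measure_pmf P. (case z of (x', b', M', w') \<Rightarrow> b' = b)
        \<bar> (case z of (x', b', M', w') \<Rightarrow> M' = M \<and> w' = w))"

definition prob_input ::
  "outcome pmf \<Rightarrow> int Matrix.vec \<Rightarrow> answer \<Rightarrow> nat set list \<Rightarrow> int Matrix.vec \<Rightarrow> real" where
  "prob_input P x b M w =
     \<P>(z in measure_pmf P. (case z of (x', b', M', w') \<Rightarrow> x' = x)
        \<bar> (case z of (x', b', M', w') \<Rightarrow> b' = b \<and> M' = M \<and> w' = w))"


section \<open>Density matrices and the trace norm\<close>

definition density_matrix :: "nat \<Rightarrow> complex mat \<Rightarrow> bool" where
  "density_matrix m A \<longleftrightarrow>
     A \<in> carrier_mat (2 ^ m) (2 ^ m) \<and>
     mat_adjoint A = A \<and>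
     (\<forall>v \<in> carrier_vec (2 ^ m). (A *\<^sub>v v) \<bullet>c v \<ge> 0) \<and>
     (\<Sum>i<2 ^ m. A $$ (i, i)) = 1"

text \<open>Singular values are the square roots of the eigenvalues of \<open>A\<^sup>* A\<close>, with multiplicity.
  These eigenvalues are nonnegative reals, so taking real parts loses nothing.\<close>

definition singular_values :: "complex mat \<Rightarrow> real multiset" where
  "singular_values A =
     image_mset (\<lambda>e. sqrt (Re e)) (proots (char_poly (mat_adjoint A * A)))"

definition trace_norm :: "complex mat \<Rightarrow> real" where
  "trace_norm A = \<Sum>\<^sub># (singular_values A)"

text \<open>The posterior state \<open>\<Sum>\<^sub>x Pr[x | b, M, w] \<rho>\<^sub>x\<close>, where the sum of \<open>2\<^sup>m \<times> 2\<^sup>m\<close> matrices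
  over \<open>x \<in> \<int>\<^sub>r\<^sup>n\<close> is written out entrywise.\<close>

definition posterior_state ::
  "nat \<Rightarrow> nat \<Rightarrow> nat \<Rightarrow> (int Matrix.vec \<Rightarrow> complex mat) \<Rightarrow> outcome pmf \<Rightarrow>
     answer \<Rightarrow> nat set list \<Rightarrow> int Matrix.vec \<Rightarrow> complex mat" where
  "posterior_state r n m \<rho> P b M w =
     Matrix.mat (2 ^ m) (2 ^ m) (\<lambda>(i, j).
       \<Sum>x\<in>Zr_vecs r n. complex_of_real (prob_input P x b M w) * \<rho> x $$ (i, j))"


section \<open>Well-definedness of the joint distribution\<close>

lemma Zr_vecs_eq_image:
  "Zr_vecs r k = (\<lambda>f. Matrix.vec k f) ` (PiE {..<k} (\<lambda>_. {0..<int r}))" (is "_ = ?F ` ?A")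
proof (intro Set.set_eqI iffI)
  fix x assume x: "x \<in> Zr_vecs r k"
  have "x = ?F (restrict (\<lambda>i. x $ i) {..<k})"
    using x by (intro eq_vecI) (auto simp: Zr_vecs_def)
  moreover have "restrict (\<lambda>i. x $ i) {..<k} \<in> ?A"
    using x by (auto simp: Zr_vecs_def)
  ultimately show "x \<in> ?F ` ?A" by blast
next
  fix x assume "x \<in> ?F ` ?A"
  then obtain f where x: "x = Matrix.vec k f" and f: "f \<in> ?A" by blast
  have "f i \<in> {0..<int r}" if "i < k" for i
    using PiE_mem[OF f, of i] that by blast
  then show "x \<in> Zr_vecs r k"
    unfolding Zr_vecs_def x by simp
qed

lemma finite_Zr_vecs: "finite (Zr_vecs r k)"
  unfolding Zr_vecs_eq_image by (intro finite_imageI finite_PiE) auto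

lemma card_Zr_vecs: "card (Zr_vecs r k) = r ^ k"
proof -
  have "inj_on (\<lambda>f. Matrix.vec k f) (PiE {..<k} (\<lambda>_. {0..<int r}))"
  proof (rule inj_onI)
    fix f g assume f: "f \<in> PiE {..<k} (\<lambda>_. {0..<int r})" and g: "g \<in> PiE {..<k} (\<lambda>_. {0..<int r})"
      and eq: "Matrix.vec k f = Matrix.vec k g"
    have "f i = g i" if "i < k" for i
      using arg_cong[OF eq, of "\<lambda>v. v $ i"] that by simp
    with f g show "f = g" by (intro PiE_ext[OF f g]) auto
  qed
  then show ?thesis
    unfolding Zr_vecs_eq_image by (simp add: card_image card_PiE)
qed

lemma finite_hypermatchings: "finite (hypermatchings \<alpha> t n)"
proof (rule finite_subset)
  show "hypermatchings \<alpha> t n \<subseteq> {M. set M \<subseteq> Pow {..<n} \<and> length M = num_edges \<alpha> t n}"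
  proof (intro subsetI CollectI conjI)
    fix M e assume M: "M \<in> hypermatchings \<alpha> t n"
    show "length M = num_edges \<alpha> t n" using M by (simp add: hypermatchings_def)
    show "e \<in> Pow {..<n}" if "e \<in> set M"
      using M that unfolding hypermatchings_def in_set_conv_nth by blast
  qed
  show "finite {M. set M \<subseteq> Pow {..<n} \<and> length M = num_edges \<alpha> t n}"
    by (intro finite_lists_length_eq) auto
qed

lemma hypermatchings_nonempty:
  assumes "t > 0" "0 \<le> \<alpha>" "\<alpha> \<le> 1"
  shows "hypermatchings \<alpha> t n \<noteq> {}"
proof -
  define k where "k = num_edges \<alpha> t n"
  define M where "M = map (\<lambda>i. {i * t..<Suc i * t}) [0..<k]"
  have "real k \<le> \<alpha> * real n / real t"
    unfolding k_def num_edges_def using assms by (simp add: of_nat_nat)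
  also have "\<dots> \<le> real n / real t"
    using assms by (intro divide_right_mono) (auto simp: mult_left_le_one_le)
  finally have "real k * real t \<le> real n"
    using assms by (simp add: field_simps)
  then have kt: "k * t \<le> n" by (metis of_nat_le_iff of_nat_mult)
  have le: "Suc i * t \<le> n" if "i < k" for i
    using kt mult_le_mono1[of "Suc i" k t] that by linarith
  have disj: "{i * t..<Suc i * t} \<inter> {j * t..<Suc j * t} = {}" if "i < j" for i j
  proof -
    have "Suc i * t \<le> j * t" using that by (intro mult_le_mono1) simp
    then show ?thesis by auto
  qed
  have "M \<in> hypermatchings \<alpha> t n"
    unfolding hypermatchings_def
  proof (intro CollectI conjI allI impI)
    show "length M = num_edges \<alpha> t n" by (simp add: M_def k_def)
  next
    fix i assume "i < length M"
    then have i: "i < k" "M ! i = {i * t..<Suc i * t}" by (auto simp: M_def)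
    show "M ! i \<subseteq> {..<n}" using le[OF i(1)] unfolding i(2) by auto
    show "card (M ! i) = t" unfolding i(2) by simp
  next
    fix i j assume ij: "i < length M" "j < length M" "i \<noteq> j"
    then have "M ! i = {i * t..<Suc i * t}" "M ! j = {j * t..<Suc j * t}"
      by (auto simp: M_def)
    with ij(3) disj[of i j] disj[of j i] show "M ! i \<inter> M ! j = {}"
      by (metis Int_commute linorder_neqE_nat)
  qed
  then show ?thesis by blast
qed

lemma apply_matching_in_Zr_vecs:
  assumes "r > 0" "M \<in> hypermatchings \<alpha> t n"
  shows "apply_matching r M x \<in> Zr_vecs r (num_edges \<alpha> t n)"
proof -
  have "length M = num_edges \<alpha> t n"
    using assms(2) by (simp add: hypermatchings_def)
  then have dim: "dim_vec (apply_matching r M x) = num_edges \<alpha> t n"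
    by (simp add: apply_matching_def incidence_mat_def)
  have "apply_matching r M x $ i \<in> {0..<int r}" if "i < num_edges \<alpha> t n" for i
  proof -
    have "i < dim_vec (incidence_mat (dim_vec x) M *\<^sub>v x)"
      using that dim unfolding apply_matching_def by (simp only: index_map_vec)
    then have "apply_matching r M x $ i = (incidence_mat (dim_vec x) M *\<^sub>v x) $ i mod int r"
      unfolding apply_matching_def by (rule index_map_vec(1))
    then show ?thesis
      using assms(1) by (simp only: atLeastLessThan_iff) simp
  qed
  with dim show ?thesis
    unfolding Zr_vecs_def carrier_vec_def by blast
qed

lemma pmf_joint_pmf:
  assumes "r > 0" "t > 0" "0 \<le> \<alpha>" "\<alpha> \<le> 1"
  shows "pmf (joint_pmf r t n \<alpha>) z = joint_mass r t n \<alpha> z"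
  unfolding joint_pmf_def
proof (rule pmf_embed_pmf)
  define k where "k = num_edges \<alpha> t n"
  define X where "X = Zr_vecs r n"
  define H where "H = hypermatchings \<alpha> t n"
  define W where "W = Zr_vecs r k"
  define S where "S = X \<times> (UNIV :: answer set) \<times> H \<times> W"
  have UNIV_answer: "(UNIV :: answer set) = {YES, NO}"
    using answer.exhaust by blast
  have finX: "finite X" and finW: "finite W" and finH: "finite H"
    by (simp_all add: X_def W_def H_def finite_Zr_vecs finite_hypermatchings)
  have finS: "finite S"
    unfolding S_def using finX finW finH by (simp add: UNIV_answer)
  have cH: "card H > 0"
    using hypermatchings_nonempty[of t \<alpha> n] assms finH by (simp add: H_def card_gt_0_iff)
  have cX: "real (card X) = real r ^ n" and cW: "real (card W) = real r ^ k"
    by (simp_all add: X_def W_def card_Zr_vecs)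
  show nonneg: "\<And>z. 0 \<le> joint_mass r t n \<alpha> z"
    by (auto simp: joint_mass_def Let_def split: answer.split)
  have zero: "joint_mass r t n \<alpha> z = 0" if "z \<notin> S" for z
  proof -
    obtain x b M w where z: "z = (x, b, M, w)" by (cases z)
    have "\<not> (x \<in> X \<and> M \<in> H \<and> w \<in> W)"
      using that unfolding z S_def by blast
    then show ?thesis
      unfolding z joint_mass_def Let_def prod.case X_def H_def W_def k_def by (rule if_not_P)
  qed
  have delta: "(\<Sum>w\<in>W. c * of_bool (a = w)) = c" if "a \<in> W" for a and c :: real
  proof -
    have "(\<Sum>w\<in>W. c * of_bool (a = w)) = (\<Sum>w\<in>W. if a = w then c else 0)"
      by (intro sum.cong refl) simp
    also have "\<dots> = c" using that finW by simp
    finally show ?thesis .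
  qed
  let ?c = "1/2 * (1 / real r ^ n) * (1 / real (card H))"
  have "(\<Sum>z\<in>S. joint_mass r t n \<alpha> z) =
        (\<Sum>x\<in>X. \<Sum>b\<in>UNIV. \<Sum>M\<in>H. \<Sum>w\<in>W. joint_mass r t n \<alpha> (x, b, M, w))"
    unfolding S_def by (simp add: sum.cartesian_product case_prod_unfold)
  also have "\<dots> = (\<Sum>x\<in>X. (\<Sum>M\<in>H. \<Sum>w\<in>W. ?c * of_bool (apply_matching r M x = w)) +
                         (\<Sum>M\<in>H. \<Sum>w\<in>W. ?c * (1 / real r ^ k)))"
    by (intro sum.cong refl)
       (simp add: UNIV_answer joint_mass_def Let_def X_def H_def W_def k_def)
  also have "\<dots> = (\<Sum>x\<in>X. (\<Sum>M\<in>H. ?c) + (\<Sum>M\<in>H. ?c))"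
  proof (intro sum.cong refl arg_cong2[where f = "(+)"])
    fix x M assume "x \<in> X" "M \<in> H"
    then have "apply_matching r M x \<in> W"
      using apply_matching_in_Zr_vecs assms(1) by (simp add: H_def W_def k_def)
    then show "(\<Sum>w\<in>W. ?c * of_bool (apply_matching r M x = w)) = ?c"
      by (rule delta)
  next
    show "(\<Sum>w\<in>W. ?c * (1 / real r ^ k)) = ?c"
      using assms(1) by (simp add: cW)
  qed
  also have "\<dots> = 1"
    using cH assms(1) by (simp add: cX)
  finally have "(\<Sum>z\<in>S. joint_mass r t n \<alpha> z) = 1" .
  moreover have "(\<integral>\<^sup>+ z. ennreal (joint_mass r t n \<alpha> z) \<partial>count_space UNIV) =
                 (\<Sum>z\<in>S. ennreal (joint_mass r t n \<alpha> z))"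
    using finS zero by (intro nn_integral_count_space'[where A = S]) auto
  ultimately show "(\<integral>\<^sup>+ z. ennreal (joint_mass r t n \<alpha> z) \<partial>count_space UNIV) = 1"
    using nonneg by (simp add: sum_ennreal)
qed

end

theory Submission
  imports Defs
begin

text \<open>For a Hermitian matrix the trace norm is the pairing with some unitary. Choosing such a unitary
  \<open>U\<^bsub>M,w\<^esub>\<close> for every \<open>(M, w)\<close> and expanding \<open>r\<^sup>k [Mx = w] - 1\<close> in characters turns the
  expectation into \<open>\<Sum>\<^bsub>l\<ge>1\<^esub> E\<^sub>x Tr (\<rho>\<^sub>x G\<^sub>l(x))\<close>, where \<open>G\<^sub>l\<close> collects the dual vectors \<open>s \<in> \<int>\<^sub>r\<^sup>k\<close> with
  \<open>l\<close> nonzero entries. For \<open>q = 2\<^sup>a\<close> a density matrix satisfies \<open>|Tr (\<rho> G)|\<^bsup>2q\<^esup> \<le> Tr ((G G\<^sup>*)\<^sup>q)\<close>. In the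
  expansion of the right-hand side every product of the \<open>U\<^bsub>M,w\<^esub>\<close> is unitary and hence has trace at
  most \<open>2\<^sup>m\<close>, so the matrix moment is at most \<open>2\<^sup>m\<close> times the moment of an explicit scalar function
  with nonnegative Fourier coefficients on level \<open>t l\<close>. Scalar hypercontractivity over \<open>\<int>\<^sub>r\<close> with
  constant \<open>9 q r\<close> bounds that moment by the Fourier energy, which is at most
  \<open>(r-1)\<^sup>l (k choose l)\<^sup>2 / (4 (n choose t l))\<close> by the symmetry of the vertices. Taking \<open>q\<close> of order
  \<open>m / (t l)\<close> makes the bounds for the levels sum to at most \<open>\<epsilon>\<^sup>2\<close>.\<close>

text \<open>The shape of the memory bound can be read off the factors of one level. Each of the
  \<open>t * l\<close> nonzero coordinates of a frequency costs \<open>9 * q * r\<close>, and the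
  dual vectors of weight \<open>l\<close> contribute \<open>(r - 1) ^ l\<close>; together they give
  about \<open>r ^ ((t + 1) * l)\<close>, whose root of order \<open>t * l\<close> is
  \<open>r powr (1 + 1 / t)\<close>. With \<open>N = n / t\<close>, the number
  \<open>n choose (t * l)\<close> is at least the \<open>t\<close>-th power of
  \<open>N choose l\<close>, and the squared \<open>k choose l\<close> cancels two of these factors;
  this leaves \<open>t - 2\<close>, hence the exponent \<open>1 - 2 / t\<close>. The dimension
  \<open>2 ^ m\<close> enters a moment once, whatever its order, so a high moment makes it cheap,
  while the constant \<open>9 * q * r\<close> grows with the order; \<open>q\<close> of order
  \<open>m / (t * l)\<close> balances the two. Far up, where \<open>t * l\<close> exceeds
  \<open>12 * m\<close>, this balance would need \<open>q < 1\<close>. The assumption \<alpha> \<le>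
  1/2 yields \<open>2 * l \<le> N\<close> on every level, so that \<open>N choose l\<close> grows
  geometrically in \<open>l\<close>; the assumption \<alpha> \<le>
  \<open>(r - 1) powr (-1/2)\<close> keeps the factors \<alpha>^2 (r - 1) of the high levels at most
  1.\<close>

section \<open>Scalar inequalities for even moments of a mean-zero perturbation\<close>

lemma add_power_ge_bernoulli:
  fixes a b :: real
  assumes "1 \<le> a" "0 \<le> b"
  shows "a ^ q + real q * b \<le> (a + b) ^ q"
proof (induction q)
  case (Suc q)
  have "a ^ Suc q + real (Suc q) * b \<le> a * (a ^ q + real q * b) + b * (a^q + real q * b)"
  proof -
    have "1 \<le> a ^ q" using assms by simp
    hence "b * 1 \<le> b * (a^q)" using assms by (intro mult_left_mono) auto
    moreover have "1 * (real q * b) \<le> a * (real q * b)" using assms by (intro mult_right_mono) auto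
    moreover have "0 \<le> b * (real q * b)" using assms by simp
    ultimately show ?thesis by (simp add: algebra_simps)
  qed
  also have "\<dots> = (a + b) * (a^q + real q * b)" by (simp add: algebra_simps)
  also have "\<dots> \<le> (a + b) * (a + b)^q" using Suc assms by (intro mult_left_mono) auto
  finally show ?case by simp
qed simp

lemma exp_le_quadratic:
  fixes z :: real
  assumes "z \<le> 1"
  shows "exp z \<le> 1 + z + z\<^sup>2"
proof (cases "0 \<le> z")
  case True
  then show ?thesis using exp_bound[of z] assms by simp
next
  case False
  have "1 - z \<le> exp (- z)" using exp_ge_add_one_self[of "-z"] by simp
  hence "exp z \<le> 1 / (1 - z)"
    using False by (simp add: exp_minus field_simps)
  also have "\<dots> \<le> 1 + z + z\<^sup>2"
  proof -
    have "(1 + z + z\<^sup>2) * (1 - z) = 1 - z ^ 3"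
      by (simp add: algebra_simps power2_eq_square power3_eq_cube)
    moreover have "z ^ 3 \<le> 0" using False by (simp add: power3_eq_cube mult_nonneg_nonpos zero_le_mult_iff mult_le_0_iff)
    ultimately show ?thesis using False by (simp add: divide_le_eq)
  qed
  finally show ?thesis .
qed

text \<open>The first-order term is kept exact, so that it can cancel on averaging, and everything
  else is pushed into the quadratic term. If \<open>4 * q * cmod z \<le> 1\<close>, the quadratic
  bound on the exponential applies; otherwise linear terms are themselves dominated by quadratic
  ones.\<close>

lemma cmod_one_plus_power_le:
  fixes z :: complex
  assumes q: "1 \<le> q"
  shows "cmod (1 + z) ^ (2 * q) \<le> 2 * real q * Re z + (1 + 9 * real q * (cmod z)\<^sup>2) ^ q"
proof -
  define y where "y = cmod z"
  define \<rho> where "\<rho> = Re z"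
  have y0: "0 \<le> y" by (simp add: y_def)
  have \<rho>y: "\<rho> \<le> y" "-y \<le> \<rho>"
    using complex_Re_le_cmod[of z] abs_Re_le_cmod[of z] by (auto simp: y_def \<rho>_def)
  have sq: "(cmod (1 + z))\<^sup>2 = 1 + 2 * \<rho> + y\<^sup>2"
    unfolding y_def \<rho>_def cmod_power2 by (simp add: power2_eq_square algebra_simps)
  have nn: "0 \<le> 1 + 2 * \<rho> + y\<^sup>2" using sq zero_le_power2[of "cmod (1+z)"] by simp
  have q1: "1 \<le> real q" using q by simp
  have "(1 + 2 * \<rho> + y\<^sup>2) ^ q \<le> 2 * real q * \<rho> + (1 + 9 * real q * y\<^sup>2) ^ q"
  proof (cases "4 * real q * y \<le> 1")
    case True
    have "y \<le> real q * y" using q1 y0 by (simp add: mult_le_cancel_right1)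
    hence y4: "y \<le> 1/4" using True by linarith
    define u where "u = 2 * \<rho> + y\<^sup>2"
    have yy: "y\<^sup>2 \<le> y / 4" using mult_left_mono[OF y4 y0] by (simp add: power2_eq_square)
    have ub: "\<bar>u\<bar> \<le> 9/4 * y" using \<rho>y yy zero_le_power2[of y] unfolding u_def by linarith
    have "u\<^sup>2 \<le> (9/4 * y)\<^sup>2" using ub y0 by (metis abs_ge_zero power2_abs power_mono)
    moreover have "(9/4 * y)\<^sup>2 = 81/16 * y\<^sup>2" by (simp add: power_mult_distrib power_divide)
    ultimately have u2: "u\<^sup>2 \<le> 6 * y\<^sup>2" using zero_le_power2[of y] by linarith
    have "real q * u \<le> real q * (9/4 * y)" using ub q1 by (intro mult_left_mono) auto
    hence qu: "real q * u \<le> 1" using True by linarith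
    have "(1 + u) ^ q \<le> (exp u) ^ q"
      using exp_ge_add_one_self[of u] nn unfolding u_def by (intro power_mono) (auto simp: add_ac)
    also have "\<dots> = exp (real q * u)" by (simp add: exp_of_nat_mult)
    also have "\<dots> \<le> 1 + real q * u + (real q * u)\<^sup>2" by (rule exp_le_quadratic[OF qu])
    also have "\<dots> \<le> 1 + real q * u + real q * (real q * (6 * y\<^sup>2))"
    proof -
      have "(real q)\<^sup>2 * u\<^sup>2 \<le> (real q)\<^sup>2 * (6 * y\<^sup>2)" using u2 by (intro mult_left_mono) auto
      thus ?thesis by (simp add: power2_eq_square algebra_simps)
    qed
    also have "\<dots> = 2 * real q * \<rho> + (1 + real q * (y\<^sup>2 + real q * (6 * y\<^sup>2)))"
      by (simp add: u_def algebra_simps)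
    also have "\<dots> \<le> 2 * real q * \<rho> + (1 + real q * (9 * real q * y\<^sup>2))"
    proof -
      have "1 * y\<^sup>2 \<le> real q * y\<^sup>2" using q1 by (intro mult_right_mono) auto
      hence "y\<^sup>2 + real q * (6 * y\<^sup>2) \<le> 9 * real q * y\<^sup>2"
        by (simp add: algebra_simps) (use zero_le_power2[of y] in linarith)
      thus ?thesis using q1 by (intro add_left_mono mult_left_mono) auto
    qed
    also have "\<dots> \<le> 2 * real q * \<rho> + (1 + 9 * real q * y\<^sup>2) ^ q"
      using add_power_ge_bernoulli[of 1 "9 * real q * y\<^sup>2" q] by simp
    finally show ?thesis by (simp add: u_def add_ac)
  next
    case False
    \<comment> \<open>Origin of the constant 9: \<open>2 * y\<close> is at most
      \<open>8 * q * y^2\<close>, and \<open>y^2\<close> adds one more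
      \<open>q * y^2\<close>.\<close>
    hence "y \<le> (4 * real q * y) * y" using y0 by (simp add: mult_le_cancel_right1)
    hence yq: "y \<le> 4 * real q * y\<^sup>2" by (simp add: power2_eq_square mult_ac)
    have yy: "y\<^sup>2 \<le> real q * y\<^sup>2" using mult_right_mono[OF q1, of "y\<^sup>2"] by simp
    show ?thesis
    proof (cases "0 \<le> \<rho>")
      case True
      have "(1 + 2 * \<rho> + y\<^sup>2) ^ q \<le> (1 + 9 * real q * y\<^sup>2) ^ q"
        using yq yy \<rho>y nn by (intro power_mono) auto
      thus ?thesis using True by (simp add: add_increasing)
    next
      case False
      have "(1 + 2 * \<rho> + y\<^sup>2) ^ q - 2 * real q * \<rho> \<le> (1 + y\<^sup>2) ^ q + real q * (2 * y)"
      proof -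
        have "(1 + 2 * \<rho> + y\<^sup>2) ^ q \<le> (1 + y\<^sup>2) ^ q" using False nn by (intro power_mono) auto
        moreover have "real q * (- (2 * \<rho>)) \<le> real q * (2 * y)" using \<rho>y by (intro mult_left_mono) auto
        ultimately show ?thesis by (simp add: algebra_simps)
      qed
      \<comment> \<open>For negative real part the linear term has moved to the left with a positive
        sign; Bernoulli at base \<open>1 + y^2\<close> instead of 1 takes it back under the
        power.\<close>
      also have "\<dots> \<le> (1 + y\<^sup>2 + 2 * y) ^ q"
        using y0 by (intro add_power_ge_bernoulli) auto
      also have "\<dots> \<le> (1 + 9 * real q * y\<^sup>2) ^ q"
        using y0 yq yy by (intro power_mono) auto
      finally show ?thesis by simp
    qed
  qed
  thus ?thesis by (simp add: power_mult sq y_def \<rho>_def)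
qed

text \<open>The first-order term of the pointwise bound averages out because \<open>h\<close> has mean zero.\<close>

lemma mean_zero_perturbation_moment:
  fixes h :: "'a \<Rightarrow> complex" and a :: complex
  assumes "finite A" "1 \<le> q" and mean: "(\<Sum>x\<in>A. h x) = 0"
    and bnd: "\<And>x. x \<in> A \<Longrightarrow> (cmod (h x))\<^sup>2 \<le> s"
  shows "(\<Sum>x\<in>A. cmod (a + h x) ^ (2 * q)) \<le> real (card A) * ((cmod a)\<^sup>2 + 9 * real q * s) ^ q"
proof (cases "a = 0")
  case True
  have "cmod (a + h x) ^ (2 * q) \<le> ((cmod a)\<^sup>2 + 9 * real q * s) ^ q" if x: "x \<in> A" for x
  proof -
    have s0: "0 \<le> s" using bnd[OF x] zero_le_power2[of "cmod (h x)"] by linarith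
    have "cmod (h x) ^ (2 * q) \<le> s ^ q" using bnd[OF x] by (simp add: power_mult power_mono)
    also have "\<dots> \<le> (9 * real q * s) ^ q"
    proof (rule power_mono)
      have "1 * s \<le> (9 * real q) * s" using assms(2) s0 by (intro mult_right_mono) auto
      thus "s \<le> 9 * real q * s" by simp
    qed (rule s0)
    finally show ?thesis using True by simp
  qed
  then show ?thesis using sum_bounded_above[of A "\<lambda>x. cmod (a + h x) ^ (2 * q)"] by simp
next
  case False
  hence ca: "0 < cmod a" by simp
  have pt: "cmod (a + h x) ^ (2 * q)
      \<le> cmod a ^ (2 * q) * (2 * real q * Re (h x / a)) + ((cmod a)\<^sup>2 + 9 * real q * s) ^ q" if x: "x \<in> A" for x
  proof -
    have "cmod (a + h x) = cmod a * cmod (1 + h x / a)"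
      using False by (simp add: norm_mult[symmetric] distrib_left)
    hence "cmod (a + h x) ^ (2 * q) = cmod a ^ (2 * q) * cmod (1 + h x / a) ^ (2 * q)"
      by (simp add: power_mult_distrib)
    also have "\<dots> \<le> cmod a ^ (2 * q) * (2 * real q * Re (h x / a) + (1 + 9 * real q * (cmod (h x / a))\<^sup>2) ^ q)"
      by (intro mult_left_mono cmod_one_plus_power_le assms) auto
    also have "\<dots> = cmod a ^ (2 * q) * (2 * real q * Re (h x / a))
         + ((cmod a)\<^sup>2 * (1 + 9 * real q * (cmod (h x / a))\<^sup>2)) ^ q"
      by (simp only: power_mult power_mult_distrib distrib_left[of "((cmod a)\<^sup>2) ^ q"])
    also have "(cmod a)\<^sup>2 * (1 + 9 * real q * (cmod (h x / a))\<^sup>2) = (cmod a)\<^sup>2 + 9 * real q * (cmod (h x))\<^sup>2"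
      using ca by (simp add: norm_divide power_divide field_simps)
    also have "\<dots> ^ q \<le> ((cmod a)\<^sup>2 + 9 * real q * s) ^ q"
      using bnd[OF x] by (intro power_mono add_left_mono mult_left_mono) auto
    finally show ?thesis by simp
  qed
  have "(\<Sum>x\<in>A. cmod (a + h x) ^ (2 * q)) \<le>
     (\<Sum>x\<in>A. cmod a ^ (2 * q) * (2 * real q * Re (h x / a)) + ((cmod a)\<^sup>2 + 9 * real q * s) ^ q)"
    by (intro sum_mono pt)
  also have "\<dots> = cmod a ^ (2 * q) * (2 * real q * Re ((\<Sum>x\<in>A. h x) / a)) + real (card A) * ((cmod a)\<^sup>2 + 9 * real q * s) ^ q"
    by (simp add: sum.distrib sum_distrib_left sum_divide_distrib)
  finally show ?thesis by (simp add: mean)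
qed

section \<open>Characters and hypercontractivity over the integers modulo r\<close>

definition unit_root :: "nat \<Rightarrow> int \<Rightarrow> complex" where
  "unit_root r a = cis (2 * pi * (real_of_int a / real r))"

lemma unit_root_add: "unit_root r (a + b) = unit_root r a * unit_root r b"
  by (simp add: unit_root_def cis_mult add_divide_distrib distrib_left)

lemma unit_root_0 [simp]: "unit_root r 0 = 1"
  by (simp add: unit_root_def)

lemma cmod_unit_root [simp]: "cmod (unit_root r a) = 1"
  by (simp add: unit_root_def)

lemma cnj_unit_root: "cnj (unit_root r a) = unit_root r (- a)"
  by (simp add: unit_root_def cis_cnj)

lemma unit_root_power: "unit_root r a ^ j = unit_root r (a * int j)"
proof -
  have "real j * (2 * pi * (real_of_int a / real r)) = 2 * pi * (real_of_int (a * int j) / real r)" by simp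
  thus ?thesis unfolding unit_root_def Complex.DeMoivre by (simp only:)
qed

lemma unit_root_eq_1_iff:
  assumes "0 < r"
  shows "unit_root r a = 1 \<longleftrightarrow> int r dvd a"
proof
  assume "unit_root r a = 1"
  hence "cos (2 * pi * (real_of_int a / real r)) = 1"
    by (simp add: unit_root_def complex_eq_iff)
  then obtain n where "2 * pi * (real_of_int a / real r) = of_int n * 2 * pi"
    by (auto simp: cos_one_2pi_int)
  hence "(2 * pi) * (real_of_int a / real r) = (2 * pi) * of_int n" by (simp only: mult_ac)
  hence "real_of_int a / real r = of_int n" by (subst (asm) mult_cancel_left) simp
  hence "real_of_int a = of_int n * real r" using assms by (simp add: field_simps)
  hence "a = n * int r" by (metis of_int_eq_iff of_int_mult of_int_of_nat_eq)
  thus "int r dvd a" by simp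
next
  assume "int r dvd a"
  then obtain n where "a = int r * n" by (elim dvdE)
  hence "real_of_int a / real r = of_int n" using assms by simp
  thus "unit_root r a = 1" by (simp only: unit_root_def cis_multiple_2pi Ints_of_int)
qed

lemma sum_unit_root:
  assumes "0 < r"
  shows "(\<Sum>x\<in>{0..<int r}. unit_root r (v * x)) = (if int r dvd v then of_nat r else 0)"
proof -
  have "(\<Sum>x\<in>{0..<int r}. unit_root r (v * x)) = (\<Sum>j<r. unit_root r v ^ j)"
    by (rule sum.reindex_bij_witness[of _ int nat]) (auto simp: unit_root_power)
  also have "\<dots> = (if int r dvd v then of_nat r else 0)"
  proof (cases "int r dvd v")
    case True
    then show ?thesis using unit_root_eq_1_iff[OF assms, of v] by simp
  next
    case False
    hence "unit_root r v \<noteq> 1" using unit_root_eq_1_iff[OF assms] by simp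
    moreover have "unit_root r v ^ r = 1"
      using assms by (simp add: unit_root_power unit_root_eq_1_iff)
    ultimately show ?thesis using False by (simp add: sum_gp_strict)
  qed
  finally show ?thesis .
qed

text \<open>Parseval for the group of integers modulo \<open>r\<close>, by orthogonality of the
  characters.\<close>

lemma sum_cmod_squared_character:
  fixes f :: "int \<Rightarrow> complex"
  assumes "0 < r"
  shows "(\<Sum>x\<in>{0..<int r}. (cmod (\<Sum>v\<in>{0..<int r}. f v * unit_root r (v * x)))\<^sup>2)
     = real r * (\<Sum>v\<in>{0..<int r}. (cmod (f v))\<^sup>2)"
proof -
  let ?Z = "{0..<int r}"
  have "complex_of_real (\<Sum>x\<in>?Z. (cmod (\<Sum>v\<in>?Z. f v * unit_root r (v * x)))\<^sup>2)
      = (\<Sum>x\<in>?Z. (\<Sum>v\<in>?Z. \<Sum>w\<in>?Z. f v * cnj (f w) * unit_root r ((v - w) * x)))"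
    unfolding of_real_sum
  proof (rule sum.cong[OF refl])
    fix x
    show "complex_of_real ((cmod (\<Sum>v\<in>?Z. f v * unit_root r (v * x)))\<^sup>2) =
       (\<Sum>v\<in>?Z. \<Sum>w\<in>?Z. f v * cnj (f w) * unit_root r ((v - w) * x))"
      unfolding complex_norm_square cnj_sum sum_product
      by (intro sum.cong refl) (simp add: cnj_unit_root left_diff_distrib unit_root_add[of r "v * x" "- (w * x)" for v w, simplified])
  qed
  also have "\<dots> = (\<Sum>v\<in>?Z. \<Sum>w\<in>?Z. f v * cnj (f w) * (\<Sum>x\<in>?Z. unit_root r ((v - w) * x)))"
    unfolding sum_distrib_left by (subst sum.swap, rule sum.cong[OF refl], rule sum.swap)
  also have "\<dots> = (\<Sum>v\<in>?Z. \<Sum>w\<in>?Z. if w = v then f v * cnj (f v) * of_nat r else 0)"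
  proof (intro sum.cong refl)
    fix v w assume "v \<in> ?Z" "w \<in> ?Z"
    hence "int r dvd v - w \<longleftrightarrow> w = v"
      by (auto simp: mod_eq_dvd_iff[symmetric])
    thus "f v * cnj (f w) * (\<Sum>x\<in>?Z. unit_root r ((v - w) * x)) = (if w = v then f v * cnj (f v) * of_nat r else 0)"
      by (simp add: sum_unit_root[OF assms])
  qed
  also have "\<dots> = complex_of_real (real r * (\<Sum>v\<in>?Z. (cmod (f v))\<^sup>2))"
    unfolding of_real_mult of_real_sum complex_norm_square by (simp add: sum_distrib_left mult_ac)
  finally show ?thesis unfolding of_real_eq_iff .
qed

text \<open>The constant \<open>\<kappa>\<close> is the price per nonzero frequency of the one-variable inequality
  \<open>\<parallel>f\<parallel>\<^bsub>2q\<^esub>\<^sup>2 \<le> |f_0|^2 + \<kappa> \<Sum>\<^bsub>v\<noteq>0\<^esub> |f_v|^2\<close>; it tensorizes.\<close>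

definition hyper_const :: "nat \<Rightarrow> nat \<Rightarrow> real \<Rightarrow> bool" where
  "hyper_const r q \<kappa> \<longleftrightarrow> (\<forall>f :: int \<Rightarrow> complex.
     (\<Sum>x\<in>{0..<int r}. cmod (\<Sum>v\<in>{0..<int r}. f v * unit_root r (v * x)) ^ (2 * q))
       \<le> real r * (\<Sum>v\<in>{0..<int r}. (if v = 0 then 1 else \<kappa>) * (cmod (f v))\<^sup>2) ^ q)"

lemma hyper_const_parseval: "0 < r \<Longrightarrow> hyper_const r 1 1"
  unfolding hyper_const_def by (simp add: sum_cmod_squared_character if_distrib)

text \<open>The nonconstant part of \<open>f\<close> has mean zero, and Cauchy-Schwarz bounds it
  pointwise by its Fourier energy times the number of nonzero frequencies. This pointwise bound is
  where the factor \<open>r\<close> in the constant comes from.\<close>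

lemma hyper_const_general:
  assumes r: "0 < r" and q: "1 \<le> q"
  shows "hyper_const r q (9 * real q * real r)"
  unfolding hyper_const_def
proof
  fix f :: "int \<Rightarrow> complex"
  let ?Z = "{0..<int r}"
  let ?Y = "{0..<int r} - {0}"
  define s where "s = (\<Sum>v\<in>?Y. (cmod (f v))\<^sup>2)"
  define h where "h x = (\<Sum>v\<in>?Y. f v * unit_root r (v * x))" for x
  have Z: "finite ?Z" "0 \<in> ?Z" using r by auto
  have split: "(\<Sum>v\<in>?Z. f v * unit_root r (v * x)) = f 0 + h x" for x
    unfolding h_def by (subst sum.remove[OF Z]) simp
  have mean: "(\<Sum>x\<in>?Z. h x) = 0"
  proof -
    have "(\<Sum>x\<in>?Z. h x) = (\<Sum>v\<in>?Y. f v * (\<Sum>x\<in>?Z. unit_root r (v * x)))"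
      unfolding h_def by (subst sum.swap) (simp add: sum_distrib_left)
    also have "\<dots> = 0"
    proof (rule sum.neutral, rule ballI)
      fix v assume "v \<in> ?Y"
      hence "\<not> int r dvd v" by (auto dest: zdvd_imp_le)
      thus "f v * (\<Sum>x\<in>?Z. unit_root r (v * x)) = 0" by (simp add: sum_unit_root[OF r])
    qed
    finally show ?thesis .
  qed
  have bnd: "(cmod (h x))\<^sup>2 \<le> real r * s" for x
  proof -
    have "cmod (h x) \<le> (\<Sum>v\<in>?Y. cmod (f v))"
      unfolding h_def by (rule sum_norm_le) (simp add: norm_mult)
    hence "(cmod (h x))\<^sup>2 \<le> (\<Sum>v\<in>?Y. cmod (f v) * 1)\<^sup>2" by (simp add: power_mono)
    also have "\<dots> \<le> s * (\<Sum>v\<in>?Y. 1\<^sup>2)"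
      unfolding s_def by (rule Cauchy_Schwarz_ineq_sum)
    also have "\<dots> = s * real (r - 1)" using r by simp
    also have "\<dots> \<le> s * real r" by (intro mult_left_mono) (auto simp: s_def sum_nonneg)
    finally show ?thesis by (simp add: mult.commute)
  qed
  have "(\<Sum>x\<in>?Z. cmod (f 0 + h x) ^ (2 * q)) \<le> real (card ?Z) * ((cmod (f 0))\<^sup>2 + 9 * real q * (real r * s)) ^ q"
    by (rule mean_zero_perturbation_moment[OF Z(1) q mean bnd])
  also have "(cmod (f 0))\<^sup>2 + 9 * real q * (real r * s) =
     (\<Sum>v\<in>?Z. (if v = 0 then 1 else 9 * real q * real r) * (cmod (f v))\<^sup>2)"
    by (subst sum.remove[OF Z]) (simp add: s_def sum_distrib_left mult_ac)
  finally show "(\<Sum>x\<in>?Z. cmod (\<Sum>v\<in>?Z. f v * unit_root r (v * x)) ^ (2 * q)) \<le> real r *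
     (\<Sum>v\<in>?Z. (if v = 0 then 1 else 9 * real q * real r) * (cmod (f v))\<^sup>2) ^ q"
    by (simp add: split)
qed

section \<open>Tensorization of the one-variable inequality\<close>

lemma sum_PiE_insert:
  assumes "i \<notin> I"
  shows "(\<Sum>x\<in>PiE (insert i I) A. F x) = (\<Sum>a\<in>A i. \<Sum>x\<in>PiE I A. F (x(i := a)))"
proof -
  have "(\<Sum>x\<in>PiE (insert i I) A. F x) = (\<Sum>p\<in>A i \<times> PiE I A. F ((\<lambda>(y, g). g(i := y)) p))"
    unfolding PiE_insert_eq by (subst sum.reindex[OF inj_combinator[OF assms]]) (simp add: o_def)
  also have "\<dots> = (\<Sum>a\<in>A i. \<Sum>x\<in>PiE I A. F (x(i := a)))"
    by (simp add: sum.cartesian_product case_prod_unfold)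
  finally show ?thesis .
qed

text \<open>Minkowski's inequality for the \<open>q\<close>-norm over \<open>X\<close>, phrased
  through bounds \<open>c b\<close> on the individual norms. It follows from Jensen for the weights
  \<open>c b / S\<close>; indices with \<open>c b = 0\<close> are discarded beforehand, since there
  \<open>g b\<close> vanishes on \<open>X\<close>.\<close>

lemma sum_power_moment_le:
  fixes g :: "'b \<Rightarrow> 'x \<Rightarrow> real" and c :: "'b \<Rightarrow> real"
  assumes fin: "finite B" "finite X" and q: "1 \<le> q" and R: "0 \<le> R"
    and g0: "\<And>b x. b \<in> B \<Longrightarrow> x \<in> X \<Longrightarrow> 0 \<le> g b x" and c0: "\<And>b. b \<in> B \<Longrightarrow> 0 \<le> c b"
    and le: "\<And>b. b \<in> B \<Longrightarrow> (\<Sum>x\<in>X. g b x ^ q) \<le> R * c b ^ q"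
  shows "(\<Sum>x\<in>X. (\<Sum>b\<in>B. g b x) ^ q) \<le> R * (\<Sum>b\<in>B. c b) ^ q"
proof -
  define B' where "B' = {b\<in>B. 0 < c b}"
  have B': "finite B'" "B' \<subseteq> B" using fin by (auto simp: B'_def)
  have gz: "g b x = 0" if "b \<in> B - B'" "x \<in> X" for b x
  proof -
    have b: "b \<in> B" "c b = 0" using that c0 by (force simp: B'_def)+
    have "(\<Sum>x\<in>X. g b x ^ q) \<le> 0" using le[OF b(1)] q unfolding b(2) by (simp add: zero_power)
    hence "(\<Sum>x\<in>X. g b x ^ q) = 0" using g0 b by (intro antisym sum_nonneg) auto
    hence "g b x ^ q = 0" using fin g0 b that by (subst (asm) sum_nonneg_eq_0_iff) auto
    thus ?thesis using q by simp
  qed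
  define S where "S = (\<Sum>b\<in>B'. c b)"
  have S: "(\<Sum>b\<in>B. c b) = S" unfolding S_def
    using fin c0 by (intro sum.mono_neutral_right) (auto simp: B'_def not_less intro: antisym)
  have sumB: "(\<Sum>b\<in>B. g b x) = (\<Sum>b\<in>B'. g b x)" if "x \<in> X" for x
    using fin B' gz[OF _ that] by (intro sum.mono_neutral_right) auto
  show ?thesis
  proof (cases "B' = {}")
    case True
    then have "(\<Sum>x\<in>X. (\<Sum>b\<in>B. g b x) ^ q) = 0"
      using q by (intro sum.neutral) (simp add: sumB)
    moreover have "0 \<le> R * (\<Sum>b\<in>B. c b) ^ q"
      by (rule mult_nonneg_nonneg[OF R zero_le_power[OF sum_nonneg]]) (rule c0)
    ultimately show ?thesis by simp
  next
    case False
    have Spos: "0 < S" unfolding S_def using B' False by (intro sum_pos) (auto simp: B'_def)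
    have cp: "0 < c b" if "b \<in> B'" for b using that by (simp add: B'_def)
    hence cne: "c b \<noteq> 0" if "b \<in> B'" for b using that by fastforce
    have "(\<Sum>b\<in>B'. g b x) ^ q \<le> S ^ q * (\<Sum>b\<in>B'. c b / S * (g b x / c b) ^ q)" if x: "x \<in> X" for x
    proof -
      have "(\<Sum>b\<in>B'. g b x) ^ q = S ^ q * (\<Sum>b\<in>B'. (c b / S) *\<^sub>R (g b x / c b)) ^ q"
      proof -
        have "S * (\<Sum>b\<in>B'. (c b / S) *\<^sub>R (g b x / c b)) = (\<Sum>b\<in>B'. g b x)"
          unfolding sum_distrib_left using cne Spos by (intro sum.cong refl) simp
        thus ?thesis by (metis power_mult_distrib)
      qed
      also have "\<dots> \<le> S ^ q * (\<Sum>b\<in>B'. c b / S * (g b x / c b) ^ q)"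
      proof (rule mult_left_mono)
        show "(\<Sum>b\<in>B'. (c b / S) *\<^sub>R (g b x / c b)) ^ q \<le> (\<Sum>b\<in>B'. c b / S * (g b x / c b) ^ q)"
        proof (rule convex_on_sum[where C = "{0..}" and f = "\<lambda>x::real. x ^ q"])
          show "convex_on {0..} (\<lambda>x::real. x ^ q)"
            by (cases "even q") (auto intro: convex_power_odd convex_on_subset[OF convex_power_even])
          show "(\<Sum>b\<in>B'. c b / S) = 1" using Spos by (simp add: S_def sum_divide_distrib[symmetric])
          show "0 \<le> c b / S" if "b \<in> B'" for b using cp[OF that] Spos by simp
          show "g b x / c b \<in> {0..}" if "b \<in> B'" for b
            using cp[OF that] g0[of b x] x B' that by auto
        qed (use B' False in auto)
      qed (use Spos in simp)
      finally show ?thesis .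
    qed
    hence "(\<Sum>x\<in>X. (\<Sum>b\<in>B. g b x) ^ q) \<le> (\<Sum>x\<in>X. S ^ q * (\<Sum>b\<in>B'. c b / S * (g b x / c b) ^ q))"
      by (intro sum_mono) (simp add: sumB)
    also have "\<dots> = S ^ q * (\<Sum>b\<in>B'. c b / S * ((\<Sum>x\<in>X. g b x ^ q) / c b ^ q))"
      unfolding sum_distrib_left[symmetric]
      by (subst sum.swap) (simp only: sum_distrib_left[symmetric] sum_divide_distrib power_divide)
    also have "\<dots> \<le> S ^ q * (\<Sum>b\<in>B'. c b / S * R)"
    proof (intro mult_left_mono sum_mono)
      fix b assume b: "b \<in> B'"
      show "(\<Sum>x\<in>X. g b x ^ q) / c b ^ q \<le> R"
        using le[of b] cp[OF b] b B' by (subst pos_divide_le_eq) auto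
      show "0 \<le> c b / S" using cp[OF b] Spos by simp
    qed (use Spos in simp)
    also have "\<dots> = R * S ^ q" using Spos
      by (simp add: sum_distrib_right[symmetric] sum_divide_distrib[symmetric] S_def)
    finally show ?thesis by (simp add: S)
  qed
qed

definition character :: "nat \<Rightarrow> nat set \<Rightarrow> (nat \<Rightarrow> int) \<Rightarrow> (nat \<Rightarrow> int) \<Rightarrow> complex" where
  "character r I v x = unit_root r (\<Sum>i\<in>I. v i * x i)"

lemma character_insert:
  assumes "finite I" "i \<notin> I"
  shows "character r (insert i I) (v(i := b)) (x(i := a)) = unit_root r (b * a) * character r I v x"
proof -
  have "(\<Sum>j\<in>I. (v(i := b)) j * (x(i := a)) j) = (\<Sum>j\<in>I. v j * x j)"
    using assms by (intro sum.cong) auto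
  thus ?thesis using assms by (simp add: character_def unit_root_add)
qed

text \<open>In the induction step the one-variable inequality is applied to the new coordinate with
  the others fixed. Minkowski then moves the sum over its frequency \<open>b\<close> outside the
  moment over the remaining coordinates, where the induction hypothesis applies to each
  \<open>b\<close> separately.\<close>

theorem character_hypercontractivity:
  fixes f :: "(nat \<Rightarrow> int) \<Rightarrow> complex"
  assumes hc: "hyper_const r q \<kappa>" and q: "1 \<le> q" and \<kappa>: "0 \<le> \<kappa>" and I: "finite I"
  shows "(\<Sum>x\<in>PiE I (\<lambda>_. {0..<int r}). cmod (\<Sum>v\<in>PiE I (\<lambda>_. {0..<int r}). f v * character r I v x) ^ (2 * q))
     \<le> real r ^ card I * (\<Sum>v\<in>PiE I (\<lambda>_. {0..<int r}). \<kappa> ^ card {i\<in>I. v i \<noteq> 0} * (cmod (f v))\<^sup>2) ^ q"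
  using I
proof (induction I arbitrary: f rule: finite_induct)
  case empty
  then show ?case by (simp add: character_def power_mult)
next
  case (insert i I)
  let ?Z = "{0..<int r}"
  let ?P = "PiE I (\<lambda>_. ?Z)"
  define g where "g b x = (\<Sum>v\<in>?P. f (v(i := b)) * character r I v x)" for b x
  define k where "k b = (if b = 0 then 1 else \<kappa>)" for b :: int
  define c where "c b = (\<Sum>v\<in>?P. \<kappa> ^ card {j\<in>I. v j \<noteq> 0} * (cmod (f (v(i := b))))\<^sup>2)" for b
  have k0: "0 \<le> k b" for b using \<kappa> by (simp add: k_def)
  have finP: "finite ?P" using insert by (intro finite_PiE) auto
  have "(\<Sum>x\<in>PiE (insert i I) (\<lambda>_. ?Z). cmod (\<Sum>v\<in>PiE (insert i I) (\<lambda>_. ?Z). f v * character r (insert i I) v x) ^ (2 * q))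
    = (\<Sum>a\<in>?Z. \<Sum>x\<in>?P. cmod (\<Sum>b\<in>?Z. g b x * unit_root r (b * a)) ^ (2 * q))"
    unfolding sum_PiE_insert[OF insert(2)] g_def sum_distrib_right
    by (simp add: character_insert insert mult_ac)
  also have "\<dots> = (\<Sum>x\<in>?P. \<Sum>a\<in>?Z. cmod (\<Sum>b\<in>?Z. g b x * unit_root r (b * a)) ^ (2 * q))"
    by (rule sum.swap)
  also have "\<dots> \<le> (\<Sum>x\<in>?P. real r * (\<Sum>b\<in>?Z. k b * (cmod (g b x))\<^sup>2) ^ q)"
    unfolding k_def by (intro sum_mono hc[unfolded hyper_const_def, rule_format])
  also have "\<dots> = real r * (\<Sum>x\<in>?P. (\<Sum>b\<in>?Z. k b * (cmod (g b x))\<^sup>2) ^ q)"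
    by (simp add: sum_distrib_left)
  also have "\<dots> \<le> real r * (real r ^ card I * (\<Sum>b\<in>?Z. k b * c b) ^ q)"
  proof (intro mult_left_mono sum_power_moment_le)
    fix b
    have "(\<Sum>x\<in>?P. (k b * (cmod (g b x))\<^sup>2) ^ q) = k b ^ q * (\<Sum>x\<in>?P. cmod (g b x) ^ (2 * q))"
      by (simp add: power_mult_distrib power_mult sum_distrib_left)
    also have "\<dots> \<le> k b ^ q * (real r ^ card I * c b ^ q)"
      unfolding g_def c_def by (intro mult_left_mono insert.IH) (simp add: k0)
    finally show "(\<Sum>x\<in>?P. (k b * (cmod (g b x))\<^sup>2) ^ q) \<le> real r ^ card I * (k b * c b) ^ q"
      by (simp add: power_mult_distrib mult_ac)
    show "0 \<le> k b * c b" unfolding c_def using \<kappa> k0 by (intro mult_nonneg_nonneg sum_nonneg) auto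
  qed (use finP q k0 in auto)
  also have "(\<Sum>b\<in>?Z. k b * c b) =
     (\<Sum>v\<in>PiE (insert i I) (\<lambda>_. ?Z). \<kappa> ^ card {j\<in>insert i I. v j \<noteq> 0} * (cmod (f v))\<^sup>2)"
    unfolding sum_PiE_insert[OF insert(2)] c_def sum_distrib_left
  proof (intro sum.cong refl)
    fix b and v :: "nat \<Rightarrow> int"
    have "{j\<in>insert i I. (v(i := b)) j \<noteq> 0} = (if b = 0 then {} else {i}) \<union> {j\<in>I. v j \<noteq> 0}"
      using insert(2) by auto
    moreover have "card \<dots> = (if b = 0 then 0 else 1) + card {j\<in>I. v j \<noteq> 0}"
      using insert(1,2) by (auto simp: card_insert_if)
    ultimately show "k b * (\<kappa> ^ card {j\<in>I. v j \<noteq> 0} * (cmod (f (v(i := b))))\<^sup>2)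
      = \<kappa> ^ card {j\<in>insert i I. (v(i := b)) j \<noteq> 0} * (cmod (f (v(i := b))))\<^sup>2"
      by (simp add: k_def power_add)
  qed
  finally show ?case using insert by (simp add: mult_ac)
qed

section \<open>Trace moments against density matrices\<close>

text \<open>Matrices are bare functions of two indices, of which only those below \<open>d\<close>
  are summed over; sums and products of matrix-valued functions of \<open>x\<close> then carry no
  dimension side conditions.\<close>

definition mmul :: "nat \<Rightarrow> (nat \<Rightarrow> nat \<Rightarrow> complex) \<Rightarrow> (nat \<Rightarrow> nat \<Rightarrow> complex) \<Rightarrow> nat \<Rightarrow> nat \<Rightarrow> complex" where
  "mmul d A B = (\<lambda>i j. \<Sum>k<d. A i k * B k j)"

definition madj :: "(nat \<Rightarrow> nat \<Rightarrow> complex) \<Rightarrow> nat \<Rightarrow> nat \<Rightarrow> complex" where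
  "madj A = (\<lambda>i j. cnj (A j i))"

definition mtr :: "nat \<Rightarrow> (nat \<Rightarrow> nat \<Rightarrow> complex) \<Rightarrow> complex" where
  "mtr d A = (\<Sum>i<d. A i i)"

definition density_fun :: "nat \<Rightarrow> (nat \<Rightarrow> nat \<Rightarrow> complex) \<Rightarrow> bool" where
  "density_fun d R \<longleftrightarrow>
     (\<forall>i<d. \<forall>j<d. R j i = cnj (R i j)) \<and>
     (\<forall>v. 0 \<le> (\<Sum>i<d. \<Sum>j<d. cnj (v i) * R i j * v j)) \<and>
     mtr d R = 1"

lemma mtr_mmul_adj: "mtr d (mmul d A (madj A)) = complex_of_real (\<Sum>i<d. \<Sum>k<d. (cmod (A i k))\<^sup>2)"
  unfolding mtr_def mmul_def madj_def of_real_sum complex_norm_square by simp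

text \<open>The variance of the observable \<open>A\<close> in the state \<open>R\<close> is nonnegative.\<close>

lemma density_expectation_squared_le:
  assumes R: "density_fun d R"
  shows "(cmod (mtr d (mmul d R A)))\<^sup>2 \<le> Re (mtr d (mmul d R (mmul d A (madj A))))"
proof -
  have herm: "R j i = cnj (R i j)" if "i < d" "j < d" for i j
    using R that unfolding density_fun_def by blast
  have pos: "0 \<le> (\<Sum>i<d. \<Sum>j<d. cnj (v i) * R i j * v j)" for v
    using R unfolding density_fun_def by blast
  have tr1: "(\<Sum>i<d. R i i) = 1" using R unfolding density_fun_def mtr_def by blast
  define c where "c = mtr d (mmul d R A)"
  have c: "c = (\<Sum>i<d. \<Sum>j<d. R i j * A j i)" by (simp add: c_def mtr_def mmul_def)
  have c': "cnj c = (\<Sum>i<d. \<Sum>j<d. R i j * cnj (A i j))"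
    unfolding c cnj_sum by (subst sum.swap, intro sum.cong refl) (simp add: herm[symmetric])
  \<comment> \<open>The centred observable. Its columns serve as test vectors for positivity; summed
    over all columns, the form is the trace of \<open>R\<close> against \<open>B\<close> times its
    adjoint.\<close>
  define B where "B j k = A j k - c * of_bool (j = k)" for j k
  have "0 \<le> (\<Sum>k<d. \<Sum>i<d. \<Sum>j<d. cnj (B i k) * R i j * B j k)"
    by (intro sum_nonneg pos)
  also have "\<dots> = (\<Sum>i<d. \<Sum>k<d. \<Sum>j<d. cnj (B i k) * R i j * B j k)"
    by (rule sum.swap)
  also have "\<dots> = (\<Sum>i<d. \<Sum>j<d. \<Sum>k<d. cnj (B i k) * R i j * B j k)"
    by (intro sum.cong refl sum.swap)
  also have "\<dots> = (\<Sum>i<d. \<Sum>j<d. R i j * (\<Sum>k<d. A j k * cnj (A i k)) - cnj c * (R i j * A j i)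
       - c * (R i j * cnj (A i j)) + c * cnj c * (R i j * of_bool (i = j)))"
  proof (intro sum.cong refl)
    fix i j assume ij: "i \<in> {..<d}" "j \<in> {..<d}"
    have "(\<Sum>k<d. cnj (B i k) * R i j * B j k) = (\<Sum>k<d. R i j * (A j k * cnj (A i k))
       - (if k = i then cnj c * (R i j * A j k) else 0) - (if k = j then c * (R i j * cnj (A i k)) else 0)
       + (if k = i then c * cnj c * (R i j * of_bool (k = j)) else 0))"
      by (intro sum.cong refl) (auto simp: B_def algebra_simps)
    also have "\<dots> = R i j * (\<Sum>k<d. A j k * cnj (A i k)) - cnj c * (R i j * A j i)
       - c * (R i j * cnj (A i j)) + c * cnj c * (R i j * of_bool (i = j))"
      using ij by (simp add: sum.distrib sum_subtractf sum_distrib_left)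
    finally show "(\<Sum>k<d. cnj (B i k) * R i j * B j k) = \<dots>" .
  qed
  also have "\<dots> = mtr d (mmul d R (mmul d A (madj A))) - cnj c * c - c * cnj c + c * cnj c * (\<Sum>i<d. R i i)"
  proof -
    have "(\<Sum>i<d. \<Sum>j<d. R i j * of_bool (i = j)) = (\<Sum>i<d. R i i)"
      by (intro sum.cong refl) (simp add: of_bool_def if_distrib cong: if_cong)
    thus ?thesis
      unfolding sum.distrib sum_subtractf sum_distrib_left[symmetric] c'[symmetric] c[symmetric]
      by (simp add: mtr_def mmul_def madj_def)
  qed
  also have "\<dots> = mtr d (mmul d R (mmul d A (madj A))) - complex_of_real ((cmod c)\<^sup>2)"
    unfolding complex_norm_square by (simp add: tr1)
  finally show ?thesis unfolding c_def less_eq_complex_def by simp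
qed

text \<open>Nonnegativity of the 2 by 2 principal minors, obtained from positivity on vectors
  supported on \<open>i\<close> and \<open>j\<close>.\<close>

lemma density_minor:
  assumes R: "density_fun d R" and ij: "i < d" "j < d"
  shows "(cmod (R i j))\<^sup>2 \<le> Re (R i i) * Re (R j j)"
proof (cases "i = j")
  case True
  have "R i i = cnj (R i i)" using R ij unfolding density_fun_def by blast
  hence "Im (R i i) = 0" by (simp add: complex_eq_iff)
  then show ?thesis using True unfolding cmod_power2 by (simp add: power2_eq_square)
next
  case False
  have herm: "R j i = cnj (R i j)" "R i i = cnj (R i i)" "R j j = cnj (R j j)"
    using R ij unfolding density_fun_def by blast+
  have real: "Im (R i i) = 0" "Im (R j j) = 0" using herm(2,3) by (auto simp: complex_eq_iff)
  have form: "0 \<le> (cmod x)\<^sup>2 * Re (R i i) + 2 * Re (cnj x * y * R i j) + (cmod y)\<^sup>2 * Re (R j j)" for x y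
  proof -
    define v where "v k = (if k = i then x else if k = j then y else 0)" for k
    have inner: "(\<Sum>l<d. cnj (v k) * R k l * v l) = cnj (v k) * (R k i * x + R k j * y)" for k
    proof -
      have "(\<Sum>l<d. cnj (v k) * R k l * v l) = (\<Sum>l\<in>{i, j}. cnj (v k) * R k l * v l)"
        using ij by (intro sum.mono_neutral_right) (auto simp: v_def)
      thus ?thesis using False by (simp add: v_def algebra_simps)
    qed
    have "(\<Sum>k<d. \<Sum>l<d. cnj (v k) * R k l * v l) = (\<Sum>k\<in>{i, j}. cnj (v k) * (R k i * x + R k j * y))"
      unfolding inner using ij by (intro sum.mono_neutral_right) (auto simp: v_def)
    also have "\<dots> = cnj x * (R i i * x + R i j * y) + cnj y * (cnj (R i j) * x + R j j * y)"
      using False by (simp add: v_def herm(1))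
    finally have eq: "(\<Sum>k<d. \<Sum>l<d. cnj (v k) * R k l * v l) = \<dots>" .
    have "0 \<le> (\<Sum>k<d. \<Sum>l<d. cnj (v k) * R k l * v l)"
      using R unfolding density_fun_def by blast
    hence "0 \<le> Re (cnj x * (R i i * x + R i j * y) + cnj y * (cnj (R i j) * x + R j j * y))"
      unfolding eq less_eq_complex_def by simp
    also have "\<dots> = (cmod x)\<^sup>2 * Re (R i i) + 2 * Re (cnj x * y * R i j) + (cmod y)\<^sup>2 * Re (R j j)"
      unfolding cmod_power2 by (simp add: real power2_eq_square algebra_simps)
    finally show ?thesis .
  qed
  let ?a = "Re (R i i)" and ?b = "Re (R j j)" and ?c = "R i j"
  have a0: "0 \<le> ?a" using form[of 1 0] by simp
  have b0: "0 \<le> ?b" using form[of 0 1] by simp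
  \<comment> \<open>The phase of the test vector makes the cross term real and negative. Putting
    \<open>s\<close> equal to a positive diagonal entry makes the form that entry times the minor;
    if both diagonal entries vanish, \<open>s = 1\<close> forces the off-diagonal entry to
    vanish.\<close>
  have f1: "0 \<le> (cmod ?c)\<^sup>2 * ?a - 2 * s * (cmod ?c)\<^sup>2 + s\<^sup>2 * ?b" for s :: real
    using form[of "- ?c" "of_real s"] unfolding cmod_power2 by (simp add: power2_eq_square algebra_simps)
  have f2: "0 \<le> s\<^sup>2 * ?a - 2 * s * (cmod ?c)\<^sup>2 + (cmod ?c)\<^sup>2 * ?b" for s :: real
    using form[of "of_real s" "- cnj ?c"] unfolding cmod_power2 by (simp add: power2_eq_square algebra_simps)
  consider "0 < ?a" | "0 < ?b" | "?a = 0" "?b = 0" using a0 b0 by linarith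
  then show ?thesis
  proof cases
    case 1
    have "0 \<le> ?a * (?a * ?b - (cmod ?c)\<^sup>2)" using f1[of ?a] by (simp add: power2_eq_square algebra_simps)
    thus ?thesis using 1 by (simp add: zero_le_mult_iff)
  next
    case 2
    have "0 \<le> ?b * (?a * ?b - (cmod ?c)\<^sup>2)" using f2[of ?b] by (simp add: power2_eq_square algebra_simps)
    thus ?thesis using 2 by (simp add: zero_le_mult_iff)
  next
    case 3
    thus ?thesis using f1[of 1] by simp
  qed
qed

text \<open>Cauchy-Schwarz on the entries, together with the fact that the squared entries of
  \<open>R\<close> sum to at most the square of its trace, by the minors.\<close>

lemma density_expectation_le_frobenius:
  assumes R: "density_fun d R"
  shows "(cmod (mtr d (mmul d R A)))\<^sup>2 \<le> (\<Sum>i<d. \<Sum>k<d. (cmod (A i k))\<^sup>2)"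
proof -
  have tr1: "(\<Sum>i<d. Re (R i i)) = 1"
    using R unfolding density_fun_def mtr_def by (metis Re_sum one_complex.simps(1))
  let ?P = "{..<d} \<times> {..<d}"
  have "mtr d (mmul d R A) = (\<Sum>(i, j)\<in>?P. R i j * A j i)"
    by (simp add: mtr_def mmul_def sum.cartesian_product)
  hence "cmod (mtr d (mmul d R A)) \<le> (\<Sum>(i, j)\<in>?P. cmod (R i j) * cmod (A j i))"
    by (simp only: case_prod_unfold) (rule sum_norm_le, simp add: norm_mult)
  hence "(cmod (mtr d (mmul d R A)))\<^sup>2 \<le> (\<Sum>p\<in>?P. cmod (R (fst p) (snd p)) * cmod (A (snd p) (fst p)))\<^sup>2"
    by (simp add: power_mono case_prod_unfold)
  also have "\<dots> \<le> (\<Sum>p\<in>?P. (cmod (R (fst p) (snd p)))\<^sup>2) * (\<Sum>p\<in>?P. (cmod (A (snd p) (fst p)))\<^sup>2)"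
    by (rule Cauchy_Schwarz_ineq_sum)
  also have "\<dots> \<le> 1 * (\<Sum>p\<in>?P. (cmod (A (snd p) (fst p)))\<^sup>2)"
  proof (rule mult_right_mono)
    have "(\<Sum>p\<in>?P. (cmod (R (fst p) (snd p)))\<^sup>2) \<le> (\<Sum>p\<in>?P. Re (R (fst p) (fst p)) * Re (R (snd p) (snd p)))"
      by (intro sum_mono density_minor[OF R]) auto
    also have "\<dots> = (\<Sum>i<d. Re (R i i)) * (\<Sum>j<d. Re (R j j))"
      by (simp add: sum_product sum.cartesian_product case_prod_unfold)
    finally show "(\<Sum>p\<in>?P. (cmod (R (fst p) (snd p)))\<^sup>2) \<le> 1" by (simp add: tr1)
  qed (simp add: sum_nonneg)
  also have "1 * (\<Sum>p\<in>?P. (cmod (A (snd p) (fst p)))\<^sup>2) = (\<Sum>j<d. \<Sum>i<d. (cmod (A i j))\<^sup>2)"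
    by (simp add: sum.cartesian_product case_prod_unfold)
  also have "\<dots> = (\<Sum>i<d. \<Sum>k<d. (cmod (A i k))\<^sup>2)" by (rule sum.swap)
  finally show ?thesis .
qed

text \<open>Repeated squaring: from the first step on the iterates are Hermitian, so
  \<open>gram_iter d (Suc a) A\<close> is the power with exponent \<open>2 ^ a\<close> of
  \<open>A\<close> times its adjoint. This is why only moments of order \<open>2 * 2 ^ a\<close>
  occur.\<close>

fun gram_iter :: "nat \<Rightarrow> nat \<Rightarrow> (nat \<Rightarrow> nat \<Rightarrow> complex) \<Rightarrow> nat \<Rightarrow> nat \<Rightarrow> complex" where
  "gram_iter d 0 A = A"
| "gram_iter d (Suc a) A = mmul d (gram_iter d a A) (madj (gram_iter d a A))"

text \<open>The variance inequality is iterated \<open>a\<close> times, doubling the exponent each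
  time. The last doubling uses the Frobenius bound instead, which removes the state \<open>R\<close>
  and leaves a pure trace.\<close>

lemma density_expectation_power_le:
  assumes R: "density_fun d R"
  shows "cmod (mtr d (mmul d R A)) ^ (2 * 2 ^ a) \<le> Re (mtr d (gram_iter d (Suc a) A))"
proof -
  have *: "cmod (mtr d (mmul d R A)) ^ (2 ^ a) \<le> cmod (mtr d (mmul d R (gram_iter d a A)))" for a
  proof (induction a)
    case (Suc a)
    have "cmod (mtr d (mmul d R A)) ^ (2 ^ Suc a) = (cmod (mtr d (mmul d R A)) ^ (2 ^ a))\<^sup>2"
      by (simp add: power_mult[symmetric] mult.commute)
    also have "\<dots> \<le> (cmod (mtr d (mmul d R (gram_iter d a A))))\<^sup>2"
      by (intro power_mono Suc) simp
    also have "\<dots> \<le> Re (mtr d (mmul d R (gram_iter d (Suc a) A)))"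
      using density_expectation_squared_le[OF R] by simp
    also have "\<dots> \<le> cmod (mtr d (mmul d R (gram_iter d (Suc a) A)))"
      by (rule complex_Re_le_cmod)
    finally show ?case .
  qed simp
  have "cmod (mtr d (mmul d R A)) ^ (2 * 2 ^ a) = (cmod (mtr d (mmul d R A)) ^ (2 ^ a))\<^sup>2"
    by (simp add: power_mult[symmetric] mult.commute)
  also have "\<dots> \<le> (cmod (mtr d (mmul d R (gram_iter d a A))))\<^sup>2"
    by (intro power_mono *) simp
  also have "\<dots> \<le> (\<Sum>i<d. \<Sum>k<d. (cmod (gram_iter d a A i k))\<^sup>2)"
    by (rule density_expectation_le_frobenius[OF R])
  also have "\<dots> = Re (mtr d (gram_iter d (Suc a) A))" by (simp add: mtr_mmul_adj del: of_real_sum)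
  finally show ?thesis .
qed

section \<open>Unitary matrices and their traces\<close>

definition isometric :: "nat \<Rightarrow> (nat \<Rightarrow> nat \<Rightarrow> complex) \<Rightarrow> bool" where
  "isometric d U \<longleftrightarrow> (\<forall>v. (\<Sum>i<d. (cmod (\<Sum>j<d. U i j * v j))\<^sup>2) = (\<Sum>j<d. (cmod (v j))\<^sup>2))"

definition unitary_fun :: "nat \<Rightarrow> (nat \<Rightarrow> nat \<Rightarrow> complex) \<Rightarrow> bool" where
  "unitary_fun d U \<longleftrightarrow> isometric d U \<and> isometric d (madj U)"

lemma isometric_mmul:
  assumes "isometric d U" "isometric d V"
  shows "isometric d (mmul d U V)"
  unfolding isometric_def
proof
  fix v
  have "(\<Sum>j<d. mmul d U V i j * v j) = (\<Sum>k<d. U i k * (\<Sum>j<d. V k j * v j))" for i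
    unfolding mmul_def sum_distrib_right sum_distrib_left by (subst sum.swap) (simp add: mult_ac)
  thus "(\<Sum>i<d. (cmod (\<Sum>j<d. mmul d U V i j * v j))\<^sup>2) = (\<Sum>j<d. (cmod (v j))\<^sup>2)"
    using assms by (simp add: isometric_def)
qed

lemma madj_mmul: "madj (mmul d U V) = mmul d (madj V) (madj U)"
  by (simp add: madj_def mmul_def mult.commute)

lemma madj_madj [simp]: "madj (madj U) = U"
  by (simp add: madj_def)

lemma unitary_fun_mmul: "unitary_fun d U \<Longrightarrow> unitary_fun d V \<Longrightarrow> unitary_fun d (mmul d U V)"
  by (simp add: unitary_fun_def isometric_mmul madj_mmul)

lemma unitary_fun_madj: "unitary_fun d U \<Longrightarrow> unitary_fun d (madj U)"
  by (simp add: unitary_fun_def)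

lemma unitary_fun_id: "unitary_fun d (\<lambda>i j. of_bool (i = j))"
proof -
  have "(\<Sum>j<d. of_bool (i = j) * v j) = v i" if "i < d" for i and v :: "nat \<Rightarrow> complex"
    using that by (simp add: of_bool_def if_distrib[of "\<lambda>a. a * _"] cong: if_cong)
  hence "isometric d (\<lambda>i j. of_bool (i = j))" by (simp add: isometric_def)
  moreover have "madj (\<lambda>i j. of_bool (i = j)) = (\<lambda>i j. of_bool (i = j))"
    by (auto simp: madj_def fun_eq_iff of_bool_def)
  ultimately show ?thesis by (simp add: unitary_fun_def)
qed

text \<open>The column \<open>j\<close> of \<open>U\<close> is the image of a basis vector and hence
  has norm one.\<close>

lemma isometric_entry_le:
  assumes "isometric d U" "i < d" "j < d"
  shows "cmod (U i j) \<le> 1"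
proof -
  have e: "(\<Sum>l<d. U k l * of_bool (l = j)) = U k j" for k
    using assms(3) by (simp add: of_bool_def if_distrib cong: if_cong)
  have "(\<Sum>l<d. (cmod (of_bool (l = j)))\<^sup>2) = (\<Sum>l<d. if l = j then 1 else 0 :: real)"
    by (intro sum.cong) auto
  hence one: "(\<Sum>l<d. (cmod (of_bool (l = j)))\<^sup>2) = 1" using assms(3) by simp
  have "(cmod (U i j))\<^sup>2 \<le> (\<Sum>k<d. (cmod (U k j))\<^sup>2)"
    using assms(2) by (intro member_le_sum) auto
  also have "\<dots> = 1"
    using assms(1)[unfolded isometric_def, rule_format, of "\<lambda>l. of_bool (l = j)"] unfolding e one .
  finally show ?thesis using power2_le_imp_le[of "cmod (U i j)" 1] by simp
qed

lemma isometric_trace_le: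
  assumes "isometric d U"
  shows "cmod (mtr d U) \<le> real d"
proof -
  have "cmod (mtr d U) \<le> (\<Sum>i<d. 1)"
    unfolding mtr_def by (rule sum_norm_le) (simp add: isometric_entry_le[OF assms])
  thus ?thesis by simp
qed

section \<open>Domination of matrix-valued trigonometric sums by scalar ones\<close>

lemma sum_character:
  assumes "0 < r" "finite I"
  shows "(\<Sum>x\<in>PiE I (\<lambda>_. {0..<int r}). character r I v x) = (if \<forall>i\<in>I. int r dvd v i then of_nat r ^ card I else 0)"
proof -
  have prod: "character r I v x = (\<Prod>i\<in>I. unit_root r (v i * x i))" for x
    unfolding character_def using assms(2)
    by (induction I rule: finite_induct) (auto simp: unit_root_add)
  have "(\<Sum>x\<in>PiE I (\<lambda>_. {0..<int r}). character r I v x) = (\<Prod>i\<in>I. \<Sum>a\<in>{0..<int r}. unit_root r (v i * a))"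
    unfolding prod using assms(2) by (subst prod_sum_PiE) auto
  also have "\<dots> = (\<Prod>i\<in>I. if int r dvd v i then of_nat r else 0)"
    by (simp add: sum_unit_root[OF assms(1)])
  also have "\<dots> = (if \<forall>i\<in>I. int r dvd v i then of_nat r ^ card I else 0)"
    using assms(2) by (auto intro: prod_zero)
  finally show ?thesis .
qed

text \<open>Products and adjoints of such \<open>F\<close> only produce unitaries with nonnegative weights, so every
  trace moment of \<open>F\<close> is controlled by the moment of the scalar function \<open>f\<close>.\<close>

inductive majorized :: "nat \<Rightarrow> nat set \<Rightarrow> nat \<Rightarrow> ((nat \<Rightarrow> int) \<Rightarrow> nat \<Rightarrow> nat \<Rightarrow> complex) \<Rightarrow> ((nat \<Rightarrow> int) \<Rightarrow> complex) \<Rightarrow> bool"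
  for r I d where
  majorized_term: "unitary_fun d U \<Longrightarrow>
     majorized r I d (\<lambda>x i j. \<alpha> * character r I v x * U i j) (\<lambda>x. of_real (cmod \<alpha>) * character r I v x)"
| majorized_add: "majorized r I d F f \<Longrightarrow> majorized r I d G g \<Longrightarrow>
     majorized r I d (\<lambda>x i j. F x i j + G x i j) (\<lambda>x. f x + g x)"

lemma character_add: "character r I v x * character r I w x = character r I (\<lambda>i. v i + w i) x"
  by (simp add: character_def unit_root_add[symmetric] sum.distrib distrib_right)

lemma cnj_character: "cnj (character r I v x) = character r I (\<lambda>i. - v i) x"
  by (simp add: character_def cnj_unit_root sum_negf)

lemma majorized_zero: "majorized r I d (\<lambda>x i j. 0) (\<lambda>x. 0)"
  using majorized_term[OF unitary_fun_id, of r I d 0 "\<lambda>_. 0"] by simp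

lemma majorized_sum:
  assumes "finite P" "\<And>p. p \<in> P \<Longrightarrow> majorized r I d (F p) (f p)"
  shows "majorized r I d (\<lambda>x i j. \<Sum>p\<in>P. F p x i j) (\<lambda>x. \<Sum>p\<in>P. f p x)"
  using assms
  by (induction P rule: finite_induct) (auto simp: majorized_zero intro: majorized_add)

lemma majorized_mmul_term:
  assumes "majorized r I d G g" "unitary_fun d U"
  shows "majorized r I d (\<lambda>x. mmul d (\<lambda>i j. \<alpha> * character r I v x * U i j) (G x))
     (\<lambda>x. of_real (cmod \<alpha>) * character r I v x * g x)"
  using assms(1)
proof (induction rule: majorized.induct)
  case (majorized_term V \<beta> w)
  have "majorized r I d (\<lambda>x i j. (\<alpha> * \<beta>) * character r I (\<lambda>i. v i + w i) x * mmul d U V i j)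
    (\<lambda>x. of_real (cmod (\<alpha> * \<beta>)) * character r I (\<lambda>i. v i + w i) x)"
    by (intro majorized.majorized_term unitary_fun_mmul assms majorized_term)
  moreover have "(\<lambda>x i j. (\<alpha> * \<beta>) * character r I (\<lambda>i. v i + w i) x * mmul d U V i j) =
    (\<lambda>x. mmul d (\<lambda>i j. \<alpha> * character r I v x * U i j) (\<lambda>i j. \<beta> * character r I w x * V i j))"
    by (simp add: fun_eq_iff mmul_def character_add[symmetric] sum_distrib_left mult_ac)
  moreover have "(\<lambda>x. of_real (cmod (\<alpha> * \<beta>)) * character r I (\<lambda>i. v i + w i) x) =
    (\<lambda>x. of_real (cmod \<alpha>) * character r I v x * (of_real (cmod \<beta>) * character r I w x))"
    by (simp add: fun_eq_iff character_add[symmetric] norm_mult mult_ac)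
  ultimately show ?case by simp
next
  case (majorized_add F f G g)
  have "majorized r I d (\<lambda>x i j. mmul d (\<lambda>i j. \<alpha> * character r I v x * U i j) (F x) i j
       + mmul d (\<lambda>i j. \<alpha> * character r I v x * U i j) (G x) i j)
     (\<lambda>x. of_real (cmod \<alpha>) * character r I v x * f x + of_real (cmod \<alpha>) * character r I v x * g x)"
    by (intro majorized.majorized_add majorized_add.IH)
  thus ?case by (simp add: mmul_def distrib_left sum.distrib)
qed

lemma majorized_mmul:
  assumes "majorized r I d F f" "majorized r I d G g"
  shows "majorized r I d (\<lambda>x. mmul d (F x) (G x)) (\<lambda>x. f x * g x)"
  using assms(1)
proof (induction rule: majorized.induct)
  case (majorized_term U \<alpha> v)
  show ?case by (rule majorized_mmul_term[OF assms(2) majorized_term])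
next
  case (majorized_add F f F' f')
  have "majorized r I d (\<lambda>x i j. mmul d (F x) (G x) i j + mmul d (F' x) (G x) i j) (\<lambda>x. f x * g x + f' x * g x)"
    by (intro majorized.majorized_add majorized_add.IH)
  thus ?case by (simp add: mmul_def distrib_right sum.distrib)
qed

lemma majorized_madj:
  assumes "majorized r I d F f"
  shows "majorized r I d (\<lambda>x. madj (F x)) (\<lambda>x. cnj (f x))"
  using assms
proof (induction rule: majorized.induct)
  case (majorized_term U \<alpha> v)
  have "majorized r I d (\<lambda>x i j. cnj \<alpha> * character r I (\<lambda>i. - v i) x * madj U i j)
    (\<lambda>x. of_real (cmod (cnj \<alpha>)) * character r I (\<lambda>i. - v i) x)"
    by (intro majorized.majorized_term unitary_fun_madj majorized_term)
  thus ?case by (simp add: madj_def cnj_character)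
next
  case (majorized_add F f G g)
  thus ?case using majorized.majorized_add[OF majorized_add.IH] by (simp add: madj_def)
qed

lemma majorized_gram_iter:
  assumes "majorized r I d F f"
  shows "majorized r I d (\<lambda>x. gram_iter d (Suc a) (F x)) (\<lambda>x. of_real (cmod (f x) ^ (2 * 2 ^ a)))"
proof (induction a)
  case 0
  show ?case using majorized_mmul[OF assms majorized_madj[OF assms]]
    by (simp add: complex_norm_square[symmetric])
next
  case (Suc a)
  have "complex_of_real (cmod (f x) ^ (2 * 2 ^ Suc a)) =
     of_real (cmod (f x) ^ (2 * 2 ^ a)) * cnj (of_real (cmod (f x) ^ (2 * 2 ^ a)))" for x
    by (simp add: power_add[symmetric] mult_2)
  thus ?case using majorized_mmul[OF Suc majorized_madj[OF Suc]] by simp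
qed

text \<open>Summed over all \<open>x\<close>, a character gives either 0 or
  \<open>r ^ card I\<close>, in any case a nonnegative real. The scalar side therefore has no
  cancellation between terms, and taking absolute values term by term on the matrix side stays below
  it, with \<open>d\<close> bounding the trace of each unitary.\<close>

lemma majorized_trace_le:
  assumes r: "0 < r" and I: "finite I" and "majorized r I d F f"
  shows "cmod (\<Sum>x\<in>PiE I (\<lambda>_. {0..<int r}). mtr d (F x)) \<le> real d * Re (\<Sum>x\<in>PiE I (\<lambda>_. {0..<int r}). f x)"
  using assms(3)
proof (induction rule: majorized.induct)
  case (majorized_term U \<alpha> v)
  define S where "S = (\<Sum>x\<in>PiE I (\<lambda>_. {0..<int r}). character r I v x)"
  have S: "cmod S = Re S" unfolding S_def sum_character[OF r I]
    using of_real_power[of "real r" "card I", where ?'a = complex, symmetric]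
    by (auto simp: norm_power simp del: of_real_power)
  have "(\<Sum>x\<in>PiE I (\<lambda>_. {0..<int r}). mtr d (\<lambda>i j. \<alpha> * character r I v x * U i j)) = \<alpha> * S * mtr d U"
    unfolding S_def mtr_def by (simp add: sum_distrib_left sum_distrib_right) (rule sum.swap)
  hence "cmod (\<Sum>x\<in>PiE I (\<lambda>_. {0..<int r}). mtr d (\<lambda>i j. \<alpha> * character r I v x * U i j)) = cmod \<alpha> * Re S * cmod (mtr d U)"
    by (simp add: norm_mult S)
  also have "\<dots> \<le> cmod \<alpha> * Re S * real d"
    using majorized_term by (intro mult_left_mono isometric_trace_le) (auto simp: unitary_fun_def S[symmetric])
  also have "\<dots> = real d * Re (\<Sum>x\<in>PiE I (\<lambda>_. {0..<int r}). of_real (cmod \<alpha>) * character r I v x)"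
    by (simp add: S_def sum_distrib_left[symmetric])
  finally show ?case .
next
  case (majorized_add F f G g)
  have "(\<Sum>x\<in>PiE I (\<lambda>_. {0..<int r}). mtr d (\<lambda>i j. F x i j + G x i j)) =
      (\<Sum>x\<in>PiE I (\<lambda>_. {0..<int r}). mtr d (F x)) + (\<Sum>x\<in>PiE I (\<lambda>_. {0..<int r}). mtr d (G x))"
    by (simp add: mtr_def sum.distrib)
  thus ?case using norm_triangle_le[OF add_mono[OF majorized_add.IH]]
    by (simp add: sum.distrib distrib_left)
qed

section \<open>Unitary duality of the trace norm\<close>

lemma isometric_iff_orthonormal_columns:
  assumes "\<And>i j. i < d \<Longrightarrow> j < d \<Longrightarrow> (\<Sum>k<d. cnj (U k i) * U k j) = of_bool (i = j)"
  shows "isometric d U"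
  unfolding isometric_def
proof
  fix v
  have "complex_of_real (\<Sum>k<d. (cmod (\<Sum>j<d. U k j * v j))\<^sup>2)
     = (\<Sum>k<d. \<Sum>i<d. \<Sum>j<d. cnj (v i) * v j * (cnj (U k i) * U k j))"
    unfolding of_real_sum complex_norm_square cnj_sum sum_product
    by (rule sum.cong[OF refl], subst sum.swap) (simp add: mult_ac)
  also have "\<dots> = (\<Sum>i<d. \<Sum>j<d. cnj (v i) * v j * (\<Sum>k<d. cnj (U k i) * U k j))"
    unfolding sum_distrib_left by (subst sum.swap, rule sum.cong[OF refl], rule sum.swap)
  also have "\<dots> = (\<Sum>i<d. \<Sum>j<d. if j = i then cnj (v i) * v i else 0)"
    by (intro sum.cong refl) (auto simp: assms)
  also have "\<dots> = complex_of_real (\<Sum>j<d. (cmod (v j))\<^sup>2)"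
    unfolding of_real_sum complex_norm_square by (simp add: mult.commute)
  finally show "(\<Sum>i<d. (cmod (\<Sum>j<d. U i j * v j))\<^sup>2) = (\<Sum>j<d. (cmod (v j))\<^sup>2)"
    unfolding of_real_eq_iff .
qed

text \<open>If every eigenvalue equalled \<open>c\<close>, then the trace would be \<open>n c\<close>.\<close>

lemma ex_eigenvector_ne:
  fixes A :: "nat \<Rightarrow> nat \<Rightarrow> complex"
  assumes tr: "(\<Sum>i<n. A i i) \<noteq> of_nat n * c"
  obtains w e where "e \<noteq> c" "\<exists>i<n. w i \<noteq> 0" "\<And>i. i < n \<Longrightarrow> (\<Sum>j<n. A i j * w j) = e * w i"
proof -
  define M where "M = Matrix.mat n n (\<lambda>(i, j). A i j)"
  have M: "M \<in> carrier_mat n n" by (simp add: M_def)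
  obtain es where es: "char_poly M = (\<Prod>a\<leftarrow>es. [:- a, 1:])" using char_poly_factorized[OF M] by blast
  obtain B where B: "B \<in> carrier_mat n n" "upper_triangular B" "similar_mat M B"
    using schur_decomposition_exists[OF M es] by blast
  obtain P Q where PQ: "P \<in> carrier_mat n n" "Q \<in> carrier_mat n n" "Q * P = 1\<^sub>m n" "M = P * B * Q"
  proof -
    obtain P Q where wit: "similar_mat_wit M B P Q" using B(3) unfolding similar_mat_def by blast
    show ?thesis
      using that[of P Q] similar_mat_witD2[OF M wit] by blast
  qed
  have trQ: "(\<Sum>i<n. (X * Y) $$ (i, i)) = (\<Sum>i<n. (Y * X) $$ (i, i))"
    if "X \<in> carrier_mat n n" "Y \<in> carrier_mat n n" for X Y :: "complex mat"
  proof -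
    have "(\<Sum>i<n. (X * Y) $$ (i, i)) = (\<Sum>i<n. \<Sum>k<n. X $$ (i, k) * Y $$ (k, i))"
      by (rule sum.cong[OF refl]) (use that in \<open>simp add: scalar_prod_def atLeast0LessThan\<close>)
    also have "\<dots> = (\<Sum>k<n. \<Sum>i<n. Y $$ (k, i) * X $$ (i, k))"
      by (subst sum.swap) (simp add: mult.commute)
    also have "\<dots> = (\<Sum>i<n. (Y * X) $$ (i, i))"
      by (rule sum.cong[OF refl]) (use that in \<open>simp add: scalar_prod_def atLeast0LessThan\<close>)
    finally show ?thesis .
  qed
  have "(\<Sum>i<n. A i i) = (\<Sum>i<n. M $$ (i, i))" by (simp add: M_def)
  also have "\<dots> = (\<Sum>i<n. (Q * (P * B)) $$ (i, i))"
    unfolding PQ(4) using PQ B by (intro trQ) auto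
  also have "Q * (P * B) = B"
    using PQ B by (subst assoc_mult_mat[symmetric, of _ n n _ n _ n]) auto
  finally have "(\<Sum>i<n. B $$ (i, i)) \<noteq> of_nat n * c" using tr by simp
  then obtain i where i: "i < n" "B $$ (i, i) \<noteq> c"
    by (metis (no_types, lifting) sum.cong card_lessThan lessThan_iff sum_constant)
  have "B $$ (i, i) \<in> set (diag_mat B)" using i B by (auto simp: diag_mat_def)
  hence "poly (char_poly M) (B $$ (i, i)) = 0"
    unfolding char_poly_similar[OF B(3)] char_poly_upper_triangular[OF B(1,2)]
    by (auto simp: poly_prod_list prod_list_zero_iff)
  hence "eigenvalue M (B $$ (i, i))" using eigenvalue_root_char_poly[OF M] by blast
  then obtain w where w: "w \<in> carrier_vec n" "w \<noteq> 0\<^sub>v n" "M *\<^sub>v w = B $$ (i, i) \<cdot>\<^sub>v w"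
    using M unfolding eigenvalue_def eigenvector_def by auto
  show ?thesis
  proof (rule that)
    show "B $$ (i, i) \<noteq> c" by fact
    show "\<exists>j<n. w $ j \<noteq> 0" using w(1,2) by (metis carrier_vecD eq_vecI index_zero_vec(1,2))
    fix k assume k: "k < n"
    have "(\<Sum>j<n. A k j * w $ j) = (M *\<^sub>v w) $ k"
      using k w(1) by (simp add: M_def scalar_prod_def atLeast0LessThan)
    thus "(\<Sum>j<n. A k j * w $ j) = B $$ (i, i) * w $ k" using k w by simp
  qed
qed

text \<open>To enlarge an orthonormal family of eigenvectors, move all known eigenvalues to a common
  value \<open>c\<close> by a rank-\<open>k\<close> perturbation; an eigenvector for another eigenvalue is then
  orthogonal to the family.\<close>

lemma ex_orthonormal_eigenvectors:
  fixes A :: "nat \<Rightarrow> nat \<Rightarrow> complex"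
  assumes herm: "\<And>i j. i < n \<Longrightarrow> j < n \<Longrightarrow> A j i = cnj (A i j)"
  shows "k \<le> n \<Longrightarrow> \<exists>u :: nat \<Rightarrow> nat \<Rightarrow> complex. \<exists>l :: nat \<Rightarrow> real.
     (\<forall>a<k. \<forall>i<n. (\<Sum>j<n. A i j * u a j) = of_real (l a) * u a i) \<and>
     (\<forall>a<k. \<forall>b<k. (\<Sum>i<n. cnj (u a i) * u b i) = of_bool (a = b))"
proof (induction k)
  case (Suc k)
  obtain u :: "nat \<Rightarrow> nat \<Rightarrow> complex" and l :: "nat \<Rightarrow> real" where
    ev: "\<And>a i. a < k \<Longrightarrow> i < n \<Longrightarrow> (\<Sum>j<n. A i j * u a j) = of_real (l a) * u a i" and
    on: "\<And>a b. a < k \<Longrightarrow> b < k \<Longrightarrow> (\<Sum>i<n. cnj (u a i) * u b i) = of_bool (a = b)"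
    using Suc.IH[OF Suc_leD[OF Suc.prems]] by blast
  \<comment> \<open>The trace of \<open>A'\<close> equals \<open>n * c\<close> only if
    \<open>(n - k) * c\<close> is the trace of \<open>A\<close> minus the known eigenvalues. The
    added 1 rules this out, so \<open>A'\<close> has an eigenvalue other than
    \<open>c\<close>.\<close>
  define c :: real where "c = (Re ((\<Sum>i<n. A i i) - (\<Sum>a<k. of_real (l a))) + 1) / real (n - k)"
  define A' where "A' i j = A i j + (\<Sum>a<k. of_real (c - l a) * u a i * cnj (u a j))" for i j
  have c: "Re ((\<Sum>i<n. A i i) - (\<Sum>a<k. of_real (l a))) + of_nat k * c \<noteq> of_nat n * c"
  proof -
    have "real (n - k) * c = Re ((\<Sum>i<n. A i i) - (\<Sum>a<k. of_real (l a))) + 1"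
      using Suc.prems by (simp add: c_def)
    thus ?thesis using Suc.prems by (simp add: of_nat_diff algebra_simps)
  qed
  have "(\<Sum>i<n. A' i i) = (\<Sum>i<n. A i i) + (\<Sum>a<k. of_real (c - l a) * (\<Sum>i<n. cnj (u a i) * u a i))"
    unfolding A'_def sum.distrib sum_distrib_left by (subst (2) sum.swap) (simp add: mult_ac)
  also have "\<dots> = (\<Sum>i<n. A i i) - (\<Sum>a<k. of_real (l a)) + of_nat k * of_real c"
    by (simp add: on sum_subtractf)
  finally have "(\<Sum>i<n. A' i i) \<noteq> of_nat n * of_real c"
    using c by (auto simp: complex_eq_iff)
  then obtain w e where e: "e \<noteq> of_real c" and w0: "\<exists>i<n. w i \<noteq> 0"
    and w: "\<And>i. i < n \<Longrightarrow> (\<Sum>j<n. A' i j * w j) = e * w i"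
    by (rule ex_eigenvector_ne[where A = A' and n = n and c = "of_real c"]) blast
  have herm': "A' j i = cnj (A' i j)" if "i < n" "j < n" for i j
    using herm[OF that] by (simp add: A'_def mult_ac)
  define N where "N = (\<Sum>i<n. cnj (w i) * w i)"
  have N: "N = complex_of_real (\<Sum>i<n. (cmod (w i))\<^sup>2)"
    unfolding N_def of_real_sum complex_norm_square by (simp add: mult.commute)
  obtain i0 where i0: "i0 < n" "w i0 \<noteq> 0" using w0 by blast
  have "0 < (\<Sum>i<n. (cmod (w i))\<^sup>2)"
    using i0 by (intro sum_pos2[of _ i0]) auto
  then obtain s where s: "0 < s" "N = of_real (s\<^sup>2)"
    unfolding N by (metis real_sqrt_gt_zero real_sqrt_pow2 less_imp_le)
  have adj: "(\<Sum>i<n. cnj (x i) * (\<Sum>j<n. B i j * y j)) = (\<Sum>j<n. cnj (\<Sum>i<n. B j i * x i) * y j)"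
    if "\<And>i j. i < n \<Longrightarrow> j < n \<Longrightarrow> B j i = cnj (B i j)" for B x y
    unfolding cnj_sum sum_distrib_left sum_distrib_right
    by (subst sum.swap, intro sum.cong refl) (simp add: that[symmetric] mult_ac)
  have "e * N = (\<Sum>i<n. cnj (w i) * (\<Sum>j<n. A' i j * w j))"
    unfolding N_def by (subst sum_distrib_left, intro sum.cong refl) (simp add: w mult.left_commute)
  also have "\<dots> = (\<Sum>j<n. cnj (\<Sum>i<n. A' j i * w i) * w j)" by (rule adj[OF herm'])
  also have "\<dots> = cnj e * N" unfolding N_def sum_distrib_left by (intro sum.cong refl) (simp add: w)
  \<comment> \<open>\<open>A'\<close> is Hermitian because the \<open>l a\<close> and
    \<open>c\<close> are real; hence its eigenvalue \<open>e\<close> is real as well.\<close>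
  finally have "e = cnj e" using s by simp
  then obtain er where er: "e = of_real er" by (metis Reals_cases Reals_cnj_iff)
  have evA': "(\<Sum>j<n. A' i j * u a j) = of_real c * u a i" if "a < k" "i < n" for a i
  proof -
    have "(\<Sum>j<n. A' i j * u a j) = (\<Sum>j<n. A i j * u a j)
        + (\<Sum>b<k. of_real (c - l b) * u b i * (\<Sum>j<n. cnj (u b j) * u a j))"
      unfolding A'_def distrib_right sum.distrib sum_distrib_left sum_distrib_right
      by (subst (2) sum.swap) (simp add: mult_ac)
    also have "(\<Sum>b<k. of_real (c - l b) * u b i * (\<Sum>j<n. cnj (u b j) * u a j))
       = (\<Sum>b<k. if b = a then of_real (c - l a) * u a i else 0)"
      using that by (intro sum.cong refl) (auto simp: on)
    also have "\<dots> = of_real (c - l a) * u a i" using that by simp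
    finally show ?thesis using ev[OF that] by (simp add: algebra_simps)
  qed
  have orth: "(\<Sum>i<n. cnj (u a i) * w i) = 0" if "a < k" for a
  proof -
    have "e * (\<Sum>i<n. cnj (u a i) * w i) = (\<Sum>i<n. cnj (u a i) * (\<Sum>j<n. A' i j * w j))"
      by (subst sum_distrib_left, intro sum.cong refl) (simp add: w mult.left_commute)
    also have "\<dots> = (\<Sum>j<n. cnj (\<Sum>i<n. A' j i * u a i) * w j)" by (rule adj[OF herm'])
    also have "\<dots> = of_real c * (\<Sum>i<n. cnj (u a i) * w i)"
      unfolding sum_distrib_left by (intro sum.cong refl) (simp add: evA'[OF that] mult_ac)
    finally show ?thesis using e by simp
  qed
  \<comment> \<open>The perturbation annihilates \<open>w\<close>, which is orthogonal to all
    \<open>u a\<close>; so the eigenvector of \<open>A'\<close> is one of \<open>A\<close>.\<close>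
  have evw: "(\<Sum>j<n. A i j * w j) = of_real er * w i" if "i < n" for i
  proof -
    have "(\<Sum>j<n. A' i j * w j) = (\<Sum>j<n. A i j * w j)
        + (\<Sum>b<k. of_real (c - l b) * u b i * (\<Sum>j<n. cnj (u b j) * w j))"
      unfolding A'_def distrib_right sum.distrib sum_distrib_left sum_distrib_right
      by (subst (2) sum.swap) (simp add: mult_ac)
    thus ?thesis using w[OF that] by (simp add: orth er)
  qed
  define u' where "u' a i = (if a = k then w i / of_real s else u a i)" for a i
  have orth': "(\<Sum>i<n. cnj (w i) * u a i) = 0" if "a < k" for a
  proof -
    have "(\<Sum>i<n. cnj (w i) * u a i) = cnj (\<Sum>i<n. cnj (u a i) * w i)" by (simp add: mult.commute)
    thus ?thesis using orth[OF that] by simp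
  qed
  show ?case
  proof (intro exI[of _ u'] exI[of _ "l(k := er)"] conjI allI impI)
    fix a i assume a: "a < Suc k" and i: "i < n"
    show "(\<Sum>j<n. A i j * u' a j) = of_real ((l(k := er)) a) * u' a i"
      using a ev[of a i] evw[OF i] i
      by (auto simp: u'_def sum_divide_distrib[symmetric] less_Suc_eq)
  next
    fix a b assume "a < Suc k" "b < Suc k"
    then consider "a < k" "b < k" | "a = k" "b < k" | "a < k" "b = k" | "a = k" "b = k" by linarith
    then show "(\<Sum>i<n. cnj (u' a i) * u' b i) = of_bool (a = b)"
    proof cases
      case 4
      have "(\<Sum>i<n. cnj (u' a i) * u' b i) = N / of_real (s\<^sup>2)"
        using 4 by (simp add: u'_def N_def sum_divide_distrib power2_eq_square)
      thus ?thesis using s 4 by simp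
    qed (auto simp: u'_def on orth orth' sum_divide_distrib[symmetric])
  qed
qed simp

text \<open>In an orthonormal eigenbasis \<open>u\<close> with real eigenvalues \<open>l\<close>,
  the matrix \<open>mat_adjoint A * A\<close> is the square of \<open>A\<close>, so the singular
  values are the absolute values of the \<open>l a\<close>. The unitary with the same eigenvectors
  and the signs of the \<open>l a\<close> as eigenvalues makes the pairing equal to their
  sum.\<close>

lemma trace_norm_dual:
  assumes A: "A \<in> carrier_mat n n" and herm: "mat_adjoint A = A"
  obtains U where "unitary_fun n U" "complex_of_real (trace_norm A) = mtr n (mmul n U (\<lambda>i j. A $$ (i, j)))"
proof -
  have adj_ix: "mat_adjoint A $$ (i, j) = cnj (A $$ (j, i))" if "i < n" "j < n" for i j
    using that A by (simp add: mat_adjoint_def mat_of_rows_index)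
  have hA: "A $$ (j, i) = cnj (A $$ (i, j))" if "i < n" "j < n" for i j
    using adj_ix[OF that(2,1)] unfolding herm .
  obtain u l where
    ev: "\<And>a i. a < n \<Longrightarrow> i < n \<Longrightarrow> (\<Sum>j<n. A $$ (i, j) * u a j) = complex_of_real (l a) * u a i" and
    on: "\<And>a b. a < n \<Longrightarrow> b < n \<Longrightarrow> (\<Sum>i<n. cnj (u a i) * u b i) = of_bool (a = b)"
    using ex_orthonormal_eigenvectors[of n "\<lambda>i j. A $$ (i, j)" n, OF hA] by blast
  define P where "P = Matrix.mat n n (\<lambda>(i, a). u a i)"
  define Q where "Q = Matrix.mat n n (\<lambda>(a, i). cnj (u a i))"
  define L where "L = Matrix.mat n n (\<lambda>(a, b). if a = b then complex_of_real ((l a)\<^sup>2) else 0)"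
  have car: "P \<in> carrier_mat n n" "Q \<in> carrier_mat n n" "L \<in> carrier_mat n n"
    by (simp_all add: P_def Q_def L_def)
  have QP: "Q * P = 1\<^sub>m n"
    by (rule eq_matI) (auto simp: P_def Q_def scalar_prod_def atLeast0LessThan on)
  have PQ: "P * Q = 1\<^sub>m n" by (rule mat_mult_left_right_inverse[OF car(2,1) QP])
  have on': "(\<Sum>a<n. u a i * cnj (u a j)) = of_bool (i = j)" if "i < n" "j < n" for i j
  proof -
    have "(P * Q) $$ (i, j) = (\<Sum>a<n. u a i * cnj (u a j))"
      using that by (simp add: P_def Q_def scalar_prod_def atLeast0LessThan)
    thus ?thesis using that by (auto simp: PQ)
  qed
  have AAP: "(A * A) * P = P * L"
  proof (rule eq_matI)
    fix i a assume "i < dim_row (P * L)" "a < dim_col (P * L)"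
    hence ia: "i < n" "a < n" using car by auto
    have AP: "(A * P) $$ (j, a) = of_real (l a) * u a j" if "j < n" for j
      using that ia A ev[of a j] by (simp add: P_def scalar_prod_def atLeast0LessThan)
    have "(A * (A * P)) $$ (i, a) = (\<Sum>j<n. A $$ (i, j) * (A * P) $$ (j, a))"
      using ia A car by (simp add: scalar_prod_def atLeast0LessThan)
    also have "\<dots> = of_real (l a) * (\<Sum>j<n. A $$ (i, j) * u a j)"
      unfolding sum_distrib_left by (intro sum.cong refl) (simp add: AP mult_ac)
    also have "\<dots> = of_real ((l a)\<^sup>2) * u a i" using ev ia by (simp add: power2_eq_square)
    also have "\<dots> = (\<Sum>b<n. if b = a then of_real ((l a)\<^sup>2) * u a i else 0)" using ia by simp
    also have "\<dots> = (\<Sum>b<n. P $$ (i, b) * L $$ (b, a))"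
      using ia by (intro sum.cong refl) (auto simp: P_def L_def)
    also have "\<dots> = (P * L) $$ (i, a)"
      using ia car by (simp add: scalar_prod_def atLeast0LessThan)
    finally show "((A * A) * P) $$ (i, a) = (P * L) $$ (i, a)"
      using A car by (subst assoc_mult_mat[of _ n n _ n _ n]) auto
  qed (use A car in auto)
  have "A * A = (A * A) * (P * Q)" using A by (simp add: PQ)
  also have "\<dots> = P * L * Q" using A car AAP by (subst assoc_mult_mat[symmetric, of _ n n _ n _ n]) auto
  finally have "similar_mat_wit (A * A) L P Q"
    using A car by (intro similar_mat_witI[OF PQ QP]) auto
  hence "char_poly (mat_adjoint A * A) = char_poly L"
    unfolding herm by (intro char_poly_similar) (auto simp: similar_mat_def)
  also have "\<dots> = (\<Prod>a\<leftarrow>map (\<lambda>a. of_real ((l a)\<^sup>2)) [0..<n]. [:- a, 1:])"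
  proof -
    have "upper_triangular L" "diag_mat L = map (\<lambda>a. of_real ((l a)\<^sup>2)) [0..<n]"
      by (auto simp: L_def diag_mat_def)
    thus ?thesis using char_poly_upper_triangular[OF car(3)] by simp
  qed
  also have "\<dots> = (\<Prod>a\<in>{0..<n}. [:- of_real ((l a)\<^sup>2), 1:])"
    using prod.distinct_set_conv_list[of "[0..<n]" "\<lambda>a. [:- complex_of_real ((l a)\<^sup>2), 1:]"] by (simp add: o_def)
  finally have cp: "char_poly (mat_adjoint A * A) = (\<Prod>a\<in>{0..<n}. [:- of_real ((l a)\<^sup>2), 1:])" .
  have pr: "proots (char_poly (mat_adjoint A * A)) = (\<Sum>a\<in>{0..<n}. {#complex_of_real ((l a)\<^sup>2)#})"
    unfolding cp by (subst proots_prod) auto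
  hence tn: "trace_norm A = (\<Sum>a<n. \<bar>l a\<bar>)"
  proof -
    have "\<Sum>\<^sub># (image_mset h (\<Sum>a\<in>S. {#f a#})) = (\<Sum>a\<in>S. h (f a))"
      if "finite S" for S :: "nat set" and f :: "nat \<Rightarrow> complex" and h :: "complex \<Rightarrow> real"
      using that by (induction S rule: finite_induct) auto
    note * = this[of "{0..<n}" "\<lambda>e. sqrt (Re e)"]
    show ?thesis
      unfolding trace_norm_def singular_values_def pr
      by (subst *) (simp_all add: atLeast0LessThan del: of_real_power)
  qed
  \<comment> \<open>The sign is 1 on the kernel, since a value 0 there would destroy
    unitarity.\<close>
  define sg where "sg a = (if l a < 0 then - 1 else 1 :: complex)" for a
  define U where "U = mmul n (\<lambda>i a. sg a * u a i) (\<lambda>a j. cnj (u a j))"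
  have sg: "sg a * cnj (sg a) = 1" "cnj (sg a) * sg a = 1" "sg a * of_real (l a) = of_real \<bar>l a\<bar>" for a
    by (auto simp: sg_def)
  have col_sg: "(\<Sum>k<n. cnj (sg i * u i k) * (sg j * u j k)) = of_bool (i = j)" if "i < n" "j < n" for i j
  proof -
    have "(\<Sum>k<n. cnj (sg i * u i k) * (sg j * u j k)) = cnj (sg i) * sg j * (\<Sum>k<n. cnj (u i k) * u j k)"
      unfolding sum_distrib_left by (intro sum.cong refl) simp
    thus ?thesis using on[OF that] sg(2)[of i] by auto
  qed
  have row_sg: "(\<Sum>a<n. cnj (cnj (sg a * u a i)) * cnj (sg a * u a j)) = of_bool (i = j)" if "i < n" "j < n" for i j
  proof -
    have "cnj (cnj (sg a * u a i)) * cnj (sg a * u a j) = (sg a * cnj (sg a)) * (u a i * cnj (u a j))" for a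
      by (simp add: mult_ac)
    thus ?thesis using on'[OF that] by (simp only: sg(1) mult_1)
  qed
  have "isometric n (\<lambda>i a. sg a * u a i)"
    by (rule isometric_iff_orthonormal_columns) (rule col_sg)
  moreover have "isometric n (\<lambda>a j. cnj (u a j))"
    by (rule isometric_iff_orthonormal_columns) (simp add: on')
  moreover have "isometric n (madj (\<lambda>i a. sg a * u a i))"
    unfolding madj_def by (rule isometric_iff_orthonormal_columns) (rule row_sg)
  moreover have "isometric n (madj (\<lambda>a j. cnj (u a j)))"
    unfolding madj_def by (rule isometric_iff_orthonormal_columns) (simp add: on)
  ultimately have "unitary_fun n U"
    unfolding U_def unitary_fun_def madj_mmul by (intro conjI isometric_mmul)
  moreover have "complex_of_real (trace_norm A) = mtr n (mmul n U (\<lambda>i j. A $$ (i, j)))"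
  proof -
    have "mtr n (mmul n U (\<lambda>i j. A $$ (i, j)))
        = (\<Sum>i<n. \<Sum>j<n. \<Sum>a<n. sg a * (cnj (u a j) * (A $$ (j, i) * u a i)))"
      by (simp add: mtr_def mmul_def U_def sum_distrib_right sum_distrib_left mult_ac)
    also have "\<dots> = (\<Sum>a<n. \<Sum>j<n. \<Sum>i<n. sg a * (cnj (u a j) * (A $$ (j, i) * u a i)))"
      by (subst sum.swap, subst (2) sum.swap, subst sum.swap) (rule refl)
    also have "\<dots> = (\<Sum>a<n. sg a * (\<Sum>j<n. cnj (u a j) * (\<Sum>i<n. A $$ (j, i) * u a i)))"
      by (simp only: sum_distrib_left)
    also have "\<dots> = (\<Sum>a<n. sg a * (of_real (l a) * (\<Sum>j<n. cnj (u a j) * u a j)))"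
    proof (rule sum.cong[OF refl])
      fix a assume "a \<in> {..<n}"
      hence "(\<Sum>j<n. cnj (u a j) * (\<Sum>i<n. A $$ (j, i) * u a i)) = (\<Sum>j<n. of_real (l a) * (cnj (u a j) * u a j))"
        by (intro sum.cong refl) (simp add: ev)
      thus "sg a * (\<Sum>j<n. cnj (u a j) * (\<Sum>i<n. A $$ (j, i) * u a i)) = sg a * (of_real (l a) * (\<Sum>j<n. cnj (u a j) * u a j))"
        by (simp only: sum_distrib_left)
    qed
    also have "\<dots> = (\<Sum>a<n. of_real \<bar>l a\<bar>)"
      by (intro sum.cong refl) (simp only: on lessThan_iff of_bool_eq(2) simp_thms mult_1_right sg(3))
    finally show ?thesis by (simp add: tn)
  qed
  ultimately show ?thesis by (rule that)
qed

section \<open>Expectation of a majorized observable\<close>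

lemma power_mean_le:
  fixes c :: "'a \<Rightarrow> real"
  assumes "finite X" "X \<noteq> {}" "even p"
  shows "((\<Sum>x\<in>X. c x) / real (card X)) ^ p \<le> (\<Sum>x\<in>X. c x ^ p) / real (card X)"
proof -
  have "0 < real (card X)" using assms by (simp add: card_gt_0_iff)
  hence "(\<Sum>x\<in>X. (1 / real (card X)) *\<^sub>R c x) ^ p \<le> (\<Sum>x\<in>X. 1 / real (card X) * c x ^ p)"
    using assms by (intro convex_on_sum[where C = UNIV and f = "\<lambda>x::real. x ^ p"] convex_power_even) auto
  thus ?thesis by (simp add: sum_divide_distrib)
qed

text \<open>Four bounds in a row: convexity in \<open>x\<close>, the trace moment for each state,
  the scalar majorant, and scalar hypercontractivity. The dimension \<open>d\<close> appears to the
  first power for every \<open>a\<close>, so its cost shrinks when the root of order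
  \<open>2 * 2 ^ a\<close> is taken.\<close>

lemma majorized_expectation_bound:
  fixes b :: "(nat \<Rightarrow> int) \<Rightarrow> real" and r n :: nat
  defines "X \<equiv> PiE {..<n} (\<lambda>_. {0..<int r})"
  assumes r: "0 < r" and hc: "hyper_const r (2 ^ a) \<kappa>" "0 \<le> \<kappa>"
    and R: "\<And>x. x \<in> X \<Longrightarrow> density_fun d (R x)"
    and maj: "majorized r {..<n} d F f"
    and f: "\<And>x. f x = (\<Sum>V\<in>X. of_real (b V) * character r {..<n} V x)"
  shows "(cmod (\<Sum>x\<in>X. mtr d (mmul d (R x) (F x))) / real r ^ n) ^ (2 * 2 ^ a)
     \<le> real d * (\<Sum>V\<in>X. \<kappa> ^ card {i\<in>{..<n}. V i \<noteq> 0} * (b V)\<^sup>2) ^ (2 ^ a)"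
proof -
  let ?p = "2 * 2 ^ a"
  have finX: "finite X" unfolding X_def by (intro finite_PiE) auto
  have cX: "card X = r ^ n" unfolding X_def by (simp add: card_PiE)
  have Xne: "X \<noteq> {}" using cX r by auto
  have rn: "0 < real r ^ n" using r by simp
  have "(cmod (\<Sum>x\<in>X. mtr d (mmul d (R x) (F x))) / real r ^ n) ^ ?p
      \<le> ((\<Sum>x\<in>X. cmod (mtr d (mmul d (R x) (F x)))) / real r ^ n) ^ ?p"
    using rn by (intro power_mono divide_right_mono norm_sum) auto
  also have "\<dots> \<le> (\<Sum>x\<in>X. cmod (mtr d (mmul d (R x) (F x))) ^ ?p) / real r ^ n"
    using power_mean_le[OF finX Xne, of ?p "\<lambda>x. cmod (mtr d (mmul d (R x) (F x)))"] by (simp add: cX)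
  also have "\<dots> \<le> (\<Sum>x\<in>X. Re (mtr d (gram_iter d (Suc a) (F x)))) / real r ^ n"
    using rn by (intro divide_right_mono sum_mono density_expectation_power_le R) auto
  also have "\<dots> \<le> (real d * (real r ^ n * (\<Sum>V\<in>X. \<kappa> ^ card {i\<in>{..<n}. V i \<noteq> 0} * (b V)\<^sup>2) ^ (2 ^ a))) / real r ^ n"
  proof (rule divide_right_mono)
    have "(\<Sum>x\<in>X. Re (mtr d (gram_iter d (Suc a) (F x)))) \<le> cmod (\<Sum>x\<in>X. mtr d (gram_iter d (Suc a) (F x)))"
      unfolding Re_sum[symmetric] by (rule complex_Re_le_cmod)
    also have "\<dots> \<le> real d * Re (\<Sum>x\<in>X. of_real (cmod (f x) ^ ?p))"
      unfolding X_def by (intro majorized_trace_le majorized_gram_iter r maj) auto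
    also have "\<dots> = real d * (\<Sum>x\<in>X. cmod (f x) ^ ?p)"
      by (simp del: of_real_power)
    also have "\<dots> \<le> real d * (real r ^ n * (\<Sum>V\<in>X. \<kappa> ^ card {i\<in>{..<n}. V i \<noteq> 0} * (b V)\<^sup>2) ^ (2 ^ a))"
      using character_hypercontractivity[OF hc(1) _ hc(2), of "{..<n}" "\<lambda>V. of_real (b V)"]
      unfolding f X_def by (intro mult_left_mono) auto
    finally show "(\<Sum>x\<in>X. Re (mtr d (gram_iter d (Suc a) (F x)))) \<le> \<dots>" .
  qed (use rn in simp)
  finally show ?thesis using rn r by simp
qed

lemma density_fun_density_matrix:
  assumes "density_matrix m A"
  shows "density_fun (2 ^ m) (\<lambda>i j. A $$ (i, j))"
proof -
  let ?d = "2 ^ m :: nat"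
  have A: "A \<in> carrier_mat ?d ?d" and h: "mat_adjoint A = A"
    and pos: "\<And>v. v \<in> carrier_vec ?d \<Longrightarrow> (A *\<^sub>v v) \<bullet>c v \<ge> 0"
    and tr: "(\<Sum>i<?d. A $$ (i, i)) = 1"
    using assms unfolding density_matrix_def by auto
  have adj_ix: "mat_adjoint A $$ (i, j) = cnj (A $$ (j, i))" if "i < ?d" "j < ?d" for i j
    using that A by (simp add: mat_adjoint_def mat_of_rows_index)
  have "0 \<le> (\<Sum>i<?d. \<Sum>j<?d. cnj (v i) * A $$ (i, j) * v j)" for v
  proof -
    have "(A *\<^sub>v Matrix.vec ?d v) \<bullet>c Matrix.vec ?d v = (\<Sum>i<?d. (\<Sum>j<?d. A $$ (i, j) * v j) * cnj (v i))"
      using A by (simp add: scalar_prod_def atLeast0LessThan)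
    thus ?thesis using pos[of "Matrix.vec ?d v"] by (simp add: sum_distrib_left sum_distrib_right mult_ac)
  qed
  moreover have "A $$ (j, i) = cnj (A $$ (i, j))" if "i < ?d" "j < ?d" for i j
    using adj_ix[OF that(2,1)] unfolding h .
  ultimately show ?thesis using tr unfolding density_fun_def mtr_def by blast
qed

lemma unitary_fun_gram_iter: "unitary_fun d U \<Longrightarrow> unitary_fun d (gram_iter d a U)"
  by (induction a) (auto intro: unitary_fun_mmul unitary_fun_madj)

text \<open>Amplification: arbitrarily high powers of the expectation are bounded by the trace of a
  unitary, hence by the fixed number \<open>d\<close>; a value above 1 would eventually exceed
  it.\<close>

lemma unitary_expectation_le_1:
  assumes R: "density_fun d R" and U: "unitary_fun d U"
  shows "cmod (mtr d (mmul d R U)) \<le> 1"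
proof (rule ccontr)
  let ?x = "cmod (mtr d (mmul d R U))"
  assume "\<not> ?x \<le> 1"
  hence x: "1 < ?x" by simp
  then obtain a where a: "real d < ?x ^ a" using real_arch_pow by blast
  also have "?x ^ a \<le> ?x ^ (2 * 2 ^ a)"
    using x less_exp[of a] by (intro power_increasing) linarith+
  also have "\<dots> \<le> Re (mtr d (gram_iter d (Suc a) U))"
    by (rule density_expectation_power_le[OF R])
  also have "\<dots> \<le> cmod (mtr d (gram_iter d (Suc a) U))" by (rule complex_Re_le_cmod)
  also have "\<dots> \<le> real d"
    using unitary_fun_gram_iter[OF U, of "Suc a"] unfolding unitary_fun_def by (intro isometric_trace_le) blast
  finally show False by simp
qed

section \<open>Fourier coefficients of random hypermatchings\<close>

text \<open>The transposed incidence matrix applied to \<open>s\<close>. For a hypermatching each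
  vertex lies in at most one edge, so every entry is a single \<open>s e\<close> or 0, and the range
  \<open>{0..<int r}\<close> is preserved by plain integer sums.\<close>

definition dual_vec :: "nat set list \<Rightarrow> (nat \<Rightarrow> int) \<Rightarrow> nat \<Rightarrow> int" where
  "dual_vec M s i = (\<Sum>e<length M. if i \<in> M ! e then s e else 0)"

lemma hypermatchingsD:
  assumes "M \<in> hypermatchings \<alpha> t n"
  shows "length M = num_edges \<alpha> t n" "\<And>e. e < length M \<Longrightarrow> M ! e \<subseteq> {..<n}"
    "\<And>e. e < length M \<Longrightarrow> card (M ! e) = t"
    "\<And>e e'. e < length M \<Longrightarrow> e' < length M \<Longrightarrow> e \<noteq> e' \<Longrightarrow> M ! e \<inter> M ! e' = {}"
  using assms unfolding hypermatchings_def by blast+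

lemma dual_vec_edge:
  assumes M: "M \<in> hypermatchings \<alpha> t n" and e: "e < length M" "i \<in> M ! e"
  shows "dual_vec M s i = s e"
proof -
  have "dual_vec M s i = (\<Sum>e'<length M. if e' = e then s e else 0)"
    unfolding dual_vec_def using hypermatchingsD(4)[OF M] e by (intro sum.cong) auto
  thus ?thesis using e by simp
qed

lemma dual_vec_notin:
  assumes "\<And>e. e < length M \<Longrightarrow> i \<notin> M ! e"
  shows "dual_vec M s i = 0"
  unfolding dual_vec_def using assms by (intro sum.neutral) auto

lemma support_dual_vec:
  assumes M: "M \<in> hypermatchings \<alpha> t n"
  shows "{i\<in>{..<n}. dual_vec M s i \<noteq> 0} = (\<Union>e\<in>{e\<in>{..<length M}. s e \<noteq> 0}. M ! e)"
proof (intro equalityI subsetI)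
  fix i assume "i \<in> {i\<in>{..<n}. dual_vec M s i \<noteq> 0}"
  hence i: "dual_vec M s i \<noteq> 0" by simp
  then obtain e where e: "e < length M" "i \<in> M ! e" using dual_vec_notin by blast
  thus "i \<in> (\<Union>e\<in>{e\<in>{..<length M}. s e \<noteq> 0}. M ! e)" using i dual_vec_edge[OF M e] by auto
next
  fix i assume "i \<in> (\<Union>e\<in>{e\<in>{..<length M}. s e \<noteq> 0}. M ! e)"
  then obtain e where e: "e < length M" "i \<in> M ! e" "s e \<noteq> 0" by auto
  thus "i \<in> {i\<in>{..<n}. dual_vec M s i \<noteq> 0}"
    using dual_vec_edge[OF M e(1,2)] hypermatchingsD(2)[OF M e(1)] by auto
qed

lemma card_support_dual_vec:
  assumes M: "M \<in> hypermatchings \<alpha> t n"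
  shows "card {i\<in>{..<n}. dual_vec M s i \<noteq> 0} = t * card {e\<in>{..<length M}. s e \<noteq> 0}"
proof -
  have "card (\<Union>e\<in>{e\<in>{..<length M}. s e \<noteq> 0}. M ! e) = (\<Sum>e\<in>{e\<in>{..<length M}. s e \<noteq> 0}. card (M ! e))"
    using hypermatchingsD(4)[OF M] finite_subset[OF hypermatchingsD(2)[OF M] finite_lessThan]
    by (intro card_UN_disjoint) auto
  also have "\<dots> = (\<Sum>e\<in>{e\<in>{..<length M}. s e \<noteq> 0}. t)"
    using hypermatchingsD(3)[OF M] by (intro sum.cong) auto
  finally show ?thesis unfolding support_dual_vec[OF M] by simp
qed

lemma dual_vec_range:
  assumes M: "M \<in> hypermatchings \<alpha> t n" and s: "s \<in> PiE {..<length M} (\<lambda>_. {0..<int r})" and r: "0 < r"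
  shows "dual_vec M s i \<in> {0..<int r}"
proof (cases "\<exists>e<length M. i \<in> M ! e")
  case True
  then show ?thesis using dual_vec_edge[OF M] PiE_mem[OF s] by fastforce
next
  case False
  then show ?thesis using dual_vec_notin[of M i s] r by auto
qed

lemma ex_permutation_mapping_subset:
  assumes T: "T \<subseteq> {..<n::nat}" "T' \<subseteq> {..<n}" "card T = card T'"
  obtains p where "bij_betw p {..<n} {..<n}" "p ` T = T'"
proof -
  have fin: "finite T" "finite T'" using T finite_subset by blast+
  obtain f where f: "bij_betw f T T'" using T fin finite_same_card_bij by blast
  have "card ({..<n} - T) = card ({..<n} - T')" using T fin by (simp add: card_Diff_subset)
  then obtain g where g: "bij_betw g ({..<n} - T) ({..<n} - T')"
    using finite_same_card_bij[of "{..<n} - T" "{..<n} - T'"] by auto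
  define p where "p i = (if i \<in> T then f i else g i)" for i
  have 1: "bij_betw p T T'" using f by (rule bij_betw_cong[THEN iffD1, rotated]) (simp add: p_def)
  have 2: "bij_betw p ({..<n} - T) ({..<n} - T')"
    using g by (rule bij_betw_cong[THEN iffD1, rotated]) (simp add: p_def)
  have "bij_betw p (T \<union> ({..<n} - T)) (T' \<union> ({..<n} - T'))"
    by (rule bij_betw_combine[OF 1 2]) auto
  moreover have "T \<union> ({..<n} - T) = {..<n}" "T' \<union> ({..<n} - T') = {..<n}" using T by auto
  ultimately show ?thesis using that[of p] 1 by (auto simp: bij_betw_def)
qed

text \<open>A permutation of the vertices that carries \<open>T\<close> to \<open>T'\<close> acts
  injectively on hypermatchings and keeps the order of their edges.\<close>

lemma card_hypermatchings_covering_le: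
  assumes T: "T \<subseteq> {..<n}" "T' \<subseteq> {..<n}" "card T = card T'"
    and E: "E \<subseteq> {..<num_edges \<alpha> t n}"
  shows "card {M\<in>hypermatchings \<alpha> t n. (\<Union>e\<in>E. M ! e) = T} \<le> card {M\<in>hypermatchings \<alpha> t n. (\<Union>e\<in>E. M ! e) = T'}"
proof -
  obtain p where p: "bij_betw p {..<n} {..<n}" "p ` T = T'"
    using ex_permutation_mapping_subset[OF T] by blast
  have inj: "inj_on p {..<n}" and im: "p ` {..<n} = {..<n}" using p by (auto simp: bij_betw_def)
  define h where "h M = map (image p) M" for M :: "nat set list"
  show ?thesis
  proof (rule card_inj_on_le[where f = h])
    show "finite {M\<in>hypermatchings \<alpha> t n. (\<Union>e\<in>E. M ! e) = T'}"
      using finite_hypermatchings by simp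
    show "inj_on h {M\<in>hypermatchings \<alpha> t n. (\<Union>e\<in>E. M ! e) = T}"
    proof (rule inj_onI)
      fix M N assume MN: "M \<in> {M\<in>hypermatchings \<alpha> t n. (\<Union>e\<in>E. M ! e) = T}"
        "N \<in> {M\<in>hypermatchings \<alpha> t n. (\<Union>e\<in>E. M ! e) = T}" "h M = h N"
      have len: "length M = length N" using MN(3) by (metis h_def length_map)
      show "M = N"
      proof (rule nth_equalityI[OF len])
        fix e assume e: "e < length M"
        hence "p ` (M ! e) = p ` (N ! e)" using MN(3) len by (metis h_def nth_map)
        moreover have "M ! e \<subseteq> {..<n}" "N ! e \<subseteq> {..<n}"
          using hypermatchingsD(2)[of M \<alpha> t n e] hypermatchingsD(2)[of N \<alpha> t n e] MN(1,2) e len by auto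
        ultimately show "M ! e = N ! e" using inj_on_image_eq_iff[OF inj] by blast
      qed
    qed
    show "h ` {M\<in>hypermatchings \<alpha> t n. (\<Union>e\<in>E. M ! e) = T} \<subseteq> {M\<in>hypermatchings \<alpha> t n. (\<Union>e\<in>E. M ! e) = T'}"
    proof
      fix N assume "N \<in> h ` {M\<in>hypermatchings \<alpha> t n. (\<Union>e\<in>E. M ! e) = T}"
      then obtain M where M: "M \<in> hypermatchings \<alpha> t n" "(\<Union>e\<in>E. M ! e) = T" and N: "N = h M" by auto
      note HM = hypermatchingsD[OF M(1)]
      have len: "length N = length M" by (simp add: N h_def)
      have nth: "N ! e = p ` (M ! e)" if "e < length M" for e using that by (simp add: N h_def)
      have "N \<in> hypermatchings \<alpha> t n"
        unfolding hypermatchings_def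
      proof (intro CollectI conjI allI impI)
        show "length N = num_edges \<alpha> t n" using len HM(1) by simp
        fix e assume "e < length N"
        hence e: "e < length M" using len by simp
        show "N ! e \<subseteq> {..<n}" using nth[OF e] HM(2)[OF e] im by blast
        show "card (N ! e) = t"
          unfolding nth[OF e] using HM(3)[OF e] card_image[OF inj_on_subset[OF inj HM(2)[OF e]]] by simp
        fix e' assume "e' < length N" "e \<noteq> e'"
        hence e': "e' < length M" "e \<noteq> e'" using len by auto
        show "N ! e \<inter> N ! e' = {}"
          unfolding nth[OF e] nth[OF e'(1)]
          using inj_on_image_Int[OF inj HM(2)[OF e] HM(2)[OF e'(1)]] HM(4)[OF e e'] by simp
      qed
      moreover have "(\<Union>e\<in>E. N ! e) = T'"
      proof -
        have "(\<Union>e\<in>E. N ! e) = (\<Union>e\<in>E. p ` (M ! e))"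
          using E HM(1) nth by (intro SUP_cong) auto
        also have "\<dots> = p ` T" using M(2) by blast
        finally show ?thesis using p by simp
      qed
      ultimately show "N \<in> {M\<in>hypermatchings \<alpha> t n. (\<Union>e\<in>E. M ! e) = T'}" by simp
    qed
  qed
qed

text \<open>By symmetry all sets of the size of \<open>T\<close> are equally likely to be the union
  of the edges in \<open>E\<close>, and these events are disjoint for different sets.\<close>

lemma card_hypermatchings_covering:
  assumes E: "E \<subseteq> {..<num_edges \<alpha> t n}" and T: "T \<subseteq> {..<n}"
  shows "(n choose card T) * card {M\<in>hypermatchings \<alpha> t n. (\<Union>e\<in>E. M ! e) = T} \<le> card (hypermatchings \<alpha> t n)"
proof -
  let ?c = "\<lambda>T. {M\<in>hypermatchings \<alpha> t n. (\<Union>e\<in>E. M ! e) = T}"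
  let ?S = "{T'. T' \<subseteq> {..<n} \<and> card T' = card T}"
  have fin: "finite ?S" by simp
  have "(n choose card T) * card (?c T) = (\<Sum>T'\<in>?S. card (?c T))"
    using n_subsets[of "{..<n}" "card T"] by simp
  also have "\<dots> \<le> (\<Sum>T'\<in>?S. card (?c T'))"
    using T E by (intro sum_mono card_hypermatchings_covering_le) auto
  also have "\<dots> = card (\<Union>T'\<in>?S. ?c T')"
    using finite_hypermatchings by (intro card_UN_disjoint[symmetric] fin) auto
  also have "\<dots> \<le> card (hypermatchings \<alpha> t n)"
    using finite_hypermatchings by (intro card_mono) auto
  finally show ?thesis .
qed

section \<open>Fourier weight of a single level\<close>

definition weight_vecs :: "nat \<Rightarrow> nat \<Rightarrow> nat \<Rightarrow> (nat \<Rightarrow> int) set" where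
  "weight_vecs r k l = {s\<in>PiE {..<k} (\<lambda>_. {0..<int r}). card {e\<in>{..<k}. s e \<noteq> 0} = l}"

lemma finite_weight_vecs: "finite (weight_vecs r k l)"
proof -
  have "finite (PiE {..<k} (\<lambda>_. {0..<int r}))" by (intro finite_PiE) auto
  thus ?thesis unfolding weight_vecs_def by simp
qed

lemma card_weight_vecs_le: "card (weight_vecs r k l) \<le> (k choose l) * (r - 1) ^ l"
proof -
  let ?S = "{E. E \<subseteq> {..<k} \<and> card E = l}"
  let ?F = "\<lambda>E. PiE {..<k} (\<lambda>e. if e \<in> E then {1..<int r} else {0})"
  have "weight_vecs r k l \<subseteq> (\<Union>E\<in>?S. ?F E)"
  proof
    fix s assume s: "s \<in> weight_vecs r k l"
    hence sP: "s \<in> PiE {..<k} (\<lambda>_. {0..<int r})" by (simp add: weight_vecs_def)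
    have "s \<in> ?F {e\<in>{..<k}. s e \<noteq> 0}"
    proof (rule PiE_I)
      fix e assume e: "e \<in> {..<k}"
      show "s e \<in> (if e \<in> {e\<in>{..<k}. s e \<noteq> 0} then {1..<int r} else {0})"
        using PiE_mem[OF sP e] e by auto
    qed (rule PiE_arb[OF sP])
    moreover have "{e\<in>{..<k}. s e \<noteq> 0} \<in> ?S" using s by (auto simp: weight_vecs_def)
    ultimately show "s \<in> (\<Union>E\<in>?S. ?F E)" by blast
  qed
  hence "card (weight_vecs r k l) \<le> card (\<Union>E\<in>?S. ?F E)"
    by (intro card_mono finite_UN_I finite_PiE) auto
  also have "\<dots> \<le> (\<Sum>E\<in>?S. card (?F E))" by (intro card_UN_le) simp
  also have "\<dots> = (\<Sum>E\<in>?S. (r - 1) ^ l)"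
  proof (intro sum.cong refl)
    fix E assume E: "E \<in> ?S"
    have "card (?F E) = (\<Prod>e<k. if e \<in> E then r - 1 else 1)"
      by (subst card_PiE) (auto intro!: prod.cong)
    also have "\<dots> = (r - 1) ^ card ({..<k} \<inter> E)" by (simp add: prod.If_cases)
    also have "{..<k} \<inter> E = E" using E by auto
    finally show "card (?F E) = (r - 1) ^ l" using E by simp
  qed
  also have "\<dots> = (k choose l) * (r - 1) ^ l" using n_subsets[of "{..<k}" l] by simp
  finally show ?thesis .
qed

text \<open>The factor \<open>1/2\<close> is the prior probability of each answer.\<close>

definition level_coeff :: "nat \<Rightarrow> nat \<Rightarrow> nat \<Rightarrow> real \<Rightarrow> nat \<Rightarrow> (nat \<Rightarrow> int) \<Rightarrow> real" where
  "level_coeff r t n \<alpha> l V =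
     real (card {p \<in> hypermatchings \<alpha> t n \<times> weight_vecs r (num_edges \<alpha> t n) l.
                  restrict (dual_vec (fst p) (snd p)) {..<n} = V})
     / (2 * real (card (hypermatchings \<alpha> t n)))"

lemma level_coeff_nonneg: "0 \<le> level_coeff r t n \<alpha> l V"
  by (simp add: level_coeff_def)

lemma level_coeff_support:
  assumes "level_coeff r t n \<alpha> l V \<noteq> 0"
  shows "card {i\<in>{..<n}. V i \<noteq> 0} = t * l"
proof -
  have "{p \<in> hypermatchings \<alpha> t n \<times> weight_vecs r (num_edges \<alpha> t n) l.
                  restrict (dual_vec (fst p) (snd p)) {..<n} = V} \<noteq> {}"
    using assms unfolding level_coeff_def by (metis card.empty divide_eq_0_iff of_nat_0)
  then obtain M s where M: "M \<in> hypermatchings \<alpha> t n" and s: "s \<in> weight_vecs r (num_edges \<alpha> t n) l"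
    and V: "V = restrict (dual_vec M s) {..<n}" by auto
  have "{i\<in>{..<n}. V i \<noteq> 0} = {i\<in>{..<n}. dual_vec M s i \<noteq> 0}" by (auto simp: V)
  thus ?thesis using card_support_dual_vec[OF M, of s] hypermatchingsD(1)[OF M] s by (simp add: weight_vecs_def)
qed

text \<open>For fixed \<open>V\<close> the vector \<open>s\<close> can be recovered from
  \<open>M\<close>, since edges are nonempty and \<open>V\<close> carries the value
  \<open>s e\<close> on every vertex of edge \<open>e\<close>. So it suffices to count the supports
  \<open>E\<close> of \<open>s\<close>, and for each of them the hypermatchings whose edges in
  \<open>E\<close> cover exactly the support of \<open>V\<close>.\<close>

lemma level_coeff_le:
  assumes t: "0 < t"
  shows "level_coeff r t n \<alpha> l V * (2 * real (n choose (t * l))) \<le> real (num_edges \<alpha> t n choose l)"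
proof (cases "level_coeff r t n \<alpha> l V = 0")
  case False
  let ?k = "num_edges \<alpha> t n"
  let ?H = "hypermatchings \<alpha> t n"
  define T where "T = {i\<in>{..<n}. V i \<noteq> 0}"
  have cT: "card T = t * l" unfolding T_def by (rule level_coeff_support[OF False])
  have T: "T \<subseteq> {..<n}" by (auto simp: T_def)
  let ?A = "{p \<in> ?H \<times> weight_vecs r ?k l. restrict (dual_vec (fst p) (snd p)) {..<n} = V}"
  let ?S = "{E. E \<subseteq> {..<?k} \<and> card E = l}"
  let ?B = "SIGMA E:?S. {M\<in>?H. (\<Union>e\<in>E. M ! e) = T}"
  let ?f = "\<lambda>p. ({e\<in>{..<?k}. snd p e \<noteq> (0::int)}, fst p)"
  have "card ?A \<le> card ?B"
  proof (rule card_inj_on_le[where f = ?f])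
    show "finite ?B" using finite_hypermatchings by (intro finite_SigmaI) auto
    show "inj_on ?f ?A"
    proof (rule inj_onI)
      fix p p' assume p: "p \<in> ?A" and p': "p' \<in> ?A" and eq: "?f p = ?f p'"
      obtain M s where p1: "p = (M, s)" by (cases p)
      obtain M' s' where p1': "p' = (M', s')" by (cases p')
      have "M' = M" using eq p1 p1' by simp
      with p1 p1' have M: "p = (M, s)" "p' = (M, s')" by simp_all
      have MH: "M \<in> ?H" and s: "s \<in> weight_vecs r ?k l" "s' \<in> weight_vecs r ?k l"
        and V: "restrict (dual_vec M s) {..<n} = restrict (dual_vec M s') {..<n}"
        using p p' M by auto
      have "s e = s' e" if "e < ?k" for e
      proof -
        have e: "e < length M" using that hypermatchingsD(1)[OF MH] by simp
        hence "M ! e \<noteq> {}" using hypermatchingsD(3)[OF MH e] t by auto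
        then obtain i where i: "i \<in> M ! e" by blast
        hence "i < n" using hypermatchingsD(2)[OF MH e] by auto
        hence "dual_vec M s i = dual_vec M s' i" using V by (metis restrict_apply' lessThan_iff)
        thus ?thesis using dual_vec_edge[OF MH e i] by simp
      qed
      hence "s = s'" using s unfolding weight_vecs_def by (intro PiE_ext[of s "{..<?k}" _ s']) auto
      thus "p = p'" using M by simp
    qed
    show "?f ` ?A \<subseteq> ?B"
    proof
      fix q assume "q \<in> ?f ` ?A"
      then obtain M s where M: "M \<in> ?H" and s: "s \<in> weight_vecs r ?k l"
        and V: "restrict (dual_vec M s) {..<n} = V" and q: "q = ({e\<in>{..<?k}. s e \<noteq> 0}, M)" by auto
      have "T = {i\<in>{..<n}. dual_vec M s i \<noteq> 0}" unfolding T_def V[symmetric] by auto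
      hence "(\<Union>e\<in>{e\<in>{..<?k}. s e \<noteq> 0}. M ! e) = T"
        using support_dual_vec[OF M, of s] hypermatchingsD(1)[OF M] by simp
      thus "q \<in> ?B" unfolding q using M s by (auto simp: weight_vecs_def)
    qed
  qed
  also have "card ?B = (\<Sum>E\<in>?S. card {M\<in>?H. (\<Union>e\<in>E. M ! e) = T})"
    using finite_hypermatchings by (intro card_SigmaI) auto
  finally have "(n choose (t * l)) * card ?A \<le> (\<Sum>E\<in>?S. (n choose card T) * card {M\<in>?H. (\<Union>e\<in>E. M ! e) = T})"
    by (simp add: sum_distrib_left[symmetric] cT)
  also have "\<dots> \<le> (\<Sum>E\<in>?S. card ?H)"
    using T by (intro sum_mono card_hypermatchings_covering) auto
  also have "\<dots> = (?k choose l) * card ?H" using n_subsets[of "{..<?k}" l] by simp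
  finally have le0: "(n choose (t * l)) * card ?A \<le> (?k choose l) * card ?H" .
  have le: "real (n choose (t * l)) * real (card ?A) \<le> real (?k choose l) * real (card ?H)"
    using of_nat_le_iff[where ?'a = real, THEN iffD2, OF le0] by (simp only: of_nat_mult)
  have "0 < real (card ?H)" using False unfolding level_coeff_def by (cases "card ?H = 0") auto
  thus ?thesis using le unfolding level_coeff_def by (simp add: divide_le_eq mult_ac)
qed simp

text \<open>Every pair \<open>(M, s)\<close> is counted for at most one \<open>V\<close>.\<close>

lemma sum_level_coeff_le:
  assumes "finite X"
  shows "(\<Sum>V\<in>X. level_coeff r t n \<alpha> l V) \<le> real (num_edges \<alpha> t n choose l) * real (r - 1) ^ l / 2"
proof -
  let ?H = "hypermatchings \<alpha> t n" and ?W = "weight_vecs r (num_edges \<alpha> t n) l"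
  let ?A = "\<lambda>V. {p \<in> ?H \<times> ?W. restrict (dual_vec (fst p) (snd p)) {..<n} = V}"
  have fin: "finite (?H \<times> ?W)" using finite_hypermatchings finite_weight_vecs by blast
  have "(\<Sum>V\<in>X. card (?A V)) = card (\<Union>V\<in>X. ?A V)"
    using assms fin by (intro card_UN_disjoint[symmetric]) auto
  also have "\<dots> \<le> card (?H \<times> ?W)" using fin by (intro card_mono) auto
  also have "\<dots> \<le> card ?H * ((num_edges \<alpha> t n choose l) * (r - 1) ^ l)"
    using card_weight_vecs_le by (simp add: card_cartesian_product)
  finally have le: "(\<Sum>V\<in>X. card (?A V)) \<le> card ?H * ((num_edges \<alpha> t n choose l) * (r - 1) ^ l)" .
  have le': "real (\<Sum>V\<in>X. card (?A V)) \<le> real (card ?H) * (real (num_edges \<alpha> t n choose l) * real (r - 1) ^ l)"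
    using of_nat_le_iff[where ?'a = real, THEN iffD2, OF le] by (simp only: of_nat_mult of_nat_power)
  have "(\<Sum>V\<in>X. level_coeff r t n \<alpha> l V) = real (\<Sum>V\<in>X. card (?A V)) / (2 * real (card ?H))"
    by (simp only: level_coeff_def sum_divide_distrib of_nat_sum)
  also have "\<dots> \<le> real (card ?H) * (real (num_edges \<alpha> t n choose l) * real (r - 1) ^ l) / (2 * real (card ?H))"
    by (intro divide_right_mono le') simp
  also have "\<dots> \<le> real (num_edges \<alpha> t n choose l) * real (r - 1) ^ l / 2"
    by (cases "card ?H = 0") auto
  finally show ?thesis .
qed

text \<open>The sum of squares is at most the largest coefficient times the sum of the coefficients;
  the 4 collects the factor 1/2 from each of the two bounds. All coefficients that occur sit on
  weight \<open>t * l\<close>, which fixes the power of \<kappa>.\<close>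

lemma level_coeff_energy_le:
  assumes t: "0 < t" and X: "finite X" and nt: "t * l \<le> n" and \<kappa>: "0 \<le> \<kappa>"
  shows "(\<Sum>V\<in>X. \<kappa> ^ card {i\<in>{..<n}. V i \<noteq> 0} * (level_coeff r t n \<alpha> l V)\<^sup>2)
    \<le> \<kappa> ^ (t * l) * (real (num_edges \<alpha> t n choose l))\<^sup>2 * real (r - 1) ^ l / (4 * real (n choose (t * l)))"
proof -
  let ?b = "level_coeff r t n \<alpha> l" and ?C = "real (num_edges \<alpha> t n choose l)" and ?N = "real (n choose (t * l))"
  have N: "0 < ?N" using nt by simp
  have b: "?b V \<le> ?C / (2 * ?N)" for V
    using level_coeff_le[OF t, of r n \<alpha> l V] N by (simp add: field_simps)
  have "(\<Sum>V\<in>X. \<kappa> ^ card {i\<in>{..<n}. V i \<noteq> 0} * (?b V)\<^sup>2) \<le> (\<Sum>V\<in>X. \<kappa> ^ (t * l) * (?C / (2 * ?N)) * ?b V)"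
  proof (rule sum_mono)
    fix V
    show "\<kappa> ^ card {i\<in>{..<n}. V i \<noteq> 0} * (?b V)\<^sup>2 \<le> \<kappa> ^ (t * l) * (?C / (2 * ?N)) * ?b V"
    proof (cases "?b V = 0")
      case False
      have "(?b V)\<^sup>2 \<le> (?C / (2 * ?N)) * ?b V"
        unfolding power2_eq_square by (intro mult_right_mono b level_coeff_nonneg)
      thus ?thesis unfolding level_coeff_support[OF False] using \<kappa>
        by (metis mult.assoc mult_left_mono zero_le_power)
    qed simp
  qed
  also have "\<dots> = \<kappa> ^ (t * l) * (?C / (2 * ?N)) * (\<Sum>V\<in>X. ?b V)" by (simp add: sum_distrib_left)
  also have "\<dots> \<le> \<kappa> ^ (t * l) * (?C / (2 * ?N)) * (?C * real (r - 1) ^ l / 2)"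
    using \<kappa> N by (intro mult_left_mono sum_level_coeff_le X) auto
  also have "\<dots> = \<kappa> ^ (t * l) * ?C\<^sup>2 * real (r - 1) ^ l / (4 * ?N)"
    by (simp add: power2_eq_square field_simps)
  finally show ?thesis .
qed

section \<open>Numerical estimates per level\<close>

text \<open>Split \<open>t * N\<close> points into \<open>t\<close> blocks of size \<open>N\<close>
  and choose \<open>l\<close> from each; formally, one term of the Vandermonde sum is kept at every
  step.\<close>

lemma choose_power_le: "(N choose l) ^ t \<le> (t * N choose (t * l))"
proof (induction t)
  case (Suc t)
  have "(N choose l) ^ Suc t \<le> (N choose l) * (t * N choose (t * l))"
    using Suc by simp
  also have "\<dots> = (N choose l) * (t * N choose (l + t * l - l))" by simp
  also have "\<dots> \<le> (\<Sum>i\<le>l + t * l. (N choose i) * (t * N choose (l + t * l - i)))"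
    by (rule member_le_sum) auto
  also have "\<dots> = (Suc t * N choose (Suc t * l))"
    using vandermonde[of N "t * N" "l + t * l"] by simp
  finally show ?case .
qed simp

text \<open>The falling factorials are compared factor by factor: \<alpha> N - i \<le> \<alpha> (N -
  i) because \<alpha> \<le> 1.\<close>

lemma choose_scaled_le:
  assumes k: "real k = \<alpha> * real N" and \<alpha>: "0 \<le> \<alpha>" "\<alpha> \<le> 1" and l: "l \<le> k"
  shows "real (k choose l) \<le> \<alpha> ^ l * real (N choose l)"
proof -
  have prod: "real (a choose l) = (\<Prod>i = 0..<l. real a - real i) / fact l" for a
    by (simp add: binomial_gbinomial gbinomial_prod_rev)
  have "(\<Prod>i = 0..<l. real k - real i) \<le> (\<Prod>i = 0..<l. \<alpha> * (real N - real i))"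
  proof (rule prod_mono)
    fix i assume "i \<in> {0..<l}"
    hence "i \<le> k" using l by simp
    moreover have "\<alpha> * real i \<le> 1 * real i" using \<alpha> by (intro mult_right_mono) auto
    ultimately show "0 \<le> real k - real i \<and> real k - real i \<le> \<alpha> * (real N - real i)"
      by (simp add: k[symmetric] algebra_simps)
  qed
  also have "\<dots> = \<alpha> ^ l * (\<Prod>i = 0..<l. real N - real i)"
    by (simp add: prod.distrib)
  finally show ?thesis unfolding prod by (simp add: divide_right_mono)
qed

text \<open>Absorb one factor, \<open>N * ((N - 1) choose (l - 1)) = l * (N choose l)\<close>, and
  bound the smaller binomial below by \<open>2 ^ (l - 1)\<close>. The gain over the plain power
  bound is the explicit factor \<open>N\<close>, which later cancels the \<open>N\<close> of the
  memory hypothesis.\<close>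

lemma choose_ge_half_range:
  assumes "1 \<le> l" "2 * l \<le> N"
  shows "real N * 2 ^ l \<le> 2 * real l * real (N choose l)"
proof -
  obtain j M where j: "l = Suc j" and M: "N = Suc M" using assms by (metis Suc_le_D le_trans mult_le_mono1 nat_mult_1 one_le_numeral One_nat_def)
  have "2 ^ j \<le> real (M choose j)"
  proof (cases "j = 0")
    case False
    have "(2 :: real) ^ j \<le> (real M / real j) ^ j"
      using False assms j M by (intro power_mono) (auto simp: field_simps)
    also have "\<dots> \<le> real (M choose j)"
      using assms j M by (intro binomial_ge_n_over_k_pow_k) auto
    finally show ?thesis .
  qed simp
  hence "real (Suc M) * 2 ^ j \<le> real (Suc M) * real (M choose j)" by (intro mult_left_mono) auto
  also have "\<dots> = real (Suc j) * real (Suc M choose Suc j)"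
    using arg_cong[OF Suc_times_binomial[of j M], of real] by (simp only: of_nat_mult)
  finally have "2 * (real (Suc M) * 2 ^ j) \<le> 2 * (real (Suc j) * real (Suc M choose Suc j))" by simp
  thus ?thesis unfolding j M power_Suc by (simp only: mult_ac)
qed

text \<open>Two of the \<open>t\<close> factors \<open>N choose l\<close> in the denominator are
  spent on the squared \<open>k choose l\<close>; the remaining \<open>t - 2\<close> provide the
  decay.\<close>

lemma level_density_le:
  assumes N: "n = t * N" and k: "real k = \<alpha> * real N" and \<alpha>: "0 \<le> \<alpha>" "\<alpha> \<le> 1"
    and l: "l \<le> k" "l \<le> N" and t: "2 \<le> t"
  shows "(real (k choose l))\<^sup>2 * real (r - 1) ^ l / (4 * real (n choose (t * l)))
     \<le> (\<alpha>\<^sup>2 * real (r - 1)) ^ l / (4 * real (N choose l) ^ (t - 2))"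
proof -
  let ?C = "real (N choose l)"
  have C: "0 < ?C" using l by simp
  have "?C ^ t \<le> real (n choose (t * l))"
    unfolding N using choose_power_le[of N l t] by (metis of_nat_le_iff of_nat_power)
  moreover have "(real (k choose l))\<^sup>2 \<le> (\<alpha> ^ l * ?C)\<^sup>2"
    using choose_scaled_le[OF k \<alpha> l(1)] by (intro power_mono) auto
  ultimately have "(real (k choose l))\<^sup>2 * real (r - 1) ^ l / (4 * real (n choose (t * l)))
     \<le> (\<alpha> ^ l * ?C)\<^sup>2 * real (r - 1) ^ l / (4 * ?C ^ t)"
    using C by (intro frac_le mult_right_mono mult_left_mono) auto
  also have "?C ^ t = ?C\<^sup>2 * ?C ^ (t - 2)" using t by (metis power_add le_add_diff_inverse)
  also have "(\<alpha> ^ l * ?C)\<^sup>2 * real (r - 1) ^ l / (4 * (?C\<^sup>2 * ?C ^ (t - 2))) =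
     (\<alpha>\<^sup>2 * real (r - 1)) ^ l / (4 * ?C ^ (t - 2))"
    using C by (simp add: power_mult_distrib power_mult[symmetric] mult.commute)
  finally show ?thesis .
qed

text \<open>The least \<open>a\<close> with \<open>m \<le> c * 2 ^ a\<close> works: if
  \<open>a > 0\<close>, minimality even gives \<open>c * 2 ^ a < 2 * m\<close>, so the slack 12
  matters only for \<open>a = 0\<close>.\<close>

lemma ex_power_two_scale:
  fixes m c :: nat
  assumes "1 \<le> c" "c \<le> 12 * m"
  obtains a where "m \<le> c * 2 ^ a" "c * 2 ^ a \<le> 12 * m"
proof -
  have "m \<le> c * 2 ^ m" using less_exp[of m] assms(1) by (metis le_trans less_imp_le mult_le_mono1 nat_mult_1)
  then obtain a where a: "m \<le> c * 2 ^ a" "\<And>i. i < a \<Longrightarrow> \<not> m \<le> c * 2 ^ i"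
    using exists_least_iff[of "\<lambda>a. m \<le> c * 2 ^ a"] by blast
  show ?thesis
  proof (cases a)
    case 0
    then show ?thesis using that[of a] a assms by simp
  next
    case (Suc i)
    then show ?thesis using that[of a] a(1) a(2)[of i] by simp
  qed
qed

section \<open>Numerical bound for one level, separately below and above
  \<open>t * l = 12 * m\<close>\<close>

context
  fixes r t l N m :: nat and \<alpha> e \<gamma> :: real
  assumes r: "2 \<le> r" and t: "2 \<le> t" and l: "1 \<le> l" "2 * l \<le> N" and \<alpha>: "0 < \<alpha>" "\<alpha>\<^sup>2 * real (r - 1) \<le> 1"
    and e: "0 < e" "e \<le> 1" and m: "1 \<le> m"
    and \<gamma>: "\<gamma> = 1 / 1000"
    and hyp: "real m ^ t * real r ^ (t + 1) * \<alpha>\<^sup>2 \<le> \<gamma> ^ t * e\<^sup>2 * real N ^ (t - 2)"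
begin

lemma low_level_bound:
  assumes E: "0 \<le> E" and q: "t * l * q \<le> 12 * m"
    and bnd: "E\<^sup>2 \<le> 2 ^ (t * l) * ((9 * real q * real r) ^ (t * l) *
       ((\<alpha>\<^sup>2 * real (r - 1)) ^ l / (4 * real (N choose l) ^ (t - 2))))"
  shows "E \<le> e / 8 * (7 / 8) ^ l"
proof -
  define x where "x = real m * real r / (real t * real l)"
  have tl: "0 < real t * real l" using t l by simp
  have "real t * real l * real q \<le> 12 * real m"
    using q by (metis of_nat_le_iff of_nat_mult of_nat_numeral)
  hence "real q \<le> 12 * real m / (real t * real l)" using tl by (simp add: field_simps)
  \<comment> \<open>Here 18 is the hypercontractive 9 times the 2 paid for the dimension, and 216 is
    18 times the 12 from the upper bound on \<open>q\<close>.\<close>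
  hence qx: "18 * real q * real r \<le> 216 * x" unfolding x_def
    using mult_right_mono[of "real q" "12 * real m / (real t * real l)" "18 * real r"] by (simp add: mult_ac)
  have x0: "0 \<le> x" by (simp add: x_def)
  have Npos: "0 < real N" using l by simp
  have lpos: "0 < real l" using l by simp
  let ?C = "real (N choose l)"
  have C: "(real N / real l) ^ l \<le> ?C" using l by (intro binomial_ge_n_over_k_pow_k) auto
  have Cpos: "0 < ?C" using l by simp
  \<comment> \<open>Everything that is raised to the power \<open>l\<close> is collected in one
    base, so a small \<open>y\<close> means geometric decay in \<open>l\<close>.\<close>
  define y where "y = (216 * x) ^ t * (\<alpha>\<^sup>2 * real r) * (real l / real N) ^ (t - 2)"
  have "E\<^sup>2 \<le> (18 * real q * real r) ^ (t * l) * (\<alpha>\<^sup>2 * real (r - 1)) ^ l / (4 * ?C ^ (t - 2))"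
  proof -
    have "18 * real q * real r = 2 * (9 * real q * real r)" by simp
    hence "(18 * real q * real r) ^ (t * l) = 2 ^ (t * l) * (9 * real q * real r) ^ (t * l)"
      by (simp only: power_mult_distrib)
    thus ?thesis using bnd by (simp only: mult.assoc times_divide_eq_right)
  qed
  also have "\<dots> \<le> (216 * x) ^ (t * l) * (\<alpha>\<^sup>2 * real r) ^ l / (4 * ((real N / real l) ^ l) ^ (t - 2))"
  proof (rule frac_le)
    have "(18 * real q * real r) ^ (t * l) \<le> (216 * x) ^ (t * l)" by (intro power_mono qx) simp
    moreover have "(\<alpha>\<^sup>2 * real (r - 1)) ^ l \<le> (\<alpha>\<^sup>2 * real r) ^ l" by (intro power_mono mult_left_mono) auto
    ultimately show "(18 * real q * real r) ^ (t * l) * (\<alpha>\<^sup>2 * real (r - 1)) ^ l \<le> (216 * x) ^ (t * l) * (\<alpha>\<^sup>2 * real r) ^ l"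
      using x0 by (intro mult_mono) auto
    show "4 * ((real N / real l) ^ l) ^ (t - 2) \<le> 4 * ?C ^ (t - 2)"
      using C by (intro mult_left_mono power_mono) auto
  qed (use x0 Npos lpos in auto)
  also have "\<dots> = y ^ l / 4"
  proof -
    have "((real N / real l) ^ l) ^ (t - 2) = ((real N / real l) ^ (t - 2)) ^ l"
      by (simp add: power_mult[symmetric] mult.commute)
    moreover have "(real l / real N) ^ (t - 2) = 1 / (real N / real l) ^ (t - 2)"
      by (simp add: power_divide)
    ultimately show ?thesis
      by (simp add: y_def power_mult_distrib power_mult power_divide)
  qed
  finally have Ey: "E\<^sup>2 \<le> y ^ l / 4" .
  \<comment> \<open>The bracket is the left-hand side of \<open>hyp\<close>: \<open>t\<close> of the
    powers of \<open>r\<close> come from \<open>x\<close>, the last one from the number of dual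
    vectors.\<close>
  have y: "y = 216 ^ t * (real m ^ t * real r ^ (t + 1) * \<alpha>\<^sup>2) / (real t ^ t * (real l)\<^sup>2 * real N ^ (t - 2))"
  proof -
    have "real l ^ t = (real l)\<^sup>2 * real l ^ (t - 2)" using t by (metis power_add le_add_diff_inverse)
    thus ?thesis using Npos lpos
      by (simp add: y_def x_def power_mult_distrib power_divide field_simps)
  qed
  also have "\<dots> \<le> 216 ^ t * (\<gamma> ^ t * e\<^sup>2 * real N ^ (t - 2)) / (real t ^ t * (real l)\<^sup>2 * real N ^ (t - 2))"
    by (intro divide_right_mono mult_left_mono hyp) auto
  also have "\<dots> = (216 * \<gamma>) ^ t * e\<^sup>2 / (real t ^ t * (real l)\<^sup>2)"
    using Npos by (simp add: power_mult_distrib field_simps)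
  also have "\<dots> \<le> (216 * \<gamma>) ^ t * e\<^sup>2 / (1 * 1)"
    using t l \<gamma> by (intro divide_left_mono mult_mono one_le_power) auto
  also have "\<dots> \<le> (216 * \<gamma>) ^ 2 * e\<^sup>2"
    using t \<gamma> unfolding mult_1_right div_by_1 by (intro mult_right_mono power_decreasing) auto
  \<comment> \<open>This fixes \<gamma> = 1/1000: 216/1000 is just below 7/32, which splits into the
    decay rate 7/8 and a factor 1/4. Of the powers of 1/4 and of \<open>e\<close> only the first is
    kept below.\<close>
  also have "\<dots> \<le> ((7 / 32) * e)\<^sup>2" unfolding \<gamma> power_mult_distrib by (intro mult_right_mono) (auto simp: power2_eq_square)
  finally have "y ^ l \<le> (((7 / 32) * e)\<^sup>2) ^ l"
    by (intro power_mono) (auto simp: y_def x_def)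
  also have "\<dots> = (((7 / 32) * e) ^ l)\<^sup>2" by (simp only: power_mult[symmetric] mult.commute[of 2 l])
  also have "\<dots> = ((7 / 32) ^ l * e ^ l)\<^sup>2" by (simp only: power_mult_distrib)
  also have "\<dots> \<le> ((7 / 32) ^ l * e ^ 1)\<^sup>2"
    using e l by (intro power_mono mult_left_mono power_decreasing) auto
  also have "\<dots> \<le> ((7 / 8) ^ l / 4 * e)\<^sup>2"
  proof -
    have "(7 / 32 :: real) ^ l = (7 / 8) ^ l * (1 / 4) ^ l" by (simp add: power_mult_distrib[symmetric])
    also have "\<dots> \<le> (7 / 8) ^ l * (1 / 4) ^ 1" using l by (intro mult_left_mono power_decreasing) auto
    finally show ?thesis using e by (intro power_mono mult_mono) auto
  qed
  finally have "E\<^sup>2 \<le> ((7 / 8) ^ l / 4 * e)\<^sup>2 / 4" using Ey by simp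
  also have "\<dots> = (e / 8 * (7 / 8) ^ l)\<^sup>2" by (simp add: power2_eq_square)
  finally show ?thesis by (rule power2_le_imp_le) (use e in simp)
qed

lemma high_level_bound:
  assumes E: "0 \<le> E" and tl: "12 * m < t * l"
    and bnd: "E\<^sup>2 \<le> 2 ^ m * ((\<alpha>\<^sup>2 * real (r - 1)) ^ l / (4 * real (N choose l) ^ (t - 2)))"
  shows "E \<le> e / 8 * (7 / 8) ^ l"
proof -
  have mr: "1 \<le> real m ^ t * real r ^ t" using m r by (simp add: power_mult_distrib[symmetric] one_le_power mult_ge1_I)
  have "1 * (\<alpha>\<^sup>2 * real r) \<le> (real m ^ t * real r ^ t) * (\<alpha>\<^sup>2 * real r)"
    by (intro mult_right_mono mr) simp
  also have "\<dots> \<le> \<gamma> ^ t * e\<^sup>2 * real N ^ (t - 2)" using hyp by (simp add: mult_ac)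
  \<comment> \<open>On these levels \<open>m\<close> and \<open>r\<close> enter \<open>hyp\<close>
    only through being at least 1.\<close>
  finally have ar: "\<alpha>\<^sup>2 * real (r - 1) \<le> \<gamma> ^ t * e\<^sup>2 * real N ^ (t - 2)"
    using mult_left_mono[of "real (r - 1)" "real r" "\<alpha>\<^sup>2"] by simp
  have a0: "0 \<le> \<alpha>\<^sup>2 * real (r - 1)" by simp
  have goal: "64 * E\<^sup>2 \<le> e\<^sup>2 * ((7 / 8) ^ l)\<^sup>2"
  \<comment> \<open>For \<open>t = 2\<close> the binomial has exponent 0 and gives no decay, but
    then \<open>hyp\<close> is free of \<open>N\<close> and makes \<alpha>^2 (r - 1) itself tiny.
    For larger \<open>t\<close> the decay comes from the binomial.\<close>
  proof (cases "t = 2")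
    case True
    have "m \<le> l" using tl True by simp
    have "4 * E\<^sup>2 \<le> 2 ^ m * (\<alpha>\<^sup>2 * real (r - 1)) ^ l" using bnd True by simp
    also have "\<dots> \<le> 2 ^ l * (\<gamma>\<^sup>2 * e\<^sup>2) ^ l"
    proof (rule mult_mono)
      show "(\<alpha>\<^sup>2 * real (r - 1)) ^ l \<le> (\<gamma>\<^sup>2 * e\<^sup>2) ^ l"
        using ar a0 True by (intro power_mono) auto
    qed (use \<open>m \<le> l\<close> in \<open>auto intro: power_increasing\<close>)
    also have "\<dots> = (2 * \<gamma>\<^sup>2) ^ l * (e\<^sup>2) ^ l" by (simp add: power_mult_distrib)
    also have "\<dots> \<le> (2 * \<gamma>\<^sup>2) ^ l * (e\<^sup>2) ^ 1"
      using e l by (intro mult_left_mono power_decreasing) (auto simp: power_le_one)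
    also have "(2 * \<gamma>\<^sup>2) ^ l \<le> ((49 / 64) * (1 / 16)) ^ l"
      unfolding \<gamma> by (intro power_mono) (auto simp: power2_eq_square)
    also have "\<dots> = ((7 / 8) ^ l)\<^sup>2 * (1 / 16) ^ l"
      by (simp add: power2_eq_square power_mult_distrib[symmetric])
    also have "(1 / 16 :: real) ^ l \<le> (1 / 16) ^ 1" using l by (intro power_decreasing) auto
    finally show ?thesis using e by (simp add: mult_ac)
  next
    case False
    define u where "u = t - 2"
    have u: "1 \<le> u" using False t by (simp add: u_def)
    \<comment> \<open>Since \<open>t \<le> 3 * u\<close>, the threshold 12 leaves a 4 here, which is
      what lets \<open>2 ^ m\<close> be absorbed by \<open>(6/5) ^ (u * l)\<close>.\<close>
    have "4 * m \<le> u * l"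
    proof -
      have "t * l \<le> 3 * u * l" using u False t by (intro mult_le_mono1) (simp add: u_def)
      thus ?thesis using tl by linarith
    qed
    let ?C = "real (N choose l)"
    have Npos: "0 < real N" using l by simp
    have Cpos: "0 < ?C" using l by simp
    have NC: "real N / ?C \<le> 2 * real l / 2 ^ l"
      using choose_ge_half_range[OF l] Cpos by (simp add: field_simps)
    have "4 * E\<^sup>2 \<le> 2 ^ m * ((\<alpha>\<^sup>2 * real (r - 1)) ^ l / ?C ^ u)" using bnd by (simp add: u_def)
    also have "\<dots> \<le> 2 ^ m * ((\<gamma> ^ t * e\<^sup>2 * real N ^ u) / ?C ^ u)"
    proof (intro mult_left_mono divide_right_mono)
      \<comment> \<open>A single factor is kept, to be traded against \<open>N ^ u\<close> by
        \<open>ar\<close>; all others are at most 1 by the assumption on \<alpha>.\<close>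
      have "(\<alpha>\<^sup>2 * real (r - 1)) ^ l \<le> (\<alpha>\<^sup>2 * real (r - 1)) ^ 1"
        using \<alpha> a0 l by (intro power_decreasing) auto
      thus "(\<alpha>\<^sup>2 * real (r - 1)) ^ l \<le> \<gamma> ^ t * e\<^sup>2 * real N ^ u" using ar by (simp add: u_def)
    qed (use Cpos in auto)
    also have "\<dots> = \<gamma> ^ t * e\<^sup>2 * (2 ^ m * (real N / ?C) ^ u)" by (simp add: power_divide mult_ac)
    also have "\<dots> \<le> \<gamma> ^ t * e\<^sup>2 * (((6 / 5) ^ l) ^ u * (2 * real l / 2 ^ l) ^ u)"
    proof (intro mult_left_mono mult_mono power_mono NC)
      \<comment> \<open>6/5 has fourth power above 2 and still leaves 6/5 divided by 2, that is 3/5,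
        as rate of decay.\<close>
      have "(2 :: real) ^ m \<le> ((6 / 5) ^ 4) ^ m" by (intro power_mono) (auto simp: power_divide)
      also have "\<dots> = (6 / 5) ^ (4 * m)" by (simp add: power_mult)
      also have "\<dots> \<le> (6 / 5) ^ (u * l)" using \<open>4 * m \<le> u * l\<close> by (intro power_increasing) auto
      also have "\<dots> = ((6 / 5) ^ l) ^ u" by (simp add: power_mult[symmetric] mult.commute)
      finally show "(2 :: real) ^ m \<le> ((6 / 5) ^ l) ^ u" .
    qed (use Cpos \<gamma> in auto)
    also have "((6 / 5) ^ l) ^ u * (2 * real l / 2 ^ l) ^ u = (2 * real l * (3 / 5) ^ l) ^ u"
    proof -
      have "(6 / 5 :: real) ^ l * (2 * real l / 2 ^ l) = 2 * real l * (3 / 5) ^ l"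
      proof -
        have "(6 / 5 :: real) = 2 * (3 / 5)" by simp
        hence "(6 / 5 :: real) ^ l = 2 ^ l * (3 / 5) ^ l" by (simp only: power_mult_distrib)
        hence "(6 / 5 :: real) ^ l / 2 ^ l = (3 / 5) ^ l" by (simp only:) simp
        thus ?thesis by (metis mult.commute times_divide_eq_left times_divide_eq_right)
      qed
      thus ?thesis by (metis power_mult_distrib)
    qed
    also have "\<gamma> ^ t * e\<^sup>2 * (2 * real l * (3 / 5) ^ l) ^ u \<le> \<gamma> ^ t * e\<^sup>2 * (8 ^ t * (49 / 64) ^ l)"
    proof (intro mult_left_mono)
      \<comment> \<open>The linear factor \<open>l\<close> is paid with the rate 5/4: 3/5 becomes
        3/4, which is just below 49/64, the square of 7/8.\<close>
      have "1 + real l * (1 / 4) \<le> (1 + 1 / 4) ^ l" by (rule Bernoulli_inequality) simp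
      hence "real l / 4 \<le> (5 / 4) ^ l" by simp
      hence "real l / 4 * (3 / 5) ^ l \<le> (5 / 4) ^ l * (3 / 5) ^ l" by (intro mult_right_mono) auto
      also have "\<dots> = (3 / 4) ^ l" by (simp add: power_mult_distrib[symmetric])
      also have "\<dots> \<le> (49 / 64) ^ l" by (intro power_mono) auto
      finally have "2 * real l * (3 / 5) ^ l \<le> 8 * (49 / 64) ^ l" by simp
      hence "(2 * real l * (3 / 5) ^ l) ^ u \<le> (8 * (49 / 64) ^ l) ^ u" by (intro power_mono) auto
      also have "\<dots> = 8 ^ u * ((49 / 64) ^ l) ^ u" by (simp add: power_mult_distrib)
      also have "\<dots> \<le> 8 ^ t * ((49 / 64) ^ l) ^ 1"
        using u by (intro mult_mono power_increasing power_decreasing) (auto simp: u_def power_le_one)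
      finally show "(2 * real l * (3 / 5) ^ l) ^ u \<le> 8 ^ t * (49 / 64) ^ l" by simp
    qed (use \<gamma> in auto)
    also have "\<dots> = (8 * \<gamma>) ^ t * (e\<^sup>2 * (49 / 64) ^ l)" by (simp add: power_mult_distrib mult_ac)
    also have "\<dots> \<le> (8 * \<gamma>) ^ 2 * (e\<^sup>2 * (49 / 64) ^ l)"
      using t \<gamma> by (intro mult_right_mono power_decreasing) auto
    also have "(49 / 64 :: real) ^ l = ((7 / 8) ^ l)\<^sup>2"
      by (simp add: power2_eq_square power_mult_distrib[symmetric])
    finally have "4 * E\<^sup>2 \<le> (8 * \<gamma>)\<^sup>2 * (e\<^sup>2 * ((7 / 8) ^ l)\<^sup>2)" .
    also have "\<dots> \<le> (1 / 16) * (e\<^sup>2 * ((7 / 8) ^ l)\<^sup>2)"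
      unfolding \<gamma> by (intro mult_right_mono) (auto simp: power2_eq_square)
    finally show ?thesis by (simp add: mult_ac)
  qed
  have "E\<^sup>2 \<le> (e / 8 * (7 / 8) ^ l)\<^sup>2"
    using goal by (simp add: power_mult_distrib power_divide)
  thus ?thesis by (rule power2_le_imp_le) (use e in simp)
qed

text \<open>With \<open>q\<close> between \<open>m / (t l)\<close> and \<open>12 m / (t l)\<close> the dimension costs only a factor \<open>2\<^bsup>t l\<^esup>\<close>.
  On levels \<open>t l > 12 m\<close> no such \<open>q\<close> exists and Parseval (\<open>q = \<kappa> = 1\<close>) suffices.\<close>

lemma level_bound:
  assumes n: "n = t * N" and k: "real k = \<alpha> * real N" "\<alpha> \<le> 1" "l \<le> k" and E: "0 \<le> E"
    and bnd: "\<And>a \<kappa>. hyper_const r (2 ^ a) \<kappa> \<Longrightarrow> 0 \<le> \<kappa> \<Longrightarrow>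
       E ^ (2 * 2 ^ a) \<le> 2 ^ m * (\<kappa> ^ (t * l) * (real (k choose l))\<^sup>2 * real (r - 1) ^ l / (4 * real (n choose (t * l)))) ^ (2 ^ a)"
  shows "E \<le> e / 8 * (7 / 8) ^ l"
proof -
  let ?Q = "(\<alpha>\<^sup>2 * real (r - 1)) ^ l / (4 * real (N choose l) ^ (t - 2))"
  have lN: "l \<le> N" using l by simp
  have Q: "\<kappa> ^ (t * l) * (real (k choose l))\<^sup>2 * real (r - 1) ^ l / (4 * real (n choose (t * l))) \<le> \<kappa> ^ (t * l) * ?Q"
    if "0 \<le> \<kappa>" for \<kappa> :: real
    using mult_left_mono[OF level_density_le[OF n k(1) _ k(2,3) lN t, of r], of "\<kappa> ^ (t * l)"] \<alpha>(1) that
    by (simp add: mult_ac)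
  have bnd': "E ^ (2 * 2 ^ a) \<le> 2 ^ m * (\<kappa> ^ (t * l) * ?Q) ^ (2 ^ a)"
    if "hyper_const r (2 ^ a) \<kappa>" "0 \<le> \<kappa>" for a and \<kappa> :: real
    using that by (intro order_trans[OF bnd[OF that]] mult_left_mono power_mono Q) auto
  show ?thesis
  proof (cases "t * l \<le> 12 * m")
    case True
    have "1 \<le> t * l" using t l by simp
    then obtain a where a: "m \<le> t * l * 2 ^ a" "t * l * 2 ^ a \<le> 12 * m"
      using ex_power_two_scale[OF _ True] by blast
    let ?q = "2 ^ a :: nat"
    let ?\<kappa> = "9 * real ?q * real r"
    have "(E\<^sup>2) ^ ?q \<le> 2 ^ m * (?\<kappa> ^ (t * l) * ?Q) ^ ?q"
      using bnd'[OF hyper_const_general[of r ?q]] r by (simp add: power_mult)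
    also have "\<dots> \<le> 2 ^ (t * l * ?q) * (?\<kappa> ^ (t * l) * ?Q) ^ ?q"
      using a by (intro mult_right_mono power_increasing) auto
    also have "\<dots> = (2 ^ (t * l) * (?\<kappa> ^ (t * l) * ?Q)) ^ ?q"
      by (simp only: power_mult power_mult_distrib)
    finally have "E\<^sup>2 \<le> 2 ^ (t * l) * (?\<kappa> ^ (t * l) * ?Q)"
      by (subst (asm) power_mono_iff) auto
    thus ?thesis by (intro low_level_bound[OF E a(2)])
  next
    case False
    have "E\<^sup>2 \<le> 2 ^ m * ?Q"
      using bnd'[of 0 1] hyper_const_parseval[of r] r by simp
    thus ?thesis using False by (intro high_level_bound[OF E]) auto
  qed
qed

end

section \<open>The posterior distributions\<close>

lemma sum_Zr_vecs: "(\<Sum>x\<in>Zr_vecs r n. F x) = (\<Sum>x\<in>PiE {..<n} (\<lambda>_. {0..<int r}). F (Matrix.vec n x))"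
proof -
  have "inj_on (Matrix.vec n) (PiE {..<n} (\<lambda>_. {0..<int r}))"
  proof (rule inj_onI)
    fix f g assume f: "f \<in> PiE {..<n} (\<lambda>_. {0..<int r})" and g: "g \<in> PiE {..<n} (\<lambda>_. {0..<int r})"
      and eq: "Matrix.vec n f = Matrix.vec n g"
    have "f i = g i" if "i < n" for i
      using arg_cong[OF eq, of "\<lambda>v. v $ i"] that by simp
    with f g show "f = g" by (intro PiE_ext[OF f g]) auto
  qed
  thus ?thesis unfolding Zr_vecs_eq_image by (subst sum.reindex) auto
qed

lemma sum_dual_vec:
  "(\<Sum>i<n. dual_vec M s i * x i) = (\<Sum>e<length M. s e * (\<Sum>i<n. (if i \<in> M ! e then 1 else 0) * x i))"
  unfolding dual_vec_def sum_distrib_left sum_distrib_right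
  by (subst sum.swap) (intro sum.cong refl, simp)

text \<open>Orthogonality over \<open>s\<close>: the sum detects that \<open>M x - w\<close>
  vanishes modulo \<open>r\<close> in every coordinate. Pairing \<open>s\<close> with
  \<open>M x\<close> is pairing \<open>dual_vec M s\<close> with \<open>x\<close>.\<close>

lemma matching_indicator_expansion:
  assumes r: "0 < r" and M: "M \<in> hypermatchings \<alpha> t n" and k: "k = num_edges \<alpha> t n"
    and w: "w \<in> PiE {..<k} (\<lambda>_. {0..<int r})"
  shows "of_real (real r ^ k * of_bool (apply_matching r M (Matrix.vec n x) = Matrix.vec k w)) =
     (\<Sum>s\<in>PiE {..<k} (\<lambda>_. {0..<int r}). character r {..<n} (dual_vec M s) x * character r {..<k} s (\<lambda>e. - w e))"
proof -
  have len: "length M = k" using hypermatchingsD(1)[OF M] k by simp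
  define y where "y e = (\<Sum>i<n. (if i \<in> M ! e then 1 else 0) * x i)" for e
  have "apply_matching r M (Matrix.vec n x) = Matrix.vec k w \<longleftrightarrow> (\<forall>e<k. y e mod int r = w e)"
    unfolding Matrix.vec_eq_iff
    by (simp add: apply_matching_def incidence_mat_def len scalar_prod_def y_def atLeast0LessThan)
  also have "\<dots> \<longleftrightarrow> (\<forall>e\<in>{..<k}. int r dvd (y e - w e))"
  proof -
    have "y e mod int r = w e \<longleftrightarrow> int r dvd (y e - w e)" if "e < k" for e
    proof -
      have "w e mod int r = w e" using PiE_mem[OF w, of e] that by simp
      thus ?thesis by (metis mod_eq_dvd_iff)
    qed
    thus ?thesis by auto
  qed
  finally have iff: "apply_matching r M (Matrix.vec n x) = Matrix.vec k w \<longleftrightarrow> (\<forall>e\<in>{..<k}. int r dvd (y e - w e))" .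
  \<comment> \<open>A character is symmetric in frequency and point; exchanging the two makes
    \<open>s\<close> the summation variable of \<open>sum_character\<close>.\<close>
  have "character r {..<n} (dual_vec M s) x * character r {..<k} s (\<lambda>e. - w e) = character r {..<k} (\<lambda>e. y e - w e) s" for s
    unfolding character_def unit_root_add[symmetric] sum_dual_vec len y_def[symmetric] sum.distrib[symmetric]
    by (simp add: algebra_simps)
  hence "(\<Sum>s\<in>PiE {..<k} (\<lambda>_. {0..<int r}). character r {..<n} (dual_vec M s) x * character r {..<k} s (\<lambda>e. - w e))
     = (if \<forall>e\<in>{..<k}. int r dvd (y e - w e) then of_nat r ^ k else 0)"
    using sum_character[OF r, of "{..<k}" "\<lambda>e. y e - w e"] by simp
  thus ?thesis unfolding iff by simp
qed

text \<open>For uniform \<open>x\<close> the vector \<open>M x\<close> is uniform: since edges are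
  nonempty, only \<open>s = 0\<close> yields the trivial character, so only its term
  survives.\<close>

lemma sum_matching_indicator:
  assumes r: "0 < r" and t: "0 < t" and M: "M \<in> hypermatchings \<alpha> t n" and k: "k = num_edges \<alpha> t n"
    and w: "w \<in> Zr_vecs r k"
  shows "(\<Sum>x\<in>Zr_vecs r n. real r ^ k * of_bool (apply_matching r M x = w)) = real r ^ n"
proof -
  let ?P = "\<lambda>j. PiE {..<j::nat} (\<lambda>_. {0..<int r})"
  have len: "length M = k" using hypermatchingsD(1)[OF M] k by simp
  obtain w' where w': "w' \<in> ?P k" "w = Matrix.vec k w'" using w unfolding Zr_vecs_eq_image by blast
  have z: "(\<forall>i\<in>{..<n}. int r dvd dual_vec M s i) \<longleftrightarrow> s = restrict (\<lambda>_. 0) {..<k}" if s: "s \<in> ?P k" for s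
  proof
    assume *: "\<forall>i\<in>{..<n}. int r dvd dual_vec M s i"
    show "s = restrict (\<lambda>_. 0) {..<k}"
    proof (rule PiE_ext[OF s])
      show "restrict (\<lambda>_. 0) {..<k} \<in> ?P k" using r by auto
      fix e assume e': "e \<in> {..<k}"
      hence e: "e < length M" using len by simp
      hence "M ! e \<noteq> {}" using hypermatchingsD(3)[OF M e] t by auto
      then obtain i where i: "i \<in> M ! e" by blast
      hence "i < n" using hypermatchingsD(2)[OF M e] by auto
      hence "int r dvd s e" using * dual_vec_edge[OF M e i, of s] by (metis lessThan_iff)
      thus "s e = restrict (\<lambda>_. 0) {..<k} e" using PiE_mem[OF s e'] e' zdvd_imp_le[of "int r" "s e"] by fastforce
    qed
  next
    assume "s = restrict (\<lambda>_. 0) {..<k}"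
    thus "\<forall>i\<in>{..<n}. int r dvd dual_vec M s i" by (auto simp: dual_vec_def len intro!: dvd_sum)
  qed
  have "complex_of_real (\<Sum>x\<in>Zr_vecs r n. real r ^ k * of_bool (apply_matching r M x = w))
     = (\<Sum>x\<in>?P n. \<Sum>s\<in>?P k. character r {..<n} (dual_vec M s) x * character r {..<k} s (\<lambda>e. - w' e))"
    unfolding sum_Zr_vecs of_real_sum w'(2) by (intro sum.cong refl matching_indicator_expansion[OF r M k w'(1)])
  also have "\<dots> = (\<Sum>s\<in>?P k. (\<Sum>x\<in>?P n. character r {..<n} (dual_vec M s) x) * character r {..<k} s (\<lambda>e. - w' e))"
    by (subst sum.swap) (simp add: sum_distrib_right)
  also have "\<dots> = (\<Sum>s\<in>?P k. if s = restrict (\<lambda>_. 0) {..<k} then of_nat r ^ n else 0)"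
  proof (rule sum.cong[OF refl])
    fix s assume s: "s \<in> ?P k"
    have "character r {..<k} (restrict (\<lambda>_. 0) {..<k}) (\<lambda>e. - w' e) = 1" by (simp add: character_def)
    thus "(\<Sum>x\<in>?P n. character r {..<n} (dual_vec M s) x) * character r {..<k} s (\<lambda>e. - w' e)
       = (if s = restrict (\<lambda>_. 0) {..<k} then of_nat r ^ n else 0)"
      unfolding sum_character[OF r finite_lessThan] z[OF s] by simp
  qed
  also have "\<dots> = complex_of_real (real r ^ n)"
  proof -
    have "finite (?P k)" by (intro finite_PiE) auto
    moreover have "restrict (\<lambda>_. 0) {..<k} \<in> ?P k" using r by auto
    ultimately show ?thesis by simp
  qed
  finally show ?thesis unfolding of_real_eq_iff .
qed

text \<open>For a hypermatching \<open>M\<close> and admissible \<open>w\<close> and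
  \<open>x\<close>, this is half the difference between the conditional probabilities of
  \<open>x\<close> given YES and given NO.\<close>

definition bias :: "nat \<Rightarrow> nat \<Rightarrow> nat \<Rightarrow> nat set list \<Rightarrow> int Matrix.vec \<Rightarrow> int Matrix.vec \<Rightarrow> real" where
  "bias r n k M w x = (real r ^ k * of_bool (apply_matching r M x = w) - 1) / (2 * real r ^ n)"

definition bias_state ::
  "nat \<Rightarrow> nat \<Rightarrow> nat \<Rightarrow> nat \<Rightarrow> (int Matrix.vec \<Rightarrow> complex mat) \<Rightarrow> nat set list \<Rightarrow> int Matrix.vec \<Rightarrow> complex mat" where
  "bias_state r n k m \<rho> M w = Matrix.mat (2 ^ m) (2 ^ m) (\<lambda>(i, j).
     \<Sum>x\<in>Zr_vecs r n. complex_of_real (bias r n k M w x) * \<rho> x $$ (i, j))"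

context
  fixes r t n k :: nat and \<alpha> :: real and P :: "outcome pmf"
  assumes r: "0 < r" and t: "0 < t" and \<alpha>: "0 \<le> \<alpha>" "\<alpha> \<le> 1" and k: "k = num_edges \<alpha> t n"
    and P: "P = joint_pmf r t n \<alpha>"
begin

private abbreviation "H \<equiv> hypermatchings \<alpha> t n"

lemma pmf_P: "pmf P z = joint_mass r t n \<alpha> z"
  unfolding P by (rule pmf_joint_pmf[OF r t \<alpha>])

lemma card_H: "0 < real (card H)"
  using hypermatchings_nonempty[OF t \<alpha>, of n] finite_hypermatchings[of \<alpha> t n] by (simp add: card_gt_0_iff)

text \<open>The value is independent of \<open>b\<close>: under YES this is the uniformity of
  \<open>M x\<close>, under NO it holds by definition. Hence \<open>(M, w)\<close> is uniform and
  reveals nothing about the answer by itself.\<close>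

lemma prob_fixed:
  assumes Mw: "M \<in> H" "w \<in> Zr_vecs r k"
  shows "measure (measure_pmf P) {z. case z of (x', b', M', w') \<Rightarrow> b' = b \<and> M' = M \<and> w' = w}
     = 1 / (2 * real (card H) * real r ^ k)" (is "measure _ ?A = _")
proof -
  let ?f = "\<lambda>x. (x, b, M, w)"
  let ?B = "?f ` Zr_vecs r n"
  have "measure (measure_pmf P) ?A = measure (measure_pmf P) ?B"
    by (rule measure_prob_cong_0) (auto simp: pmf_P joint_mass_def Let_def)
  also have "\<dots> = (\<Sum>x\<in>Zr_vecs r n. pmf P (?f x))"
    by (subst measure_measure_pmf_finite) (auto simp: finite_Zr_vecs sum.reindex inj_on_def)
  also have "\<dots> = 1 / (2 * real (card H) * real r ^ k)"
  proof (cases b)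
    case YES
    have "(\<Sum>x\<in>Zr_vecs r n. pmf P (?f x)) = (\<Sum>x\<in>Zr_vecs r n. real r ^ k * of_bool (apply_matching r M x = w)) *
       (1 / (2 * real r ^ n * real (card H) * real r ^ k))"
      unfolding sum_distrib_right
      using r Mw by (intro sum.cong refl) (simp add: pmf_P joint_mass_def Let_def YES k[symmetric])
    also have "\<dots> = 1 / (2 * real (card H) * real r ^ k)"
      unfolding sum_matching_indicator[OF r t Mw(1) k Mw(2)] using r by simp
    finally show ?thesis .
  next
    case NO
    have "(\<Sum>x\<in>Zr_vecs r n. pmf P (?f x)) = (\<Sum>x\<in>Zr_vecs r n. 1 / (2 * real r ^ n * real (card H) * real r ^ k))"
      using r Mw by (intro sum.cong refl) (simp add: pmf_P joint_mass_def Let_def NO k[symmetric])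
    also have "\<dots> = 1 / (2 * real (card H) * real r ^ k)" using r by (simp add: card_Zr_vecs)
    finally show ?thesis .
  qed
  finally show ?thesis .
qed

lemma prob_Mw:
  assumes Mw: "M \<in> H" "w \<in> Zr_vecs r k"
  shows "measure (measure_pmf P) {z. case z of (x', b', M', w') \<Rightarrow> M' = M \<and> w' = w}
     = 1 / (real (card H) * real r ^ k)" (is "measure _ ?A = _")
proof -
  let ?B = "\<lambda>b. {z. case z of (x', b', M', w') \<Rightarrow> b' = b \<and> M' = M \<and> w' = w}"
  have "?A = ?B YES \<union> ?B NO" using answer.exhaust by auto
  hence "measure (measure_pmf P) ?A = measure (measure_pmf P) (?B YES \<union> ?B NO)" by simp
  also have "\<dots> = measure (measure_pmf P) (?B YES) + measure (measure_pmf P) (?B NO)"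
    by (rule measure_pmf.finite_measure_Union) auto
  also have "\<dots> = 1 / (real (card H) * real r ^ k)" unfolding prob_fixed[OF Mw] using card_H r by simp
  finally show ?thesis .
qed

lemma prob_answer_half:
  assumes Mw: "M \<in> H" "w \<in> Zr_vecs r k"
  shows "prob_answer P b M w = 1 / 2"
proof -
  have "{z \<in> space (measure_pmf P). (case z of (x', b', M', w') \<Rightarrow> b' = b) \<and> (case z of (x', b', M', w') \<Rightarrow> M' = M \<and> w' = w)}
     = {z. case z of (x', b', M', w') \<Rightarrow> b' = b \<and> M' = M \<and> w' = w}" by auto
  moreover have "{z \<in> space (measure_pmf P). case z of (x', b', M', w') \<Rightarrow> M' = M \<and> w' = w}
     = {z. case z of (x', b', M', w') \<Rightarrow> M' = M \<and> w' = w}" by auto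
  ultimately show ?thesis unfolding prob_answer_def cond_prob_def
    using card_H r by (simp only: prob_fixed[OF Mw] prob_Mw[OF Mw]) simp
qed

lemma prob_input_eq:
  assumes Mw: "M \<in> H" "w \<in> Zr_vecs r k" and x: "x \<in> Zr_vecs r n"
  shows "prob_input P x b M w = joint_mass r t n \<alpha> (x, b, M, w) * (2 * real (card H) * real r ^ k)"
proof -
  have 1: "{z \<in> space (measure_pmf P). (case z of (x', b', M', w') \<Rightarrow> x' = x) \<and> (case z of (x', b', M', w') \<Rightarrow> b' = b \<and> M' = M \<and> w' = w)}
     = {(x, b, M, w)}" by auto
  have 2: "{z \<in> space (measure_pmf P). case z of (x', b', M', w') \<Rightarrow> b' = b \<and> M' = M \<and> w' = w}
     = {z. case z of (x', b', M', w') \<Rightarrow> b' = b \<and> M' = M \<and> w' = w}" by auto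
  show ?thesis unfolding prob_input_def cond_prob_def 1 2 prob_fixed[OF Mw]
    by (simp add: measure_pmf_single pmf_P)
qed

lemma bias_state_eq:
  assumes Mw: "M \<in> H" "w \<in> Zr_vecs r k"
  shows "complex_of_real (prob_answer P YES M w) \<cdot>\<^sub>m posterior_state r n m \<rho> P YES M w
                - complex_of_real (prob_answer P NO M w) \<cdot>\<^sub>m posterior_state r n m \<rho> P NO M w
     = bias_state r n k m \<rho> M w"
proof (rule eq_matI)
  fix i j assume "i < dim_row (bias_state r n k m \<rho> M w)" "j < dim_col (bias_state r n k m \<rho> M w)"
  hence ij: "i < 2 ^ m" "j < 2 ^ m" by (simp_all add: bias_state_def)
  have "complex_of_real (bias r n k M w x) * \<rho> x $$ (i, j)
     = complex_of_real (1/2) * (complex_of_real (prob_input P x YES M w) * \<rho> x $$ (i, j))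
      - complex_of_real (1/2) * (complex_of_real (prob_input P x NO M w) * \<rho> x $$ (i, j))"
    if x: "x \<in> Zr_vecs r n" for x
  proof -
    have "bias r n k M w x = 1/2 * prob_input P x YES M w - 1/2 * prob_input P x NO M w"
      unfolding prob_input_eq[OF Mw x] using x Mw card_H r
      by (simp add: joint_mass_def Let_def k[symmetric] bias_def field_simps)
    thus ?thesis by (simp only: of_real_diff of_real_mult left_diff_distrib mult.assoc)
  qed
  hence "(\<Sum>x\<in>Zr_vecs r n. complex_of_real (bias r n k M w x) * \<rho> x $$ (i, j)) =
     complex_of_real (1/2) * (\<Sum>x\<in>Zr_vecs r n. complex_of_real (prob_input P x YES M w) * \<rho> x $$ (i, j))
     - complex_of_real (1/2) * (\<Sum>x\<in>Zr_vecs r n. complex_of_real (prob_input P x NO M w) * \<rho> x $$ (i, j))"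
    unfolding sum_distrib_left sum_subtractf[symmetric] by (intro sum.cong refl)
  thus "(complex_of_real (prob_answer P YES M w) \<cdot>\<^sub>m posterior_state r n m \<rho> P YES M w
                - complex_of_real (prob_answer P NO M w) \<cdot>\<^sub>m posterior_state r n m \<rho> P NO M w) $$ (i, j)
     = bias_state r n k m \<rho> M w $$ (i, j)"
    using ij by (simp add: prob_answer_half[OF Mw] posterior_state_def bias_state_def)
qed (simp_all add: posterior_state_def bias_state_def)

lemma expectation_trace_norm_eq:
  "measure_pmf.expectation (marginal_Mw P) (\<lambda>(M, w).
      trace_norm (complex_of_real (prob_answer P YES M w) \<cdot>\<^sub>m posterior_state r n m \<rho> P YES M w
                - complex_of_real (prob_answer P NO M w) \<cdot>\<^sub>m posterior_state r n m \<rho> P NO M w))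
   = (\<Sum>M\<in>H. \<Sum>w\<in>Zr_vecs r k. trace_norm (bias_state r n k m \<rho> M w) / (real (card H) * real r ^ k))"
proof -
  let ?Q = "marginal_Mw P"
  have pmfQ: "pmf ?Q (M, w) = 1 / (real (card H) * real r ^ k)" if "M \<in> H" "w \<in> Zr_vecs r k" for M w
  proof -
    have "(\<lambda>(x, b, M, w). (M, w)) -` {(M, w)} = ({z. case z of (x', b', M', w') \<Rightarrow> M' = M \<and> w' = w} :: outcome set)"
      by auto
    thus ?thesis unfolding marginal_Mw_def pmf_map by (simp only: prob_Mw[OF that])
  qed
  have "set_pmf ?Q \<subseteq> H \<times> Zr_vecs r k"
  proof -
    have "M \<in> H \<and> w \<in> Zr_vecs r k" if "pmf P (x, b, M, w) \<noteq> 0" for x b M w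
      using that by (auto simp: pmf_P joint_mass_def Let_def k[symmetric] split: if_splits)
    thus ?thesis unfolding marginal_Mw_def by (fastforce simp: set_pmf_iff)
  qed
  hence "measure_pmf.expectation ?Q F = (\<Sum>z\<in>H \<times> Zr_vecs r k. F z * pmf ?Q z)" for F :: "_ \<Rightarrow> real"
    by (intro integral_measure_pmf_real) (auto simp: finite_hypermatchings finite_Zr_vecs)
  thus ?thesis unfolding sum.cartesian_product
    by (auto intro!: sum.cong simp: pmfQ bias_state_eq)
qed

end

section \<open>Level decomposition\<close>

text \<open>These settle the degenerate parameters: total 0 makes the trace norm vanish in dimension
  one, and total variation at most 1 gives the trivial bound for large error.\<close>

lemma sum_bias:
  assumes r: "0 < r" and t: "0 < t" and M: "M \<in> hypermatchings \<alpha> t n" and k: "k = num_edges \<alpha> t n"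
    and w: "w \<in> Zr_vecs r k"
  shows "(\<Sum>x\<in>Zr_vecs r n. bias r n k M w x) = 0" "(\<Sum>x\<in>Zr_vecs r n. \<bar>bias r n k M w x\<bar>) \<le> 1"
proof -
  note ind = sum_matching_indicator[OF r t M k w]
  have card: "(\<Sum>x\<in>Zr_vecs r n. 1) = real r ^ n" by (simp add: card_Zr_vecs)
  show "(\<Sum>x\<in>Zr_vecs r n. bias r n k M w x) = 0"
    unfolding bias_def sum_divide_distrib[symmetric] sum_subtractf ind card by simp
  have "(\<Sum>x\<in>Zr_vecs r n. \<bar>bias r n k M w x\<bar>)
     \<le> (\<Sum>x\<in>Zr_vecs r n. (real r ^ k * of_bool (apply_matching r M x = w) + 1) / (2 * real r ^ n))"
    using r by (intro sum_mono) (auto simp: bias_def abs_divide intro!: divide_right_mono)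
  also have "\<dots> = 1"
    unfolding sum_divide_distrib[symmetric] sum.distrib ind card using r by simp
  finally show "(\<Sum>x\<in>Zr_vecs r n. \<bar>bias r n k M w x\<bar>) \<le> 1" .
qed

text \<open>Once the unitary is fixed, the trace norm is linear in the states, so the average over
  \<open>(M, w)\<close> can be exchanged with the sums over inputs and levels.\<close>

lemma trace_norm_bias_state:
  assumes dens: "\<And>x. x \<in> Zr_vecs r n \<Longrightarrow> density_matrix m (\<rho> x)"
  obtains U where "unitary_fun (2 ^ m) U"
    "complex_of_real (trace_norm (bias_state r n k m \<rho> M w)) =
      (\<Sum>x\<in>Zr_vecs r n. of_real (bias r n k M w x) * mtr (2 ^ m) (mmul (2 ^ m) (\<lambda>i j. \<rho> x $$ (i, j)) U))"
proof -
  let ?d = "2 ^ m :: nat"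
  let ?A = "bias_state r n k m \<rho> M w"
  have A: "?A \<in> carrier_mat ?d ?d" by (simp add: bias_state_def)
  have "mat_adjoint ?A = ?A"
  proof (rule eq_matI)
    fix i j assume "i < dim_row ?A" "j < dim_col ?A"
    hence ij: "i < ?d" "j < ?d" using A by auto
    have "mat_adjoint ?A $$ (i, j) = cnj (?A $$ (j, i))"
      using ij A by (simp add: mat_adjoint_def mat_of_rows_index)
    also have "\<dots> = (\<Sum>x\<in>Zr_vecs r n. complex_of_real (bias r n k M w x) * cnj (\<rho> x $$ (j, i)))"
      using ij by (simp add: bias_state_def)
    also have "\<dots> = (\<Sum>x\<in>Zr_vecs r n. complex_of_real (bias r n k M w x) * \<rho> x $$ (i, j))"
    proof (intro sum.cong refl)
      fix x assume "x \<in> Zr_vecs r n"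
      from density_fun_density_matrix[OF dens[OF this]] have "\<rho> x $$ (i, j) = cnj (\<rho> x $$ (j, i))"
        using ij unfolding density_fun_def by blast
      thus "complex_of_real (bias r n k M w x) * cnj (\<rho> x $$ (j, i)) = complex_of_real (bias r n k M w x) * \<rho> x $$ (i, j)"
        by simp
    qed
    finally show "mat_adjoint ?A $$ (i, j) = ?A $$ (i, j)" using ij by (simp add: bias_state_def)
  qed (use A in \<open>simp_all add: mat_adjoint_def\<close>)
  then obtain U where U: "unitary_fun ?d U" and tn: "complex_of_real (trace_norm ?A) = mtr ?d (mmul ?d U (\<lambda>i j. ?A $$ (i, j)))"
    using trace_norm_dual[OF A] by blast
  have "mtr ?d (mmul ?d U (\<lambda>i j. ?A $$ (i, j)))
     = (\<Sum>i<?d. \<Sum>j<?d. \<Sum>x\<in>Zr_vecs r n. of_real (bias r n k M w x) * (\<rho> x $$ (j, i) * U i j))"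
    unfolding mtr_def mmul_def
    by (intro sum.cong refl) (simp add: bias_state_def sum_distrib_left mult_ac)
  also have "\<dots> = (\<Sum>j<?d. \<Sum>i<?d. \<Sum>x\<in>Zr_vecs r n. of_real (bias r n k M w x) * (\<rho> x $$ (j, i) * U i j))"
    by (rule sum.swap)
  also have "\<dots> = (\<Sum>j<?d. \<Sum>x\<in>Zr_vecs r n. \<Sum>i<?d. of_real (bias r n k M w x) * (\<rho> x $$ (j, i) * U i j))"
    by (intro sum.cong refl sum.swap)
  also have "\<dots> = (\<Sum>x\<in>Zr_vecs r n. \<Sum>j<?d. \<Sum>i<?d. of_real (bias r n k M w x) * (\<rho> x $$ (j, i) * U i j))"
    by (rule sum.swap)
  also have "\<dots> = (\<Sum>x\<in>Zr_vecs r n. of_real (bias r n k M w x) * mtr ?d (mmul ?d (\<lambda>i j. \<rho> x $$ (i, j)) U))"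
    by (simp add: mtr_def mmul_def sum_distrib_left)
  finally show ?thesis using that[OF U] tn by simp
qed

text \<open>The term of \<open>s = 0\<close> is 1 and cancels against the \<open>- 1\<close> in
  \<open>bias\<close>, so the levels start at 1.\<close>

lemma bias_expansion:
  assumes r: "0 < r" and M: "M \<in> hypermatchings \<alpha> t n" and k: "k = num_edges \<alpha> t n"
    and w: "w \<in> PiE {..<k} (\<lambda>_. {0..<int r})"
  shows "complex_of_real (bias r n k M (Matrix.vec k w) (Matrix.vec n x)) =
     (\<Sum>l\<in>{1..k}. \<Sum>s\<in>weight_vecs r k l.
        character r {..<n} (dual_vec M s) x * character r {..<k} s (\<lambda>e. - w e)) / (2 * of_nat r ^ n)"
proof -
  let ?P = "PiE {..<k} (\<lambda>_. {0..<int r})"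
  let ?h = "\<lambda>s. character r {..<n} (dual_vec M s) x * character r {..<k} s (\<lambda>e. - w e)"
  let ?z = "restrict (\<lambda>_. 0) {..<k} :: nat \<Rightarrow> int"
  have len: "length M = k" using hypermatchingsD(1)[OF M] k by simp
  have finP: "finite ?P" by (intro finite_PiE) auto
  have "(\<Sum>s\<in>?P. ?h s) = (\<Sum>l\<in>{..k}. \<Sum>s\<in>weight_vecs r k l. ?h s)"
    unfolding weight_vecs_def
  proof (rule sum.group[symmetric, OF finP])
    have "card {e\<in>{..<k}. s e \<noteq> 0} \<le> card {..<k}" for s :: "nat \<Rightarrow> int" by (intro card_mono) auto
    thus "(\<lambda>s. card {e \<in> {..<k}. s e \<noteq> 0}) ` ?P \<subseteq> {..k}" by auto
  qed simp
  also have "{..k} = insert 0 {1..k}" by auto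
  also have "(\<Sum>l\<in>insert 0 {1..k}. \<Sum>s\<in>weight_vecs r k l. ?h s) = (\<Sum>s\<in>weight_vecs r k 0. ?h s) + (\<Sum>l\<in>{1..k}. \<Sum>s\<in>weight_vecs r k l. ?h s)"
    by (subst sum.insert) auto
  also have "weight_vecs r k 0 = {?z}"
  proof (intro equalityI subsetI)
    fix s assume "s \<in> weight_vecs r k 0"
    hence s: "s \<in> ?P" "\<And>e. e < k \<Longrightarrow> s e = 0" by (auto simp: weight_vecs_def)
    have "?z \<in> ?P" using r by auto
    hence "s = ?z" using s by (intro PiE_ext[OF s(1)]) auto
    thus "s \<in> {?z}" by simp
  qed (use r in \<open>auto simp: weight_vecs_def\<close>)
  also have "(\<Sum>s\<in>{?z}. ?h s) = 1"
  proof -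
    have "dual_vec M ?z i = 0" for i unfolding dual_vec_def len by (intro sum.neutral) auto
    thus ?thesis by (simp add: character_def)
  qed
  finally have "(\<Sum>s\<in>?P. ?h s) = 1 + (\<Sum>l\<in>{1..k}. \<Sum>s\<in>weight_vecs r k l. ?h s)" .
  hence "of_real (real r ^ k * of_bool (apply_matching r M (Matrix.vec n x) = Matrix.vec k w)) - 1
     = (\<Sum>l\<in>{1..k}. \<Sum>s\<in>weight_vecs r k l. ?h s)"
    using matching_indicator_expansion[OF r M k w, of x] by simp
  thus ?thesis by (simp add: bias_def del: of_bool_eq_iff)
qed

section \<open>The operator of a single level\<close>

definition level_coord :: "nat \<Rightarrow> nat \<Rightarrow> nat \<Rightarrow> real \<Rightarrow> nat \<Rightarrow> (nat set list \<times> (nat \<Rightarrow> int) \<times> (nat \<Rightarrow> int)) set" where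
  "level_coord r t n \<alpha> l = hypermatchings \<alpha> t n \<times> PiE {..<num_edges \<alpha> t n} (\<lambda>_. {0..<int r}) \<times> weight_vecs r (num_edges \<alpha> t n) l"

text \<open>The operator of level \<open>l\<close> in the overview. The denominator is the uniform
  weight of \<open>(M, w)\<close> times the 2 of \<open>bias\<close>; the remaining
  \<open>r ^ n\<close> is left to the average over \<open>x\<close>.\<close>

definition level_op ::
  "nat \<Rightarrow> nat \<Rightarrow> nat \<Rightarrow> real \<Rightarrow> nat \<Rightarrow> (nat set list \<Rightarrow> (nat \<Rightarrow> int) \<Rightarrow> nat \<Rightarrow> nat \<Rightarrow> complex) \<Rightarrow> (nat \<Rightarrow> int) \<Rightarrow> nat \<Rightarrow> nat \<Rightarrow> complex" where
  "level_op r t n \<alpha> l U x i j = (\<Sum>(M, w, s)\<in>level_coord r t n \<alpha> l.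
     (character r {..<num_edges \<alpha> t n} s (\<lambda>e. - w e) / (2 * of_nat (card (hypermatchings \<alpha> t n)) * of_nat r ^ num_edges \<alpha> t n))
       * character r {..<n} (dual_vec M s) x * U M w i j)"

lemma finite_level_coord: "finite (level_coord r t n \<alpha> l)"
proof -
  have "finite (PiE {..<num_edges \<alpha> t n} (\<lambda>_. {0..<int r}))" by (intro finite_PiE) auto
  thus ?thesis unfolding level_coord_def by (simp add: finite_hypermatchings finite_weight_vecs)
qed

text \<open>The phase depending on \<open>w\<close> has modulus one and disappears in the majorant,
  so the sum over \<open>w\<close> merely cancels \<open>r ^ k\<close>. Grouping the pairs
  \<open>(M, s)\<close> by the frequency they produce turns what is left into
  \<open>level_coeff\<close>.\<close>

lemma majorized_level_op:
  assumes r: "0 < r" and U: "\<And>M w. M \<in> hypermatchings \<alpha> t n \<Longrightarrow> w \<in> PiE {..<num_edges \<alpha> t n} (\<lambda>_. {0..<int r}) \<Longrightarrow> unitary_fun d (U M w)"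
  shows "majorized r {..<n} d (level_op r t n \<alpha> l U)
    (\<lambda>x. \<Sum>V\<in>PiE {..<n} (\<lambda>_. {0..<int r}). of_real (level_coeff r t n \<alpha> l V) * character r {..<n} V x)"
proof -
  let ?H = "hypermatchings \<alpha> t n" and ?k = "num_edges \<alpha> t n"
  let ?W = "PiE {..<?k} (\<lambda>_. {0..<int r})" and ?S = "weight_vecs r ?k l" and ?X = "PiE {..<n} (\<lambda>_. {0..<int r})"
  let ?c = "\<lambda>p. character r {..<?k} (snd (snd p)) (\<lambda>e. - fst (snd p) e) / (2 * of_nat (card ?H) * of_nat r ^ ?k)"
  let ?f = "\<lambda>x. \<Sum>p\<in>level_coord r t n \<alpha> l. of_real (cmod (?c p)) * character r {..<n} (dual_vec (fst p) (snd (snd p))) x"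
  have "majorized r {..<n} d (\<lambda>x i j. \<Sum>p\<in>level_coord r t n \<alpha> l. ?c p * character r {..<n} (dual_vec (fst p) (snd (snd p))) x * U (fst p) (fst (snd p)) i j) ?f"
  proof (rule majorized_sum[OF finite_level_coord])
    fix p assume "p \<in> level_coord r t n \<alpha> l"
    hence "fst p \<in> ?H" "fst (snd p) \<in> ?W" by (simp_all add: level_coord_def mem_Times_iff)
    hence "unitary_fun d (U (fst p) (fst (snd p)))" by (rule U)
    thus "majorized r {..<n} d (\<lambda>x i j. ?c p * character r {..<n} (dual_vec (fst p) (snd (snd p))) x * U (fst p) (fst (snd p)) i j)
      (\<lambda>x. of_real (cmod (?c p)) * character r {..<n} (dual_vec (fst p) (snd (snd p))) x)"
      by (rule majorized_term[where \<alpha> = "?c p" and v = "dual_vec (fst p) (snd (snd p))" and U = "U (fst p) (fst (snd p))"])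
  qed
  moreover have "(\<lambda>x i j. \<Sum>p\<in>level_coord r t n \<alpha> l. ?c p * character r {..<n} (dual_vec (fst p) (snd (snd p))) x * U (fst p) (fst (snd p)) i j) = level_op r t n \<alpha> l U"
    by (simp add: fun_eq_iff level_op_def case_prod_unfold)
  moreover have "?f x = (\<Sum>V\<in>?X. of_real (level_coeff r t n \<alpha> l V) * character r {..<n} V x)" for x
  proof -
    let ?v = "\<lambda>p. restrict (dual_vec (fst p) (snd p)) {..<n}"
    have cH: "complex_of_nat (card (PiE {..<?k} (\<lambda>_. {0..<int r}))) = of_nat r ^ ?k" by (simp add: card_PiE)
    have cm: "cmod (?c p) = 1 / (2 * real (card ?H) * real r ^ ?k)" for p
      by (simp add: norm_divide norm_mult norm_power character_def)
    have ch: "character r {..<n} (dual_vec M s) x = character r {..<n} (restrict (dual_vec M s) {..<n}) x" for M s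
      unfolding character_def by (intro arg_cong[where f = "unit_root r"] sum.cong) auto
    have "?f x = (\<Sum>M\<in>?H. \<Sum>w\<in>?W. \<Sum>s\<in>?S. 1 / (2 * of_nat (card ?H) * of_nat r ^ ?k) * character r {..<n} (dual_vec M s) x)"
      unfolding level_coord_def cm by (simp add: sum.cartesian_product case_prod_unfold del: sum_constant)
    also have "\<dots> = (\<Sum>M\<in>?H. \<Sum>s\<in>?S. 1 / (2 * of_nat (card ?H)) * character r {..<n} (dual_vec M s) x)"
    proof (rule sum.cong[OF refl])
      fix M
      show "(\<Sum>w\<in>?W. \<Sum>s\<in>?S. 1 / (2 * of_nat (card ?H) * of_nat r ^ ?k) * character r {..<n} (dual_vec M s) x)
        = (\<Sum>s\<in>?S. 1 / (2 * of_nat (card ?H)) * character r {..<n} (dual_vec M s) x)"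
        using r unfolding sum_constant cH sum_distrib_left by (intro sum.cong refl) simp
    qed
    also have "\<dots> = (\<Sum>p\<in>?H \<times> ?S. 1 / (2 * of_nat (card ?H)) * character r {..<n} (?v p) x)"
      by (simp add: sum.cartesian_product case_prod_unfold ch)
    also have "\<dots> = (\<Sum>V\<in>?X. \<Sum>p\<in>{p\<in>?H \<times> ?S. ?v p = V}. 1 / (2 * of_nat (card ?H)) * character r {..<n} (?v p) x)"
    proof (rule sum.group[symmetric])
      show "finite ?X" by (intro finite_PiE) auto
      show "?v ` (?H \<times> ?S) \<subseteq> ?X"
      proof
        fix v assume "v \<in> ?v ` (?H \<times> ?S)"
        then obtain M s where M: "M \<in> ?H" and s: "s \<in> ?S" and v: "v = restrict (dual_vec M s) {..<n}" by auto
        have "s \<in> PiE {..<length M} (\<lambda>_. {0..<int r})"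
          using s hypermatchingsD(1)[OF M] by (simp add: weight_vecs_def)
        thus "v \<in> ?X" unfolding v using dual_vec_range[OF M _ r] by simp
      qed
    qed (simp add: finite_hypermatchings finite_weight_vecs)
    also have "\<dots> = (\<Sum>V\<in>?X. of_real (level_coeff r t n \<alpha> l V) * character r {..<n} V x)"
      by (intro sum.cong refl) (simp add: level_coeff_def)
    finally show ?thesis .
  qed
  ultimately show ?thesis by simp
qed

section \<open>Summation over the levels\<close>

lemma sum_geometric_seven_eighths: "(\<Sum>l\<in>{1..k}. (7 / 8 :: real) ^ l) \<le> 7"
proof -
  have "(\<Sum>l\<in>{1..k}. (7 / 8 :: real) ^ l) + 7 * (7 / 8) ^ k = 7"
    by (induction k) auto
  thus ?thesis by (smt (verit) zero_le_power divide_nonneg_nonneg)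
qed

text \<open>Raising the memory bound to the power \<open>t\<close> clears all fractional exponents;
  \<open>e\<close> stands for the square of the error parameter.\<close>

lemma memory_bound_power:
  assumes r: "0 < r" and t: "2 \<le> t" and N: "0 < N" and pos: "0 < \<alpha>" "0 < e" "0 < \<gamma>"
    and bnd: "real m \<le> \<gamma> / real r powr (1 + 1 / real t) * (e / \<alpha>) powr (2 / real t) * real N powr (1 - 2 / real t)"
  shows "real m ^ t * real r ^ (t + 1) * \<alpha>\<^sup>2 \<le> \<gamma> ^ t * e\<^sup>2 * real N ^ (t - 2)"
proof -
  have t0: "0 < real t" using t by simp
  have 1: "(real r powr (1 + 1 / real t)) ^ t = real r ^ (t + 1)"
  proof -
    have "(real r powr (1 + 1 / real t)) ^ t = real r powr (real (t + 1))"
    proof -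
      have "real t * (1 + 1 / real t) = real (t + 1)" using t0 by (simp add: distrib_left)
      thus ?thesis using r t0 by (simp only: powr_power)
    qed
    thus ?thesis using r by (simp only: powr_realpow of_nat_0_less_iff)
  qed
  have 2: "((e / \<alpha>) powr (2 / real t)) ^ t = (e / \<alpha>)\<^sup>2"
  proof -
    have "((e / \<alpha>) powr (2 / real t)) ^ t = (e / \<alpha>) powr (real 2)"
      using t0 pos by (simp add: powr_power)
    also have "\<dots> = (e / \<alpha>)\<^sup>2" using pos by (intro powr_realpow) simp
    finally show ?thesis .
  qed
  have 3: "(real N powr (1 - 2 / real t)) ^ t = real N ^ (t - 2)"
  proof -
    have "(real N powr (1 - 2 / real t)) ^ t = real N powr (real (t - 2))"
    proof -
      have "real t * (1 - 2 / real t) = real (t - 2)" using t0 t by (simp add: right_diff_distrib of_nat_diff)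
      thus ?thesis using t0 N by (simp only: powr_power)
    qed
    thus ?thesis using N by (simp only: powr_realpow of_nat_0_less_iff)
  qed
  have "real m ^ t \<le> (\<gamma> / real r powr (1 + 1 / real t) * (e / \<alpha>) powr (2 / real t) * real N powr (1 - 2 / real t)) ^ t"
    by (intro power_mono bnd) simp
  also have "\<dots> = \<gamma> ^ t / real r ^ (t + 1) * (e / \<alpha>)\<^sup>2 * real N ^ (t - 2)"
    unfolding power_mult_distrib power_divide[of \<gamma>] 1 2 3 ..
  finally have "real m ^ t * (real r ^ (t + 1) * \<alpha>\<^sup>2) \<le> \<gamma> ^ t / real r ^ (t + 1) * (e / \<alpha>)\<^sup>2 * real N ^ (t - 2) * (real r ^ (t + 1) * \<alpha>\<^sup>2)"
    by (rule mult_right_mono) simp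
  also have "\<dots> = \<gamma> ^ t * e\<^sup>2 * real N ^ (t - 2)"
    using r pos by (simp add: power_divide field_simps)
  finally show ?thesis by (simp add: mult_ac)
qed


lemma level_expectation_bound:
  fixes U :: "nat set list \<Rightarrow> (nat \<Rightarrow> int) \<Rightarrow> nat \<Rightarrow> nat \<Rightarrow> complex" and r n :: nat
  defines "X \<equiv> PiE {..<n} (\<lambda>_. {0..<int r})"
  assumes r: "2 \<le> r" and t: "2 \<le> t" and N: "n = t * N" and k: "k = num_edges \<alpha> t n" "real k = \<alpha> * real N"
    and \<alpha>: "0 < \<alpha>" "\<alpha> \<le> 1 / 2" "\<alpha>\<^sup>2 * real (r - 1) \<le> 1" and e: "0 < e" "e \<le> 1" and m: "1 \<le> m"
    and hyp: "real m ^ t * real r ^ (t + 1) * \<alpha>\<^sup>2 \<le> (1 / 1000) ^ t * e\<^sup>2 * real N ^ (t - 2)"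
    and l: "1 \<le> l" "l \<le> k"
    and R: "\<And>x. x \<in> X \<Longrightarrow> density_fun (2 ^ m) (R x)"
    and U: "\<And>M w. M \<in> hypermatchings \<alpha> t n \<Longrightarrow> w \<in> PiE {..<k} (\<lambda>_. {0..<int r}) \<Longrightarrow> unitary_fun (2 ^ m) (U M w)"
  shows "cmod (\<Sum>x\<in>X. mtr (2 ^ m) (mmul (2 ^ m) (R x) (level_op r t n \<alpha> l U x))) / real r ^ n \<le> e / 8 * (7 / 8) ^ l"
proof -
  \<comment> \<open>The assumption \<alpha> \<le> 1/2 enters here: every level stays in the lower
    half of the binomial range.\<close>
  have "real k \<le> 1 / 2 * real N" unfolding k(2) using \<alpha> by (intro mult_right_mono) auto
  hence lN: "2 * l \<le> N" using l by linarith
  have r0: "0 < r" using r by simp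
  have maj: "majorized r {..<n} (2 ^ m) (level_op r t n \<alpha> l U)
    (\<lambda>x. \<Sum>V\<in>X. of_real (level_coeff r t n \<alpha> l V) * character r {..<n} V x)"
    unfolding X_def using U by (intro majorized_level_op r0) (simp add: k(1))
  have finX: "finite X" unfolding X_def by (intro finite_PiE) auto
  have tl: "t * l \<le> n" unfolding N using lN by simp
  have a1: "\<alpha> \<le> 1" using \<alpha> by simp
  show ?thesis
  proof (rule level_bound[OF r t l(1) lN \<alpha>(1,3) e m refl hyp N k(2) a1 l(2)])
    fix a and \<kappa> :: real assume hc: "hyper_const r (2 ^ a) \<kappa>" and \<kappa>: "0 \<le> \<kappa>"
    have "(cmod (\<Sum>x\<in>X. mtr (2 ^ m) (mmul (2 ^ m) (R x) (level_op r t n \<alpha> l U x))) / real r ^ n) ^ (2 * 2 ^ a)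
     \<le> real (2 ^ m) * (\<Sum>V\<in>X. \<kappa> ^ card {i\<in>{..<n}. V i \<noteq> 0} * (level_coeff r t n \<alpha> l V)\<^sup>2) ^ (2 ^ a)"
      unfolding X_def by (rule majorized_expectation_bound[OF r0 hc \<kappa> _ maj[unfolded X_def]]) (use R in \<open>auto simp: X_def\<close>)
    also have "\<dots> \<le> real (2 ^ m) * (\<kappa> ^ (t * l) * (real (k choose l))\<^sup>2 * real (r - 1) ^ l / (4 * real (n choose (t * l)))) ^ (2 ^ a)"
      unfolding k(1) using \<kappa> t finX tl
      by (intro mult_left_mono power_mono level_coeff_energy_le sum_nonneg) auto
    finally show "(cmod (\<Sum>x\<in>X. mtr (2 ^ m) (mmul (2 ^ m) (R x) (level_op r t n \<alpha> l U x))) / real r ^ n) ^ (2 * 2 ^ a)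
      \<le> 2 ^ m * (\<kappa> ^ (t * l) * (real (k choose l))\<^sup>2 * real (r - 1) ^ l / (4 * real (n choose (t * l)))) ^ (2 ^ a)"
      by simp
  qed simp
qed

text \<open>All triples \<open>(M, w, s)\<close> of one level are gathered into one operator before
  any absolute value is taken, so the average over hypermatchings stays inside the moment
  estimate.\<close>

lemma average_bias_expansion:
  fixes U :: "nat set list \<Rightarrow> (nat \<Rightarrow> int) \<Rightarrow> nat \<Rightarrow> nat \<Rightarrow> complex" and r n :: nat
  defines "X \<equiv> PiE {..<n} (\<lambda>_. {0..<int r})"
  assumes r: "0 < r" and k: "k = num_edges \<alpha> t n"
  shows "(\<Sum>M\<in>hypermatchings \<alpha> t n. \<Sum>w\<in>PiE {..<k} (\<lambda>_. {0..<int r}).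
      (\<Sum>x\<in>X. of_real (bias r n k M (Matrix.vec k w) (Matrix.vec n x)) * mtr d (mmul d (R x) (U M w)))
        / (of_nat (card (hypermatchings \<alpha> t n)) * of_nat r ^ k))
    = (\<Sum>l\<in>{1..k}. (\<Sum>x\<in>X. mtr d (mmul d (R x) (level_op r t n \<alpha> l U x))) / of_nat r ^ n)"
proof -
  let ?H = "hypermatchings \<alpha> t n" and ?W = "PiE {..<k} (\<lambda>_. {0..<int r})"
  let ?c = "of_nat (card ?H) * of_nat r ^ k :: complex"
  let ?chi = "\<lambda>M s w x. character r {..<n} (dual_vec M s) x * character r {..<k} s (\<lambda>e. - w e)"
  let ?T = "\<lambda>M w x. mtr d (mmul d (R x) (U M w))"
  have L: "mtr d (mmul d (R x) (level_op r t n \<alpha> l U x))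
     = (\<Sum>M\<in>?H. \<Sum>w\<in>?W. \<Sum>s\<in>weight_vecs r k l. ?chi M s w x * ?T M w x / (2 * ?c))" for x l
  proof -
    let ?q = "\<lambda>p. ?chi (fst p) (snd (snd p)) (fst (snd p)) x / (2 * ?c)"
    have lo: "level_op r t n \<alpha> l U x = (\<lambda>i j. \<Sum>p\<in>level_coord r t n \<alpha> l. ?q p * U (fst p) (fst (snd p)) i j)"
      unfolding level_op_def by (simp add: fun_eq_iff case_prod_unfold k mult_ac)
    have "mtr d (mmul d (R x) (level_op r t n \<alpha> l U x))
       = (\<Sum>i<d. \<Sum>j<d. \<Sum>p\<in>level_coord r t n \<alpha> l. ?q p * (R x i j * U (fst p) (fst (snd p)) j i))"
      unfolding mtr_def mmul_def lo sum_distrib_left by (intro sum.cong refl) (simp only: mult_ac)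
    also have "\<dots> = (\<Sum>i<d. \<Sum>p\<in>level_coord r t n \<alpha> l. \<Sum>j<d. ?q p * (R x i j * U (fst p) (fst (snd p)) j i))"
      by (intro sum.cong refl sum.swap)
    also have "\<dots> = (\<Sum>p\<in>level_coord r t n \<alpha> l. \<Sum>i<d. \<Sum>j<d. ?q p * (R x i j * U (fst p) (fst (snd p)) j i))"
      by (rule sum.swap)
    also have "\<dots> = (\<Sum>p\<in>level_coord r t n \<alpha> l. ?q p * ?T (fst p) (fst (snd p)) x)"
      by (simp add: mtr_def mmul_def sum_distrib_left)
    also have "\<dots> = (\<Sum>M\<in>?H. \<Sum>w\<in>?W. \<Sum>s\<in>weight_vecs r k l. ?chi M s w x * ?T M w x / (2 * ?c))"
      unfolding level_coord_def k[symmetric] by (simp add: sum.cartesian_product case_prod_unfold)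
    finally show ?thesis .
  qed
  have B: "of_real (bias r n k M (Matrix.vec k w) (Matrix.vec n x)) * ?T M w x
     = (\<Sum>l\<in>{1..k}. \<Sum>s\<in>weight_vecs r k l. ?chi M s w x * ?T M w x / (2 * of_nat r ^ n))"
    if "M \<in> ?H" "w \<in> ?W" for M w x
    unfolding bias_expansion[OF r that(1) k that(2)]
    by (simp add: sum_divide_distrib sum_distrib_right)
  have "(\<Sum>M\<in>?H. \<Sum>w\<in>?W. (\<Sum>x\<in>X. of_real (bias r n k M (Matrix.vec k w) (Matrix.vec n x)) * ?T M w x) / ?c)
     = (\<Sum>M\<in>?H. \<Sum>w\<in>?W. \<Sum>x\<in>X. \<Sum>l\<in>{1..k}. \<Sum>s\<in>weight_vecs r k l. ?chi M s w x * ?T M w x / (2 * ?c) / of_nat r ^ n)"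
    unfolding sum_divide_distrib
  proof (intro sum.cong refl)
    fix M w x assume "M \<in> ?H" "w \<in> ?W"
    show "of_real (bias r n k M (Matrix.vec k w) (Matrix.vec n x)) * ?T M w x / ?c
      = (\<Sum>l\<in>{1..k}. \<Sum>s\<in>weight_vecs r k l. ?chi M s w x * ?T M w x / (2 * ?c) / of_nat r ^ n)"
      unfolding B[OF \<open>M \<in> ?H\<close> \<open>w \<in> ?W\<close>] sum_divide_distrib by (simp add: mult_ac)
  qed
  also have "\<dots> = (\<Sum>M\<in>?H. \<Sum>w\<in>?W. \<Sum>l\<in>{1..k}. \<Sum>x\<in>X. \<Sum>s\<in>weight_vecs r k l. ?chi M s w x * ?T M w x / (2 * ?c) / of_nat r ^ n)"
    by (intro sum.cong refl sum.swap)
  also have "\<dots> = (\<Sum>M\<in>?H. \<Sum>l\<in>{1..k}. \<Sum>w\<in>?W. \<Sum>x\<in>X. \<Sum>s\<in>weight_vecs r k l. ?chi M s w x * ?T M w x / (2 * ?c) / of_nat r ^ n)"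
    by (intro sum.cong refl sum.swap)
  also have "\<dots> = (\<Sum>l\<in>{1..k}. \<Sum>M\<in>?H. \<Sum>w\<in>?W. \<Sum>x\<in>X. \<Sum>s\<in>weight_vecs r k l. ?chi M s w x * ?T M w x / (2 * ?c) / of_nat r ^ n)"
    by (rule sum.swap)
  also have "\<dots> = (\<Sum>l\<in>{1..k}. \<Sum>M\<in>?H. \<Sum>x\<in>X. \<Sum>w\<in>?W. \<Sum>s\<in>weight_vecs r k l. ?chi M s w x * ?T M w x / (2 * ?c) / of_nat r ^ n)"
    by (intro sum.cong refl sum.swap)
  also have "\<dots> = (\<Sum>l\<in>{1..k}. \<Sum>x\<in>X. \<Sum>M\<in>?H. \<Sum>w\<in>?W. \<Sum>s\<in>weight_vecs r k l. ?chi M s w x * ?T M w x / (2 * ?c) / of_nat r ^ n)"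
    by (intro sum.cong refl sum.swap)
  also have "\<dots> = (\<Sum>l\<in>{1..k}. (\<Sum>x\<in>X. mtr d (mmul d (R x) (level_op r t n \<alpha> l U x))) / of_nat r ^ n)"
    unfolding L by (simp only: sum_divide_distrib)
  finally show ?thesis .
qed

lemma average_trace_norm_le:
  fixes r t n m :: nat and \<alpha> e :: real and \<rho> :: "int Matrix.vec \<Rightarrow> complex mat"
  assumes r: "2 \<le> r" and t: "2 \<le> t" "t dvd n" and \<alpha>: "0 < \<alpha>" "\<alpha> * real n / real t \<in> \<int>"
    "\<alpha> \<le> min (1/2) ((real r - 1) powr (-1/2))"
    and dens: "\<And>x. x \<in> Zr_vecs r n \<Longrightarrow> density_matrix m (\<rho> x)" and e: "0 < e"
    and mem: "real m \<le> (1 / 1000) / real r powr (1 + 1 / real t) * (e / \<alpha>) powr (2 / real t)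
                    * (real n / real t) powr (1 - 2 / real t)"
    and k: "k = num_edges \<alpha> t n"
  shows "(\<Sum>M\<in>hypermatchings \<alpha> t n. \<Sum>w\<in>Zr_vecs r k.
     trace_norm (bias_state r n k m \<rho> M w) / (real (card (hypermatchings \<alpha> t n)) * real r ^ k)) \<le> e"
proof -
  let ?H = "hypermatchings \<alpha> t n" and ?W = "PiE {..<k} (\<lambda>_. {0..<int r})" and ?X = "PiE {..<n} (\<lambda>_. {0..<int r})"
  let ?d = "2 ^ m :: nat"
  let ?tn = "\<lambda>M w. trace_norm (bias_state r n k m \<rho> M w)"
  let ?E = "\<Sum>M\<in>?H. \<Sum>w\<in>Zr_vecs r k. ?tn M w / (real (card ?H) * real r ^ k)"
  have r0: "0 < r" and t0: "0 < t" and \<alpha>2: "\<alpha> \<le> 1 / 2" "\<alpha> \<le> 1" using r t \<alpha> by auto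
  obtain N where N: "n = t * N" using t(2) by blast
  have kN: "real k = \<alpha> * real N"
  proof -
    have "\<alpha> * real n / real t = \<alpha> * real N" using t0 N by simp
    hence "\<alpha> * real N \<in> \<int>" "k = nat \<lfloor>\<alpha> * real N\<rfloor>" using \<alpha>(2) k by (simp_all add: num_edges_def)
    then obtain z where z: "\<alpha> * real N = of_int z" "k = nat z" by (auto elim!: Ints_cases)
    have "0 \<le> \<alpha> * real N" using \<alpha>(1) by simp
    thus ?thesis unfolding z by simp
  qed
  have cH: "0 < real (card ?H)"
    using hypermatchings_nonempty[OF t0 _ \<alpha>2(2), of n] \<alpha>(1) finite_hypermatchings[of \<alpha> t n] by (simp add: card_gt_0_iff)
  have R: "density_fun ?d (\<lambda>i j. \<rho> x $$ (i, j))" if "x \<in> Zr_vecs r n" for x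
    by (rule density_fun_density_matrix[OF dens[OF that]])
  let ?dual = "\<lambda>M w U. unitary_fun ?d U \<and> complex_of_real (?tn M w) =
      (\<Sum>x\<in>Zr_vecs r n. of_real (bias r n k M w x) * mtr ?d (mmul ?d (\<lambda>i j. \<rho> x $$ (i, j)) U))"
  have ex: "\<exists>U. ?dual M w U" for M w
    by (rule trace_norm_bias_state[OF dens, where k = k and M = M and w = w]) blast+
  define U where "U M w = (SOME U. ?dual M w U)" for M w
  have dual: "?dual M w (U M w)" for M w
    unfolding U_def by (rule someI_ex[where P = "?dual M w", OF ex])
  hence U: "\<And>M w. unitary_fun ?d (U M w)"
    and tn: "\<And>M w. complex_of_real (?tn M w) =
      (\<Sum>x\<in>Zr_vecs r n. of_real (bias r n k M w x) * mtr ?d (mmul ?d (\<lambda>i j. \<rho> x $$ (i, j)) (U M w)))"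
    by (rule conjunct1, rule conjunct2)
  show ?thesis
  \<comment> \<open>The level bounds require \<open>e \<le> 1\<close> and \<open>m \<ge> 1\<close>.
    Otherwise either the trace norm, which never exceeds 1, is small enough, or every state is the
    scalar 1 and the difference vanishes.\<close>
  proof (cases "1 \<le> e \<or> m = 0")
    case True
    have le: "?tn M w \<le> min 1 e" if M: "M \<in> ?H" and w: "w \<in> Zr_vecs r k" for M w
    proof -
      note bs = sum_bias[OF r0 t0 M k w]
      have "?tn M w \<le> cmod (complex_of_real (?tn M w))" by simp
      also have "\<dots> \<le> (\<Sum>x\<in>Zr_vecs r n. \<bar>bias r n k M w x\<bar> * 1)"
        unfolding tn
      proof (rule sum_norm_le)
        fix x assume x: "x \<in> Zr_vecs r n"
        show "cmod (of_real (bias r n k M w x) * mtr ?d (mmul ?d (\<lambda>i j. \<rho> x $$ (i, j)) (U M w))) \<le> \<bar>bias r n k M w x\<bar> * 1"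
          unfolding norm_mult norm_of_real by (intro mult_left_mono unitary_expectation_le_1 R U x) simp
      qed
      also have "\<dots> \<le> 1" using bs(2) by simp
      finally have 1: "?tn M w \<le> 1" .
      show ?thesis
      proof (cases "m = 0")
        case True
        have "mtr ?d (mmul ?d (\<lambda>i j. \<rho> x $$ (i, j)) (U M w)) = U M w 0 0" if "x \<in> Zr_vecs r n" for x
        proof -
          have "\<rho> x $$ (0, 0) = 1" using R[OF that] True by (simp add: density_fun_def mtr_def)
          thus ?thesis using True by (simp add: mtr_def mmul_def)
        qed
        hence "complex_of_real (?tn M w) = of_real (\<Sum>x\<in>Zr_vecs r n. bias r n k M w x) * U M w 0 0"
          unfolding tn of_real_sum sum_distrib_right by (intro sum.cong refl) simp
        hence "?tn M w = 0" unfolding bs(1) by simp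
        thus ?thesis using e by simp
      qed (use True 1 in auto)
    qed
    have "?E \<le> (\<Sum>M\<in>?H. \<Sum>w\<in>Zr_vecs r k. min 1 e / (real (card ?H) * real r ^ k))"
      using cH r0 le by (intro sum_mono divide_right_mono) auto
    also have "\<dots> = min 1 e" using cH r0 by (simp add: card_Zr_vecs)
    finally show ?thesis by simp
  next
    case False
    hence e1: "e \<le> 1" and m: "1 \<le> m" by auto
    have ar: "\<alpha>\<^sup>2 * real (r - 1) \<le> 1"
    proof -
      have r1: "0 < real r - 1" using r by simp
      have "\<alpha>\<^sup>2 \<le> ((real r - 1) powr (-1/2))\<^sup>2" using \<alpha> by (intro power_mono) auto
      also have "\<dots> = (real r - 1) powr (-1)" using r1 by (simp add: powr_power)
      also have "\<dots> = 1 / (real r - 1)" using r1 by (simp add: powr_minus_divide)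
      finally show ?thesis using r1 r by (simp add: of_nat_diff field_simps)
    qed
    define V where "V M w = U M (Matrix.vec k w)" for M w
    define G where "G l = (\<Sum>x\<in>?X. mtr ?d (mmul ?d (\<lambda>i j. \<rho> (Matrix.vec n x) $$ (i, j)) (level_op r t n \<alpha> l V x))) / of_nat r ^ n" for l
    have "complex_of_real ?E = (\<Sum>M\<in>?H. \<Sum>w\<in>?W.
      (\<Sum>x\<in>?X. of_real (bias r n k M (Matrix.vec k w) (Matrix.vec n x)) * mtr ?d (mmul ?d (\<lambda>i j. \<rho> (Matrix.vec n x) $$ (i, j)) (V M w)))
        / (of_nat (card ?H) * of_nat r ^ k))"
      unfolding of_real_sum of_real_divide tn sum_Zr_vecs V_def by simp
    also have "\<dots> = (\<Sum>l\<in>{1..k}. G l)"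
      unfolding G_def by (rule average_bias_expansion[OF r0 k])
    finally have EG: "complex_of_real ?E = (\<Sum>l\<in>{1..k}. G l)" .
    have Gl: "cmod (G l) \<le> e / 8 * (7 / 8) ^ l" if l: "l \<in> {1..k}" for l
    proof -
      have N0: "0 < N" using l kN by (cases N) auto
      have hyp: "real m ^ t * real r ^ (t + 1) * \<alpha>\<^sup>2 \<le> (1 / 1000) ^ t * e\<^sup>2 * real N ^ (t - 2)"
        using mem t0 by (intro memory_bound_power[OF r0 t(1) N0 \<alpha>(1) e]) (simp_all add: N)
      have "cmod (\<Sum>x\<in>?X. mtr ?d (mmul ?d (\<lambda>i j. \<rho> (Matrix.vec n x) $$ (i, j)) (level_op r t n \<alpha> l V x))) / real r ^ n \<le> e / 8 * (7 / 8) ^ l"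
      proof (rule level_expectation_bound[OF r t(1) N k kN \<alpha>(1) \<alpha>2(1) ar e e1 m hyp])
        fix x assume "x \<in> ?X"
        thus "density_fun ?d (\<lambda>i j. \<rho> (Matrix.vec n x) $$ (i, j))"
          by (intro R) (auto simp: Zr_vecs_eq_image)
      qed (use l U in \<open>auto simp: V_def\<close>)
      thus ?thesis by (simp add: G_def norm_divide norm_power)
    qed
    have "?E \<le> cmod (complex_of_real ?E)" by (simp only: norm_of_real abs_ge_self)
    also have "\<dots> \<le> (\<Sum>l\<in>{1..k}. e / 8 * (7 / 8) ^ l)"
      unfolding EG by (rule sum_norm_le[OF Gl])
    also have "\<dots> = e / 8 * (\<Sum>l\<in>{1..k}. (7 / 8) ^ l)" by (simp add: sum_distrib_left)
    \<comment> \<open>The geometric series starts at level 1 and sums to at most 7, which is why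
      each level was given the prefactor 1/8.\<close>
    also have "\<dots> \<le> e / 8 * 7" using e by (intro mult_left_mono sum_geometric_seven_eighths) auto
    finally show ?thesis using e by simp
  qed
qed

theorem theorem4p5:
  "\<exists>\<gamma>::real. \<gamma> > 0 \<and>
     (\<forall>(r::nat) (t::nat) (n::nat) (\<alpha>::real) (m::nat) (\<rho> :: int Matrix.vec \<Rightarrow> complex mat) (\<epsilon>::real).
        r \<ge> 2 \<longrightarrow> t \<ge> 2 \<longrightarrow> t dvd n \<longrightarrow>
        0 < \<alpha> \<longrightarrow> \<alpha> \<le> 1 \<longrightarrow> \<alpha> * real n / real t \<in> \<int> \<longrightarrow>
        \<alpha> \<le> min (1/2) ((real r - 1) powr (-1/2)) \<longrightarrow>
        (\<forall>x \<in> Zr_vecs r n. density_matrix m (\<rho> x)) \<longrightarrow>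
        \<epsilon> > 0 \<longrightarrow>
        real m \<le> \<gamma> / real r powr (1 + 1 / real t) * (\<epsilon>\<^sup>2 / \<alpha>) powr (2 / real t)
                    * (real n / real t) powr (1 - 2 / real t) \<longrightarrow>
        (let P = joint_pmf r t n \<alpha> in
           measure_pmf.expectation (marginal_Mw P) (\<lambda>(M, w).
             trace_norm
               (complex_of_real (prob_answer P YES M w) \<cdot>\<^sub>m posterior_state r n m \<rho> P YES M w
                - complex_of_real (prob_answer P NO M w) \<cdot>\<^sub>m posterior_state r n m \<rho> P NO M w))
           \<le> \<epsilon>\<^sup>2))"
proof (rule exI[of _ "1 / 1000"], intro conjI allI impI)
  fix r t n :: nat and \<alpha> :: real and m :: nat and \<rho> :: "int Matrix.vec \<Rightarrow> complex mat" and \<epsilon> :: real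
  assume r: "2 \<le> r" and t: "2 \<le> t" "t dvd n" and \<alpha>: "0 < \<alpha>" "\<alpha> \<le> 1" "\<alpha> * real n / real t \<in> \<int>"
    "\<alpha> \<le> min (1/2) ((real r - 1) powr (-1/2))"
    and dens: "\<forall>x \<in> Zr_vecs r n. density_matrix m (\<rho> x)" and \<epsilon>: "\<epsilon> > 0"
    and mem: "real m \<le> (1 / 1000) / real r powr (1 + 1 / real t) * (\<epsilon>\<^sup>2 / \<alpha>) powr (2 / real t)
                    * (real n / real t) powr (1 - 2 / real t)"
  have rt: "0 < r" "0 < t" "0 \<le> \<alpha>" using r t \<alpha> by auto
  show "let P = joint_pmf r t n \<alpha> in
           measure_pmf.expectation (marginal_Mw P) (\<lambda>(M, w).
             trace_norm
               (complex_of_real (prob_answer P YES M w) \<cdot>\<^sub>m posterior_state r n m \<rho> P YES M w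
                - complex_of_real (prob_answer P NO M w) \<cdot>\<^sub>m posterior_state r n m \<rho> P NO M w))
           \<le> \<epsilon>\<^sup>2"
    unfolding Let_def expectation_trace_norm_eq[OF rt(1,2,3) \<alpha>(2) refl refl]
    using dens \<epsilon> by (intro average_trace_norm_le[OF r t \<alpha>(1,3,4) _ _ mem refl]) auto
qed simp

end
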